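(* Let $\alpha\ge 0$. For each $M>0$, the energy $E$ has a unique minimizer on $C_M$ (i.e. a unique nonnegative minimizer of mass $M$). The minimizer is strictly symmetric decreasing on its support. It is of class $\mathcal{C}^{1,1}$ and depends continuously on $M$ in $\mathcal{C}^{1,1}$. It increases with $M$ in the sense that for any pair of minimizers $u_1,u_2$ of mass $M_1,M_2$, $$M_1<M_2 \ \Longrightarrow\ u_1(\theta)<u_2(\theta)\quad\text{for all }\theta\in\mathrm{support}(u_1).$$ Moreover: (i) If $M(1-\alpha^2)>2\pi$, the minimizer is strictly positive and given by $$u(\theta)=\frac{M}{2\pi}+\frac{1}{1-\alpha^2}\cos\theta .$$ (ii) If $M(1-\alpha^2)<2\pi$, the minimizer is given by $$u(\theta)=A(\tau)\bigl(\cos(\alpha\theta)-\cos(\alpha\tau)\bigr)+u^0(\theta)-u^0(\tau),\qquad |\theta|\le\tau,$$ for some $\tau>0$ with $\max\{\alpha,1\}\,\tau<\pi$, and vanishes for $|\theta|\ge\tau$. The coefficient is determined by $A(\tau)=\dfrac{u^0_\theta(\tau)}{\alpha\sin(\alpha\tau)}$. (iii) If $M(1-\alpha^2)=2\pi$, then the formula in (ii) with $\tau=\pi$ coincides with the formula in (i), and the minimizer is $u(\theta)=\dfrac{1+\cos\theta}{1-\alpha^2}$. When $\alpha=0$, the formula in (ii) is understood as its limit as $\alpha\to0^+$.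
   Context: $\Omega=(-\pi,\pi)$ with periodic boundary conditions (functions on $\Omega$ are identified with $2\pi$-periodic functions; $H^1(\Omega)$ and $\mathcal{C}^{1,1}(\Omega)$ are the periodic spaces). The energy is $$E(u)=\frac12\int_\Omega \bigl(u_\theta^2-\alpha^2u^2\bigr)\,d\theta-\int_\Omega u\cos\theta\,d\theta ,$$ where $\alpha\ge0$ is a constant. For $M>0$, $$C_M=\Bigl\{u\in H^1(\Omega)\ \Big|\ u\ge0,\ \int_\Omega u\,d\theta=M\Bigr\}.$$ "Minimizer of mass $M$" means minimizer of $E$ on $C_M$. "Symmetric decreasing" means even about $\theta=0$ and nonincreasing in $|\theta|$ on $[0,\pi]$; "strictly symmetric decreasing on its support" means even and strictly decreasing in $|\theta|$ on the support. The function $u^0$ is $$u^0(\theta)=\begin{cases}-\tfrac12\theta\sin\theta, & \alpha=1,\\[4pt] \dfrac{1}{1-\alpha^2}\Bigl(\cos\theta-\dfrac{1+\alpha^2}{2\alpha}\cos(\alpha\theta)\Bigr), & \alpha\ne1,\end{cases}$$ and $u^0_\theta$ denotes its derivative. $\mathcal{C}^{1,1}$ denotes the continuously differentiable functions with Lipschitz derivative.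
   Formalization: Continuity in M in the C^{1,1} norm fails if M(1-α²)≤2π (u'' jumps at the moving point τ); proved instead: C^1 convergence with bounded Lipschitz constants of u', and C^{1,1}-norm convergence on compact intervals avoiding the boundary of {u≠0} (the full norm in case (i)). *)

theory Defs
  imports "HOL-Analysis.Analysis"
begin

text \<open>Functions on the circle are represented by \<open>2\<pi>\<close>-periodic functions on the real line;
  integrals are taken over the fundamental domain \<open>(-\<pi>, \<pi>)\<close>.\<close>

definition Omega :: "real set" where
  "Omega = {-pi<..<pi}"

definition periodic :: "(real \<Rightarrow> real) \<Rightarrow> bool" where
  "periodic u \<longleftrightarrow> (\<forall>\<theta>. u (\<theta> + 2 * pi) = u \<theta>)"

definition C1_per :: "(real \<Rightarrow> real) \<Rightarrow> bool" where
  "C1_per u \<longleftrightarrow> periodic u \<and> (\<forall>\<theta>. u differentiable (at \<theta>)) \<and> continuous_on UNIV (deriv u)"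

definition C11_per :: "(real \<Rightarrow> real) \<Rightarrow> bool" where
  "C11_per u \<longleftrightarrow> C1_per u \<and> (\<exists>L. L-lipschitz_on UNIV (deriv u))"

definition L2 :: "(real \<Rightarrow> real) \<Rightarrow> bool" where
  "L2 g \<longleftrightarrow> set_borel_measurable lborel Omega g \<and> set_integrable lborel Omega (\<lambda>\<theta>. (g \<theta>)\<^sup>2)"

text \<open>Weak derivatives on the circle: the test functions are periodic and need not vanish at
  \<open>\<plusminus>\<pi>\<close>.\<close>

definition has_weak_deriv :: "(real \<Rightarrow> real) \<Rightarrow> (real \<Rightarrow> real) \<Rightarrow> bool" where
  "has_weak_deriv u g \<longleftrightarrow> L2 g \<and>
     (\<forall>\<phi>. C1_per \<phi> \<longrightarrow>
        (LINT \<theta>:Omega|lborel. u \<theta> * deriv \<phi> \<theta>) = - (LINT \<theta>:Omega|lborel. g \<theta> * \<phi> \<theta>))"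

text \<open>Every class in \<open>H\<^sup>1\<close> of the circle has exactly one continuous periodic representative;
  this representative stands for the class. Square integrability of \<open>u\<close> is then automatic.\<close>

definition H1_per :: "(real \<Rightarrow> real) \<Rightarrow> bool" where
  "H1_per u \<longleftrightarrow> periodic u \<and> continuous_on UNIV u \<and> (\<exists>g. has_weak_deriv u g)"

text \<open>Weak derivatives are unique almost everywhere, so the choice does not affect integrals.\<close>

definition weak_deriv :: "(real \<Rightarrow> real) \<Rightarrow> real \<Rightarrow> real" where
  "weak_deriv u = (SOME g. has_weak_deriv u g)"

definition energy :: "real \<Rightarrow> (real \<Rightarrow> real) \<Rightarrow> real" where
  "energy \<alpha> u =
     1 / 2 * (LINT \<theta>:Omega|lborel. (weak_deriv u \<theta>)\<^sup>2 - \<alpha>\<^sup>2 * (u \<theta>)\<^sup>2)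
     - (LINT \<theta>:Omega|lborel. u \<theta> * cos \<theta>)"

definition admissible :: "real \<Rightarrow> (real \<Rightarrow> real) set" where
  "admissible M = {u. H1_per u \<and> (\<forall>\<theta>. 0 \<le> u \<theta>) \<and> (LINT \<theta>:Omega|lborel. u \<theta>) = M}"

definition minimizer :: "real \<Rightarrow> real \<Rightarrow> (real \<Rightarrow> real) \<Rightarrow> bool" where
  "minimizer \<alpha> M u \<longleftrightarrow> is_arg_min (energy \<alpha>) (\<lambda>v. v \<in> admissible M) u"

definition supp :: "(real \<Rightarrow> real) \<Rightarrow> real set" where
  "supp u = closure {\<theta>. u \<theta> \<noteq> 0}"

definition strictly_symm_decr_on_supp :: "(real \<Rightarrow> real) \<Rightarrow> bool" where
  "strictly_symm_decr_on_supp u \<longleftrightarrow>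
     (\<forall>\<theta>. u (- \<theta>) = u \<theta>) \<and>
     (\<forall>\<theta>1 \<in> supp u \<inter> {-pi..pi}. \<forall>\<theta>2 \<in> supp u \<inter> {-pi..pi}. \<bar>\<theta>1\<bar> < \<bar>\<theta>2\<bar> \<longrightarrow> u \<theta>2 < u \<theta>1)"

text \<open>Convergence of \<open>U\<close> to \<open>u\<close> in \<open>C\<^sup>1\<^sup>,\<^sup>1\<close>. The first three conditions are weak-* convergence in
  \<open>C\<^sup>1\<^sup>,\<^sup>1 = W\<^sup>2\<^sup>,\<^sup>\<infinity>\<close> (convergence in \<open>C\<^sup>1\<close> with eventually bounded Lipschitz constants of the
  derivatives); the last one is convergence in the \<open>C\<^sup>1\<^sup>,\<^sup>1\<close> norm on every compact interval that
  avoids the free boundary of \<open>u\<close>. If \<open>u\<close> is strictly positive, this is convergence in the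
  \<open>C\<^sup>1\<^sup>,\<^sup>1\<close> norm on the whole circle. At a free boundary, norm convergence cannot hold for the
  minimizers: their second derivatives have a jump there, whose location moves with \<open>M\<close>.\<close>

definition C11_tendsto :: "('i \<Rightarrow> real \<Rightarrow> real) \<Rightarrow> (real \<Rightarrow> real) \<Rightarrow> 'i filter \<Rightarrow> bool" where
  "C11_tendsto U u F \<longleftrightarrow>
     uniform_limit UNIV U u F \<and>
     uniform_limit UNIV (\<lambda>i. deriv (U i)) (deriv u) F \<and>
     (\<exists>L. \<forall>\<^sub>F i in F. L-lipschitz_on UNIV (deriv (U i))) \<and>
     (\<forall>a b. {a..b} \<inter> frontier {\<theta>. u \<theta> \<noteq> 0} = {} \<longrightarrow>
        (\<forall>\<epsilon>>0. \<forall>\<^sub>F i in F. \<epsilon>-lipschitz_on {a..b} (\<lambda>\<theta>. deriv (U i) \<theta> - deriv u \<theta>)))"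

definition u0 :: "real \<Rightarrow> real \<Rightarrow> real" where
  "u0 \<alpha> \<theta> =
     (if \<alpha> = 1 then - (1 / 2) * \<theta> * sin \<theta>
      else 1 / (1 - \<alpha>\<^sup>2) * (cos \<theta> - (1 + \<alpha>\<^sup>2) / (2 * \<alpha>) * cos (\<alpha> * \<theta>)))"

definition coeff_A :: "real \<Rightarrow> real \<Rightarrow> real" where
  "coeff_A \<alpha> \<tau> = deriv (u0 \<alpha>) \<tau> / (\<alpha> * sin (\<alpha> * \<tau>))"

definition droplet_pos :: "real \<Rightarrow> real \<Rightarrow> real \<Rightarrow> real" where
  "droplet_pos \<alpha> \<tau> \<theta> =
     coeff_A \<alpha> \<tau> * (cos (\<alpha> * \<theta>) - cos (\<alpha> * \<tau>)) + u0 \<alpha> \<theta> - u0 \<alpha> \<tau>"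

text \<open>At \<open>\<alpha> = 0\<close> the formula contains divisions by zero and is replaced by its limit as
  \<open>\<alpha>\<close> decreases to \<open>0\<close>.\<close>

definition droplet :: "real \<Rightarrow> real \<Rightarrow> real \<Rightarrow> real" where
  "droplet \<alpha> \<tau> \<theta> =
     (if \<alpha> = 0 then Lim (at_right 0) (\<lambda>a. droplet_pos a \<tau> \<theta>) else droplet_pos \<alpha> \<tau> \<theta>)"

end

theory Submission
  imports Defs "HOL-Complex_Analysis.Great_Picard" "HOL-Real_Asymp.Real_Asymp"
begin

text \<open>A minimizer exists by the direct method, and polarization shows that it is even and
  nonincreasing on \<open>[0, \<pi>]\<close>. If \<open>\<alpha> > 1\<close>, it vanishes outside \<open>[-\<pi>/\<alpha>, \<pi>/\<alpha>]\<close>: otherwise one period of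
  \<open>sin (\<alpha> x)\<close>, a direction in which the energy is affine, would lead to a minimizer that is not
  even. For competitors with this property (for all competitors if \<open>\<alpha> \<le> 1\<close>) the energy difference
  to the explicit droplet of the same mass is a nonnegative first variation plus a quadratic form
  that is nonnegative by Wirtinger's inequality on an interval of length at most \<open>2 \<pi> / \<alpha>\<close>.
  Hence the droplets are the only minimizers. Their slopes solve \<open>p'' + \<alpha>\<^sup>2 p = sin\<close> with zero boundary
  values, so a Wronskian argument gives strict monotonicity in the angle and in the support radius.\<close>

section \<open>Square integrable functions and absolute continuity\<close>

text \<open>On mean-zero functions of the whole circle the quadratic part of the energy is
  nonnegative only for \<open>\<alpha> \<le> 1\<close>, by Wirtinger's inequality. For
  \<open>\<alpha> > 1\<close> it is indefinite, so no direct comparison with an arbitrary competitor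
  can show that a droplet minimizes. This fixes the logical order: existence without formula, then
  evenness, then vanishing beyond \<open>pi / \<alpha>\<close>, and only then the comparison. An arc
  of length \<open>2 * pi / \<alpha>\<close> is the longest one on which the form is nonnegative.
  The droplets satisfy the strict inequality \<open>\<alpha> * \<tau> < pi\<close>, and this
  strictness yields uniqueness. Existence is obtained by strong convergence: uniform convergence of
  a minimizing sequence makes the derivatives Cauchy in L2 by the parallelogram identity, since the
  midpoint of two competitors is again a competitor. All estimates are made for a function paired
  with a density of which it is the integral. This replaces the arbitrary choice in
  \<open>weak_deriv\<close> and permits exact integration by parts. The threshold
  \<open>M * (1 - \<alpha>^2) = 2 * pi\<close> is the mass of the droplet that just covers the
  circle.\<close>

definition sqint :: "real \<Rightarrow> real \<Rightarrow> (real \<Rightarrow> real) \<Rightarrow> bool" where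
  "sqint a b g \<longleftrightarrow> g \<in> borel_measurable (lebesgue_on {a..b}) \<and> (\<lambda>x. (g x)\<^sup>2) integrable_on {a..b}"

lemma abs_mult_le_squares: "\<bar>x * y\<bar> \<le> x\<^sup>2 + (y::real)\<^sup>2"
proof -
  have "2 * (\<bar>x\<bar> * \<bar>y\<bar>) \<le> x\<^sup>2 + y\<^sup>2" using sum_squares_bound[of "\<bar>x\<bar>" "\<bar>y\<bar>"] by simp
  moreover have "0 \<le> \<bar>x\<bar> * \<bar>y\<bar>" by simp
  ultimately show ?thesis unfolding abs_mult by linarith
qed

lemma sqint_continuous_on:
  assumes "continuous_on {a..b} g"
  shows "sqint a b g"
  unfolding sqint_def using assms
  by (auto intro!: continuous_imp_measurable_on_sets_lebesgue integrable_continuous_real continuous_intros)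

lemma sqint_mult_abs_integrable:
  assumes "sqint a b f" "sqint a b g"
  shows "(\<lambda>x. f x * g x) absolutely_integrable_on {a..b}"
proof (rule measurable_bounded_by_integrable_imp_absolutely_integrable)
  show "(\<lambda>x. f x * g x) \<in> borel_measurable (lebesgue_on {a..b})"
    using assms by (auto simp: sqint_def)
  show "(\<lambda>x. (f x)\<^sup>2 + (g x)\<^sup>2) integrable_on {a..b}"
    using assms by (auto simp: sqint_def intro!: integrable_add)
qed (auto simp: abs_mult_le_squares)

lemma sqint_mult_integrable:
  assumes "sqint a b f" "sqint a b g"
  shows "(\<lambda>x. f x * g x) integrable_on {a..b}"
  using sqint_mult_abs_integrable[OF assms] absolutely_integrable_on_def by blast

lemma sqint_abs_integrable:
  assumes "sqint a b f"
  shows "f absolutely_integrable_on {a..b}"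
  using sqint_mult_abs_integrable[OF assms sqint_continuous_on[of a b "\<lambda>_. 1"]] by simp

lemma sqint_integrable: "sqint a b f \<Longrightarrow> f integrable_on {a..b}"
  using sqint_abs_integrable absolutely_integrable_on_def by blast

lemma sqint_integrable_abs: "sqint a b f \<Longrightarrow> (\<lambda>x. \<bar>f x\<bar>) integrable_on {a..b}"
  using sqint_abs_integrable[of a b f] unfolding absolutely_integrable_on_def by simp

lemma sqint_integrable_sq: "sqint a b f \<Longrightarrow> (\<lambda>x. (f x)\<^sup>2) integrable_on {a..b}"
  by (simp add: sqint_def)

lemma sqint_add:
  assumes "sqint a b f" "sqint a b g"
  shows "sqint a b (\<lambda>x. f x + g x)"
proof -
  have "(\<lambda>x. (f x)\<^sup>2 + (g x)\<^sup>2 + 2 * (f x * g x)) integrable_on {a..b}"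
    using assms sqint_mult_integrable[OF assms]
        by (auto simp: sqint_def intro!: integrable_add integrable_on_mult_right)
  then show ?thesis using assms by (auto simp: sqint_def power2_sum mult.assoc)
qed

lemma sqint_cmult:
  assumes "sqint a b f"
  shows "sqint a b (\<lambda>x. c * f x)"
  using assms by (auto simp: sqint_def power_mult_distrib intro!: integrable_on_mult_right)

lemma sqint_diff:
  assumes "sqint a b f" "sqint a b g"
  shows "sqint a b (\<lambda>x. f x - g x)"
  using sqint_add[OF assms(1) sqint_cmult[OF assms(2), of "-1"]] by simp

lemma sqint_subinterval:
  assumes "sqint a b f" "a \<le> c" "d \<le> b"
  shows "sqint c d f"
proof -
  have "{c..d} \<subseteq> {a..b}" using assms by auto
  then show ?thesis
    using assms(1) unfolding sqint_def
    by (meson integrable_on_subinterval measurable_restrict_mono)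
qed

lemma sqint_bounded_mult:
  assumes "sqint a b f" "u \<in> borel_measurable (lebesgue_on {a..b})" "\<And>x. x \<in> {a..b} \<Longrightarrow> \<bar>u x\<bar> \<le> B"
  shows "sqint a b (\<lambda>x. u x * f x)"
proof -
  have "(\<lambda>x. (u x * f x)\<^sup>2) absolutely_integrable_on {a..b}"
  proof (rule measurable_bounded_by_integrable_imp_absolutely_integrable)
    show "(\<lambda>x. (u x * f x)\<^sup>2) \<in> borel_measurable (lebesgue_on {a..b})"
      using assms by (auto simp: sqint_def)
    show "(\<lambda>x. B\<^sup>2 * (f x)\<^sup>2) integrable_on {a..b}"
      using assms by (auto simp: sqint_def intro!: integrable_on_mult_right)
    fix x assume "x \<in> {a..b}"
    then have "(u x)\<^sup>2 \<le> B\<^sup>2" using assms(3)[of x] by (metis abs_ge_zero power2_abs power_mono)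
    then show "norm ((u x * f x)\<^sup>2) \<le> B\<^sup>2 * (f x)\<^sup>2"
      by (simp add: power_mult_distrib mult_right_mono)
  qed simp
  then show ?thesis using assms unfolding sqint_def absolutely_integrable_on_def by auto
qed

lemma sqint_continuous_mult:
  assumes "sqint a b f" "continuous_on {a..b} u"
  shows "sqint a b (\<lambda>x. u x * f x)"
proof -
  have "compact (u ` {a..b})" using assms by (intro compact_continuous_image) auto
  then obtain B where "\<And>x. x \<in> {a..b} \<Longrightarrow> \<bar>u x\<bar> \<le> B"
    by (metis compact_imp_bounded bounded_iff image_eqI real_norm_def)
  then show ?thesis
    using assms by (intro sqint_bounded_mult[where B=B] continuous_imp_measurable_on_sets_lebesgue) auto
qed

lemma sqint_integral_abs_le:
  assumes "sqint a b f" "a \<le> c" "d \<le> b"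
  shows "\<bar>integral {c..d} f\<bar> \<le> integral {a..b} (\<lambda>x. \<bar>f x\<bar>)"
proof -
  have cd: "sqint c d f" by (rule sqint_subinterval[OF assms])
  have "norm (integral {c..d} f) \<le> integral {c..d} (\<lambda>x. \<bar>f x\<bar>)"
    by (rule integral_norm_bound_integral[OF sqint_integrable[OF cd] sqint_integrable_abs[OF cd]]) simp
  also have "\<dots> \<le> integral {a..b} (\<lambda>x. \<bar>f x\<bar>)"
    using assms(2,3) by (intro integral_subset_le sqint_integrable_abs[OF cd] sqint_integrable_abs[OF
        assms(1)]) auto
  finally show ?thesis by simp
qed

text \<open>Cauchy-Schwarz against the constant 1: the integral of the square of
  \<open>\<bar>f\<bar> - m\<close>, with \<open>m\<close> the mean of \<open>\<bar>f\<bar>\<close>,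
  is nonnegative.\<close>

lemma integral_abs_sq_le:
  assumes "sqint a b f" "a \<le> b"
  shows "(integral {a..b} (\<lambda>x. \<bar>f x\<bar>))\<^sup>2 \<le> (b - a) * integral {a..b} (\<lambda>x. (f x)\<^sup>2)"
proof (cases "a = b")
  case False
  define m where "m = integral {a..b} (\<lambda>x. \<bar>f x\<bar>) / (b - a)"
  define I J where "I = integral {a..b} (\<lambda>x. \<bar>f x\<bar>)" and "J = integral {a..b} (\<lambda>x. (f x)\<^sup>2)"
  have ba: "b - a > 0" using False assms by simp
  have i1: "((\<lambda>x. \<bar>f x\<bar>) has_integral I) {a..b}" "((\<lambda>x. (f x)\<^sup>2) has_integral J) {a..b}"
    using sqint_integrable_abs[OF assms(1)] sqint_integrable_sq[OF assms(1)]
    by (auto simp: I_def J_def)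
  have "((\<lambda>x. (f x)\<^sup>2 - 2 * m * \<bar>f x\<bar> + m\<^sup>2) has_integral (J - 2 * m * I + (b - a) * m\<^sup>2)) {a..b}"
    using has_integral_const_real[of "m\<^sup>2" a b] assms
    by (intro has_integral_add has_integral_diff has_integral_mult_right i1) (auto simp: content_real)
  moreover have "(f x)\<^sup>2 - 2 * m * \<bar>f x\<bar> + m\<^sup>2 = (\<bar>f x\<bar> - m)\<^sup>2" for x by (simp add: power2_diff)
  ultimately have "0 \<le> J - 2 * m * I + (b - a) * m\<^sup>2"
    by (metis (no_types, lifting) has_integral_nonneg zero_le_power2)
  also have "\<dots> = J - I\<^sup>2 / (b - a)"
    using ba unfolding m_def I_def[symmetric] by (simp add: power2_eq_square)
  finally show ?thesis using ba by (simp add: I_def J_def field_simps)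
qed simp

text \<open>The function \<open>u\<close> is absolutely continuous on \<open>[a, b]\<close> with square integrable derivative \<open>g\<close>.\<close>

definition AC2 :: "real \<Rightarrow> real \<Rightarrow> (real \<Rightarrow> real) \<Rightarrow> (real \<Rightarrow> real) \<Rightarrow> bool" where
  "AC2 a b u g \<longleftrightarrow> sqint a b g \<and> (\<forall>x\<in>{a..b}. u x = u a + integral {a..x} g)"

lemma AC2_sqint: "AC2 a b u g \<Longrightarrow> sqint a b g" by (simp add: AC2_def)

lemma AC2_continuous_on:
  assumes "AC2 a b u g"
  shows "continuous_on {a..b} u"
proof -
  have "continuous_on {a..b} (\<lambda>x. u a + integral {a..x} g)"
    using assms by (intro continuous_intros indefinite_integral_continuous_1 sqint_integrable) (auto simp: AC2_def)
  then show ?thesis using assms unfolding AC2_def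
    by (metis (no_types, lifting) continuous_on_cong)
qed

lemma AC2_diff:
  assumes "AC2 a b u g" "a \<le> x" "x \<le> y" "y \<le> b"
  shows "u y - u x = integral {x..y} g"
proof -
  have "g integrable_on {a..y}"
    using sqint_integrable[OF sqint_subinterval[of a b g a y]] assms AC2_sqint by auto
  then have "integral {a..x} g + integral {x..y} g = integral {a..y} g"
    using assms by (intro Henstock_Kurzweil_Integration.integral_combine) auto
  moreover have "u y = u a + integral {a..y} g" "u x = u a + integral {a..x} g"
    using assms unfolding AC2_def by (metis atLeastAtMost_iff order_trans)+
  ultimately show ?thesis by simp
qed

lemma AC2_subinterval:
  assumes "AC2 a b u g" "a \<le> c" "d \<le> b"
  shows "AC2 c d u g"
  unfolding AC2_def
proof (intro conjI ballI)
  show "sqint c d g" using assms sqint_subinterval AC2_sqint by blast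
  fix x assume "x \<in> {c..d}"
  then show "u x = u c + integral {c..x} g" using AC2_diff[OF assms(1), of c x] assms by auto
qed

lemma AC2_I_diff:
  assumes "sqint a b g" "\<And>x. a \<le> x \<Longrightarrow> x \<le> b \<Longrightarrow> u x - u a = integral {a..x} g"
  shows "AC2 a b u g"
  unfolding AC2_def
proof (intro conjI ballI)
  fix x assume "x \<in> {a..b}"
  then show "u x = u a + integral {a..x} g" using assms(2)[of x]
      by (metis add.commute atLeastAtMost_iff diff_add_cancel)
qed (rule assms(1))

lemma AC2_add:
  assumes "AC2 a b u g" "AC2 a b v h"
  shows "AC2 a b (\<lambda>x. u x + v x) (\<lambda>x. g x + h x)"
proof (rule AC2_I_diff)
  show "sqint a b (\<lambda>x. g x + h x)" using assms by (auto simp: AC2_def sqint_add)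
  fix x assume "a \<le> x" "x \<le> b"
  moreover from this have "sqint a x g" "sqint a x h"
    using assms AC2_sqint sqint_subinterval by (meson order_refl)+
  ultimately show "u x + v x - (u a + v a) = integral {a..x} (\<lambda>x. g x + h x)"
    using AC2_diff[OF assms(1), of a x] AC2_diff[OF assms(2), of a x]
    by (subst integral_add) (auto simp: sqint_integrable)
qed

lemma AC2_cmult:
  assumes "AC2 a b u g"
  shows "AC2 a b (\<lambda>x. c * u x) (\<lambda>x. c * g x)"
proof (rule AC2_I_diff)
  show "sqint a b (\<lambda>x. c * g x)" using assms by (simp add: AC2_sqint sqint_cmult)
  fix x assume "a \<le> x" "x \<le> b"
  then show "c * u x - c * u a = integral {a..x} (\<lambda>x. c * g x)"
    using AC2_diff[OF assms, of a x] by (simp add: right_diff_distrib[symmetric])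
qed

lemma AC2_diff_fun:
  assumes "AC2 a b u g" "AC2 a b v h"
  shows "AC2 a b (\<lambda>x. u x - v x) (\<lambda>x. g x - h x)"
  using AC2_add[OF assms(1) AC2_cmult[OF assms(2), of "-1"]] by simp

lemma AC2_const: "AC2 a b (\<lambda>_. c) (\<lambda>_. 0)"
  by (auto simp: AC2_def intro: sqint_continuous_on)

lemma AC2_C1:
  assumes "\<And>x. x \<in> {a..b} \<Longrightarrow> (u has_real_derivative u' x) (at x within {a..b})" "continuous_on {a..b} u'"
  shows "AC2 a b u u'"
proof (rule AC2_I_diff)
  fix x assume x: "a \<le> x" "x \<le> b"
  then have "(u' has_integral (u x - u a)) {a..x}"
    using assms(1) has_field_derivative_subset[of u _ _ "{a..b}" "{a..x}"]
    by (intro fundamental_theorem_of_calculus)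
       (auto simp: has_real_derivative_iff_has_vector_derivative[symmetric])
  then show "u x - u a = integral {a..x} u'" by (simp add: integral_unique)
qed (simp add: assms sqint_continuous_on)

text \<open>The increments of the defect are \<open>O((y - x) \<integral>\<^sub>x\<^sup>y (g\<^sup>2 + h\<^sup>2))\<close>, so its
  derivative vanishes everywhere.\<close>

lemma AC2_product_rule:
  assumes u: "AC2 a b u g" and v: "AC2 a b v h" and "a \<le> b"
  shows "u b * v b - u a * v a = integral {a..b} (\<lambda>x. u x * h x + v x * g x)"
proof -
  define q where "q = (\<lambda>x. u x * h x + v x * g x)"
  \<comment> \<open>The primitive \<open>N\<close> is continuous and serves as the modulus that
    forces the difference quotients of \<open>F\<close> to zero.\<close>
  define n where "n = (\<lambda>x. (g x)\<^sup>2 + (h x)\<^sup>2)"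
  define N where "N = (\<lambda>x. integral {a..x} n)"
  define F where "F = (\<lambda>x. integral {a..x} q - u x * v x)"
  have sq: "sqint a b g" "sqint a b h" using u v AC2_sqint by auto
  have cu: "continuous_on {a..b} u" "continuous_on {a..b} v" using u v AC2_continuous_on by auto
  have q_int: "q integrable_on {a..b}"
    unfolding q_def using sq cu
    by (intro integrable_add sqint_integrable sqint_continuous_mult) auto
  have n_int: "n integrable_on {a..b}"
    unfolding n_def using sq by (intro integrable_add sqint_integrable_sq)
  have N_cont: "continuous_on {a..b} N" unfolding N_def by (rule indefinite_integral_continuous_1[OF n_int])
  have incr: "\<bar>F y - F x\<bar> \<le> (y - x) * (N y - N x)" if xy: "a \<le> x" "x \<le> y" "y \<le> b" for x y
  proof -
    have sub: "{x..y} \<subseteq> {a..b}" using xy by auto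
    have sqx: "sqint x y g" "sqint x y h" using sq xy sqint_subinterval by auto
    define G H where "G = integral {x..y} (\<lambda>t. \<bar>g t\<bar>)" and "H = integral {x..y} (\<lambda>t. \<bar>h t\<bar>)"
    have G0: "0 \<le> G" "0 \<le> H" unfolding G_def H_def
      by (rule integral_nonneg[OF sqint_integrable_abs[OF sqx(1)]], simp, rule integral_nonneg[OF
          sqint_integrable_abs[OF sqx(2)]], simp)
    have ud: "\<bar>u y - u t\<bar> \<le> G" "\<bar>v t - v x\<bar> \<le> H" if t: "t \<in> {x..y}" for t
    proof -
      have "u y - u t = integral {t..y} g" "v t - v x = integral {x..t} h"
        using AC2_diff[OF u, of t y] AC2_diff[OF v, of x t] t xy by auto
      then show "\<bar>u y - u t\<bar> \<le> G" "\<bar>v t - v x\<bar> \<le> H"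
        unfolding G_def H_def using t sqx by (auto intro!: sqint_integral_abs_le)
    qed
    have hI: "(g has_integral (u y - u x)) {x..y}" "(h has_integral (v y - v x)) {x..y}"
      using sqint_integrable[OF sqx(1)] sqint_integrable[OF sqx(2)] AC2_diff[OF u, of x y] AC2_diff[OF v,
          of x y] xy
      by (auto simp: integrable_integral)
    have qi: "(q has_integral (integral {a..y} q - integral {a..x} q)) {x..y}"
    proof -
      have "q integrable_on {a..y}" using q_int xy by (auto intro: integrable_on_subinterval)
      then have "integral {a..x} q + integral {x..y} q = integral {a..y} q"
        using xy by (intro Henstock_Kurzweil_Integration.integral_combine) auto
      moreover have "q integrable_on {x..y}" using q_int sub by (auto intro: integrable_on_subinterval)
      ultimately show ?thesis by (metis add_diff_cancel_left' integrable_integral)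
    qed
    \<comment> \<open>Freezing \<open>u\<close> at the right end and \<open>v\<close> at the left
      end makes the integral exact: it telescopes to \<open>u y * v y - u x * v x\<close>. What
      remains is a product of oscillations with densities.\<close>
    have "((\<lambda>t. u y * h t + v x * g t - q t) has_integral
         (u y * (v y - v x) + v x * (u y - u x) - (integral {a..y} q - integral {a..x} q))) {x..y}"
      by (intro has_integral_add has_integral_diff has_integral_mult_right hI qi)
    moreover have "u y * (v y - v x) + v x * (u y - u x) - (integral {a..y} q - integral {a..x} q) = - (F y - F x)"
      by (simp add: F_def algebra_simps)
    moreover have "u y * h t + v x * g t - q t = (u y - u t) * h t + (v x - v t) * g t" for t
      by (simp add: q_def algebra_simps)
    ultimately have I: "((\<lambda>t. (u y - u t) * h t + (v x - v t) * g t) has_integral - (F y - F x)) {x..y}" by simp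
    have J: "((\<lambda>t. G * \<bar>h t\<bar> + H * \<bar>g t\<bar>) has_integral (G * H + H * G)) {x..y}"
      unfolding G_def H_def
      by (intro has_integral_add has_integral_mult_right integrable_integral sqint_integrable_abs sqx)
    have "norm (- (F y - F x)) \<le> G * H + H * G"
    proof (rule integral_norm_bound_integral[of "\<lambda>t. (u y - u t) * h t + (v x
        - v t) * g t" "{x..y}" "\<lambda>t. G * \<bar>h t\<bar> + H * \<bar>g t\<bar>",
               unfolded integral_unique[OF I] integral_unique[OF J]])
      show "(\<lambda>t. (u y - u t) * h t + (v x - v t) * g t) integrable_on {x..y}" using I by blast
      show "(\<lambda>t. G * \<bar>h t\<bar> + H * \<bar>g t\<bar>) integrable_on {x..y}" using J by blast
      fix t assume t: "t \<in> {x..y}"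
      have "\<bar>(u y - u t) * h t\<bar> \<le> G * \<bar>h t\<bar>" "\<bar>(v x - v t) * g t\<bar> \<le> H * \<bar>g t\<bar>"
        using ud[OF t] by (simp_all add: abs_mult abs_minus_commute mult_right_mono)
      then show "norm ((u y - u t) * h t + (v x - v t) * g t) \<le> G * \<bar>h t\<bar> + H * \<bar>g t\<bar>" by simp
    qed
    also have "G * H + H * G \<le> G\<^sup>2 + H\<^sup>2" using sum_squares_bound[of G H] by (simp add: algebra_simps)
    also have "\<dots> \<le> (y - x) * integral {x..y} (\<lambda>t. (g t)\<^sup>2) + (y - x) * integral {x..y} (\<lambda>t. (h t)\<^sup>2)"
      unfolding G_def H_def using integral_abs_sq_le[OF sqx(1)] integral_abs_sq_le[OF sqx(2)] xy
          by (intro add_mono) auto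
    also have "\<dots> = (y - x) * integral {x..y} n"
      unfolding n_def using sqx by (subst integral_add) (auto simp: sqint_integrable_sq algebra_simps)
    also have "integral {x..y} n = N y - N x"
    proof -
      have "n integrable_on {a..y}" using n_int xy by (auto intro: integrable_on_subinterval)
      then have "integral {a..x} n + integral {x..y} n = integral {a..y} n"
        using xy by (intro Henstock_Kurzweil_Integration.integral_combine) auto
      then show ?thesis by (simp add: N_def)
    qed
    finally show ?thesis by simp
  qed
  have incr': "\<bar>F y - F x\<bar> \<le> \<bar>y - x\<bar> * \<bar>N y - N x\<bar>" if "x \<in> {a..b}" "y \<in> {a..b}" for x y
  proof (cases "x \<le> y")
    case True
    then have "\<bar>F y - F x\<bar> \<le> (y - x) * (N y - N x)" using incr[of x y] that by auto
    also have "\<dots> \<le> \<bar>(y - x) * (N y - N x)\<bar>" by simp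
    finally show ?thesis by (simp add: abs_mult)
  next
    case False
    then have "\<bar>F x - F y\<bar> \<le> (x - y) * (N x - N y)" using incr[of y x] that by auto
    also have "\<dots> \<le> \<bar>(x - y) * (N x - N y)\<bar>" by simp
    finally show ?thesis by (simp add: abs_mult abs_minus_commute)
  qed
  \<comment> \<open>The quotient is bounded by \<open>\<bar>N y - N x\<bar>\<close> at every point,
    so no exceptional null set arises and \<open>F\<close> is constant.\<close>
  have "(F has_real_derivative 0) (at x within {a..b})" if x: "x \<in> {a..b}" for x
    unfolding has_field_derivative_iff
  proof (rule Lim_null_comparison)
    show "((\<lambda>y. \<bar>N y - N x\<bar>) \<longlongrightarrow> 0) (at x within {a..b})"
    proof -
      have "(N \<longlongrightarrow> N x) (at x within {a..b})" using N_cont x by (simp add: continuous_on_def)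
      then show ?thesis by (intro tendsto_rabs_zero LIM_zero)
    qed
    show "\<forall>\<^sub>F y in at x within {a..b}. norm ((F y - F x) / (y - x)) \<le> \<bar>N y - N x\<bar>"
      unfolding eventually_at_filter
    proof (intro always_eventually allI impI)
      fix y assume "y \<noteq> x" "y \<in> {a..b}"
      then show "norm ((F y - F x) / (y - x)) \<le> \<bar>N y - N x\<bar>"
        using incr'[OF x, of y] by (simp add: pos_divide_le_eq mult.commute)
    qed
  qed
  then obtain c where "\<And>x. x \<in> {a..b} \<Longrightarrow> F x = c"
    using has_field_derivative_zero_constant[of "{a..b}" F] by auto
  then have "F b = F a" using \<open>a \<le> b\<close> by simp
  then show ?thesis by (simp add: F_def q_def)
qed

lemma AC2_mult:
  assumes u: "AC2 a b u g" and v: "AC2 a b v h"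
  shows "AC2 a b (\<lambda>x. u x * v x) (\<lambda>x. u x * h x + v x * g x)"
proof (rule AC2_I_diff)
  show "sqint a b (\<lambda>x. u x * h x + v x * g x)"
    by (rule sqint_add[OF sqint_continuous_mult[OF AC2_sqint[OF v] AC2_continuous_on[OF u]]
          sqint_continuous_mult[OF AC2_sqint[OF u] AC2_continuous_on[OF v]]])
  fix x assume x: "a \<le> x" "x \<le> b"
  show "u x * v x - u a * v a = integral {a..x} (\<lambda>x. u x * h x + v x * g x)"
    by (rule AC2_product_rule[OF AC2_subinterval[OF u order_refl x(2)] AC2_subinterval[OF v order_refl x(2)] x(1)])
qed

section \<open>Wirtinger's inequality\<close>

text \<open>With \<open>c t = - tan (k (t - m))\<close>, which satisfies \<open>c' = - k (1 + c\<^sup>2)\<close>, the integrand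
  \<open>h\<^sup>2 - k\<^sup>2 w\<^sup>2 - (k w\<^sup>2 c)'\<close> is the square of \<open>h - k c w\<close>.\<close>

lemma AC2_tan_estimate:
  assumes w: "AC2 x y w h" and "x \<le> y" and k: "\<And>t. x \<le> t \<Longrightarrow> t \<le> y \<Longrightarrow> \<bar>k * (t - m)\<bar> < pi / 2"
  shows "k * ((w x)\<^sup>2 * tan (k * (x - m)) - (w y)\<^sup>2 * tan (k * (y - m)))
         \<le> integral {x..y} (\<lambda>t. (h t)\<^sup>2) - k\<^sup>2 * integral {x..y} (\<lambda>t. (w t)\<^sup>2)"
proof -
  define c where "c = (\<lambda>t. - tan (k * (t - m)))"
  define c' where "c' = (\<lambda>t. - (k * (1 + (c t)\<^sup>2)))"
  have cos0: "cos (k * (t - m)) \<noteq> 0" if "t \<in> {x..y}" for t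
  proof -
    have "\<bar>k * (t - m)\<bar> < pi / 2" using k that by simp
    then have "- (pi / 2) < k * (t - m)" "k * (t - m) < pi / 2" unfolding abs_less_iff by linarith+
    then show ?thesis using cos_gt_zero_pi by force
  qed
  have c_deriv: "(c has_real_derivative c' t) (at t within {x..y})" if "t \<in> {x..y}" for t
  proof -
    have "(c has_real_derivative - (inverse ((cos (k * (t - m)))\<^sup>2) * k)) (at t)"
      unfolding c_def using cos0[OF that] by (auto intro!: derivative_eq_intros)
    moreover have "inverse ((cos (k * (t - m)))\<^sup>2) = 1 + (c t)\<^sup>2"
      using tan_sec[OF cos0[OF that]] by (simp add: c_def power_inverse)
    ultimately show ?thesis by (simp add: c'_def mult.commute has_field_derivative_at_within)
  qed
  have c_cont: "continuous_on {x..y} c"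
    unfolding c_def using cos0 by (auto intro!: continuous_intros)
  have c: "AC2 x y c c'"
    by (rule AC2_C1[OF c_deriv]) (auto simp: c'_def intro!: continuous_intros c_cont)
  note w_cont = AC2_continuous_on[OF w]
  have h: "sqint x y h" using w by (rule AC2_sqint)
  have prod: "((\<lambda>t. w t * w t * c' t + c t * (w t * h t + w t * h t)) has_integral
        (w y * w y * c y - w x * w x * c x)) {x..y}"
    unfolding AC2_product_rule[OF AC2_mult[OF w w] c \<open>x \<le> y\<close>]
    by (intro integrable_integral sqint_integrable sqint_add sqint_continuous_mult AC2_sqint[OF c] h)
       (auto intro!: continuous_intros w_cont c_cont)
  have I: "((\<lambda>t. (h t)\<^sup>2 - k\<^sup>2 * (w t)\<^sup>2 - k * (w t * w t * c' t + c t * (w t * h t + w t * h t)))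
      has_integral (integral {x..y} (\<lambda>t. (h t)\<^sup>2) - k\<^sup>2 * integral {x..y} (\<lambda>t. (w t)\<^sup>2)
           - k * (w y * w y * c y - w x * w x * c x))) {x..y}"
    by (intro has_integral_diff has_integral_mult_right prod integrable_integral sqint_integrable_sq h
        sqint_continuous_on w_cont)
  have "(h t)\<^sup>2 - k\<^sup>2 * (w t)\<^sup>2 - k * (w t * w t * c' t + c t * (w t * h t + w t * h t))
        = (h t - k * c t * w t)\<^sup>2" for t
    by (simp add: c'_def power2_eq_square algebra_simps)
  then have "0 \<le> integral {x..y} (\<lambda>t. (h t)\<^sup>2) - k\<^sup>2 * integral {x..y} (\<lambda>t. (w t)\<^sup>2)
           - k * (w y * w y * c y - w x * w x * c x)"
    using has_integral_nonneg[OF I] by simp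
  then show ?thesis by (simp add: c_def power2_eq_square algebra_simps)
qed

text \<open>By the intermediate value theorem \<open>w z = w (z + b)\<close> for some \<open>z\<close>, so
  \<open>w - w z\<close> vanishes at two points half a period apart, and both arcs carry a tangent as in the
  previous lemma; the boundary terms at \<open>\<plusminus>b\<close> cancel.\<close>

lemma wirtinger:
  assumes w: "AC2 (-b) b w h" and "b > 0" and wb: "w (-b) = w b" and w0: "integral {-b..b} w = 0"
  shows "(pi / b)\<^sup>2 * integral {-b..b} (\<lambda>t. (w t)\<^sup>2) \<le> integral {-b..b} (\<lambda>t. (h t)\<^sup>2)"
proof -
  have w_cont: "continuous_on {-b..b} w" using w by (rule AC2_continuous_on)
  have "\<exists>z. -b \<le> z \<and> z \<le> 0 \<and> w z - w (z + b) = 0"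
  proof -
    define f where "f = (\<lambda>z. w z - w (z + b))"
    have f_cont: "continuous_on {-b..0} f"
      unfolding f_def by (intro continuous_intros continuous_on_subset[OF w_cont] continuous_on_compose2[OF
          w_cont]) (use \<open>b > 0\<close> in auto)
    have "f 0 = - f (-b)" using wb by (simp add: f_def)
    then consider "f (-b) \<le> 0 \<and> 0 \<le> f 0" | "f 0 \<le> 0 \<and> 0 \<le> f (-b)" by linarith
    then show ?thesis
    proof cases
      case 1 then show ?thesis using IVT'[of f "-b" 0 0] f_cont \<open>b > 0\<close> by (auto simp: f_def)
    next
      case 2 then show ?thesis using IVT2'[of f 0 0 "-b"] f_cont \<open>b > 0\<close> by (auto simp: f_def)
    qed
  qed
  then obtain z where z: "-b \<le> z" "z \<le> 0" "w (z + b) = w z" by auto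
  define v where "v = (\<lambda>t. w t - w z)"
  have v: "AC2 (-b) b v h" unfolding v_def using AC2_diff_fun[OF w AC2_const, of "w z"] by simp
  have v_cont: "continuous_on {-b..b} v" using v by (rule AC2_continuous_on)
  have h: "sqint (-b) b h" using w by (rule AC2_sqint)
  have v0: "v z = 0" "v (z + b) = 0" "v (-b) = v b" using z wb by (auto simp: v_def)
  have split: "integral {-b..z} f + integral {z..z+b} f + integral {z+b..b} f = integral {-b..b} f"
    if "f integrable_on {-b..b}" for f :: "real \<Rightarrow> real"
  proof -
    have "f integrable_on {z..b}" using that z by (auto intro: integrable_on_subinterval)
    then show ?thesis
      using Henstock_Kurzweil_Integration.integral_combine[of "-b" z b f]
        Henstock_Kurzweil_Integration.integral_combine[of z "z+b" b f] that z \<open>b > 0\<close> by auto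
  qed
  \<comment> \<open>For \<open>k\<close> strictly below \<open>pi / b\<close> the tangent stays
    finite on closed arcs of half-length \<open>b / 2\<close>; the sharp constant is recovered by a
    limit at the end.\<close>
  have est: "k\<^sup>2 * integral {-b..b} (\<lambda>t. (w t)\<^sup>2) \<le> integral {-b..b} (\<lambda>t. (h t)\<^sup>2)"
    if k: "0 < k" "k < pi / b" for k
  proof -
    have kb: "k * b < pi" using k \<open>b > 0\<close> by (simp add: field_simps)
    have small: "\<bar>k * s\<bar> < pi / 2" if "\<bar>s\<bar> \<le> b / 2" for s
    proof -
      have "\<bar>k * s\<bar> \<le> k * (b / 2)" using that k by (simp add: abs_mult)
      then show ?thesis using kb by simp
    qed
    \<comment> \<open>The centres below are the midpoints of the two arcs between the zeros
      \<open>z\<close> and \<open>z + b\<close>. The second arc is cut at \<open>b\<close>, so its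
      centre appears as \<open>z + 3 * b / 2\<close> on one side and as \<open>z - b / 2\<close> on
      the other.\<close>
    let ?D = "\<lambda>x y. integral {x..y} (\<lambda>t. (h t)\<^sup>2) - k\<^sup>2 * integral {x..y} (\<lambda>t. (v t)\<^sup>2)"
    have "0 \<le> ?D z (z + b)"
      using AC2_tan_estimate[OF AC2_subinterval[OF v, of z "z + b"] _ small, of "z + b / 2"] z \<open>b > 0\<close> v0
      by (auto simp: abs_le_iff field_simps)
    moreover have "- k * ((v b)\<^sup>2 * tan (k * (- b / 2 - z))) \<le> ?D (z + b) b"
    proof -
      have "b - (z + 3 * b / 2) = - b / 2 - z" by (simp add: field_simps)
      then show ?thesis
        using AC2_tan_estimate[OF AC2_subinterval[OF v, of "z + b" b] _ small, of "z + 3 * b / 2"] z \<open>b > 0\<close> v0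
        by (auto simp: abs_le_iff field_simps)
    qed
    moreover have "k * ((v b)\<^sup>2 * tan (k * (- b / 2 - z))) \<le> ?D (-b) z"
    proof -
      have "- b - (z - b / 2) = - b / 2 - z" by (simp add: field_simps)
      then show ?thesis
        using AC2_tan_estimate[OF AC2_subinterval[OF v, of "-b" z] _ small, of "z - b / 2"] z \<open>b > 0\<close> v0
        by (auto simp: abs_le_iff field_simps)
    qed
    ultimately have "0 \<le> ?D (-b) z + ?D z (z + b) + ?D (z + b) b" by linarith
    also have "\<dots> = ?D (-b) b"
      unfolding split[OF sqint_integrable_sq[OF h], symmetric]
        split[OF sqint_integrable_sq[OF sqint_continuous_on[OF v_cont]], symmetric]
      by (simp add: algebra_simps)
    finally have "k\<^sup>2 * integral {-b..b} (\<lambda>t. (v t)\<^sup>2) \<le> integral {-b..b} (\<lambda>t. (h t)\<^sup>2)" by simp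
    \<comment> \<open>Since \<open>w\<close> has mean zero, subtracting the constant
      \<open>w z\<close> can only increase the L2 norm.\<close>
    moreover have "integral {-b..b} (\<lambda>t. (w t)\<^sup>2) \<le> integral {-b..b} (\<lambda>t. (v t)\<^sup>2)"
    proof -
      have "((\<lambda>t. (w t)\<^sup>2 - 2 * w z * w t + (w z)\<^sup>2) has_integral
            (integral {-b..b} (\<lambda>t. (w t)\<^sup>2) - 2 * w z * integral {-b..b} w + (b - - b) * (w z)\<^sup>2)) {-b..b}"
        using has_integral_const_real[of "(w z)\<^sup>2" "-b" b] \<open>b > 0\<close>
        by (intro has_integral_add has_integral_diff has_integral_mult_right integrable_integral
            integrable_continuous_real continuous_intros w_cont) (auto simp: content_real)
      moreover have "(w t)\<^sup>2 - 2 * w z * w t + (w z)\<^sup>2 = (v t)\<^sup>2" for t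
        by (simp add: v_def power2_diff)
      ultimately have "integral {-b..b} (\<lambda>t. (v t)\<^sup>2) = integral {-b..b} (\<lambda>t. (w t)\<^sup>2) + 2 * b * (w z)\<^sup>2"
        using w0 by (simp add: integral_unique)
      then show ?thesis using \<open>b > 0\<close> by simp
    qed
    ultimately show ?thesis by (meson mult_left_mono order_trans zero_le_power2)
  qed
  show ?thesis
  \<comment> \<open>The factor \<open>c < 1\<close> plays the role of \<open>(k * b / pi)^2\<close>;
    letting it tend to 1 gives the constant \<open>pi / b\<close>.\<close>
  proof (rule field_le_mult_one_interval)
    fix c :: real assume c: "0 < c" "c < 1"
    then have "sqrt c * (pi / b) < pi / b" using \<open>b > 0\<close> by (simp add: field_simps)
    then show "c * ((pi / b)\<^sup>2 * integral {-b..b} (\<lambda>t. (w t)\<^sup>2)) \<le> integral {-b..b} (\<lambda>t. (h t)\<^sup>2)"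
      using est[of "sqrt c * (pi / b)"] c \<open>b > 0\<close> by (simp add: power_mult_distrib power_divide)
  qed
qed

section \<open>Uniqueness of the density of an absolutely continuous function\<close>

lemma AE_zero_of_integral_Icc:
  fixes f :: "real \<Rightarrow> real"
  assumes f: "integrable lborel f" and total: "integral\<^sup>L lborel f = 0"
    and Icc: "\<And>c d. c \<le> d \<Longrightarrow> (LINT x:{c..d}|lborel. f x) = 0"
  shows "AE x in lborel. f x = 0"
proof (rule sigma_finite_measure.density_zero[OF sigma_finite_lborel f])
  have on: "set_integrable lborel A f" if "A \<in> sets borel" for A
    unfolding set_integrable_def using that f by (intro integrable_mult_indicator) auto
  fix A :: "real set" assume "A \<in> sets lborel"
  then have "A \<in> sets borel" by simp
  then show "(LINT x:A|lborel. f x) = 0"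
  \<comment> \<open>Vanishing on intervals spreads to all Borel sets; the complement step is where
    the vanishing of the total integral enters.\<close>
  proof (induction rule: borel_set_induct)
    case (compl A)
    have "(LINT x:A \<union> - A|lborel. f x) = (LINT x:A|lborel. f x) + (LINT x:-A|lborel. f x)"
      using compl by (intro set_integral_Un on) auto
    then show ?case using compl total by (simp add: set_lebesgue_integral_def)
  next
    case (union F)
    have "(LINT x:(\<Union>i. F i)|lborel. f x) = (\<Sum>i. (LINT x:F i|lborel. f x))"
      using union by (intro lebesgue_integral_countable_add on) (auto simp: disjoint_family_on_def)
    then show ?case using union by simp
  qed (use Icc in \<open>auto simp: set_lebesgue_integral_def\<close>)
qed

text \<open>The definitions use \<open>lborel\<close>, the calculus uses the completed measure.
  Borel measurability of \<open>f\<close> is what allows leaving the completion.\<close>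

lemma abs_integrable_Icc_lborel:
  assumes "f \<in> borel_measurable borel" "f absolutely_integrable_on {a..b::real}"
  shows "set_integrable lborel {a..b} (f :: real \<Rightarrow> real)"
proof -
  have "integrable (completion lborel) (\<lambda>x. indicat_real {a..b} x *\<^sub>R f x)"
    using assms(2) by (simp add: set_integrable_def)
  then show ?thesis unfolding set_integrable_def
    using assms(1) by (subst (asm) integrable_completion) auto
qed

lemma sqint_borel: "g \<in> borel_measurable borel \<Longrightarrow> (\<lambda>x. (g x)\<^sup>2) integrable_on {a..b} \<Longrightarrow> sqint a b g"
  unfolding sqint_def by (auto intro!: measurable_restrict_space1 measurable_completion)

text \<open>The difference of the two densities integrates to zero over every interval.\<close>

lemma AC2_deriv_unique:
  assumes g: "AC2 a b u g" and h: "AC2 a b u h" and "a \<le> b"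
    and meas: "g \<in> borel_measurable borel" "h \<in> borel_measurable borel"
  shows "negligible {x \<in> {a..b}. g x \<noteq> h x}"
proof -
  define d where "d = (\<lambda>x. g x - h x)"
  have d: "AC2 a b (\<lambda>_. 0) d" unfolding d_def using AC2_diff_fun[OF g h] by simp
  have d_meas: "d \<in> borel_measurable borel" using meas by (simp add: d_def)
  have int: "set_integrable lborel {a..b} d"
    using d_meas sqint_abs_integrable[OF AC2_sqint[OF d]] by (rule abs_integrable_Icc_lborel)
  have "AE x in lborel. indicat_real {a..b} x *\<^sub>R d x = 0"
  proof (rule AE_zero_of_integral_Icc)
    show "integrable lborel (\<lambda>x. indicat_real {a..b} x *\<^sub>R d x)" using int by (simp add: set_integrable_def)
    have sub: "(LINT x:{c..e}|lborel. d x) = 0" if "a \<le> c" "e \<le> b" for c e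
    proof (cases "c \<le> e")
      case True
      have "set_integrable lborel {c..e} d" using int that by (auto intro: set_integrable_subset)
      then have "(LINT x:{c..e}|lborel. d x) = integral {c..e} d" by (rule set_borel_integral_eq_integral)
      also have "\<dots> = 0" using AC2_diff[OF d, of c e] that True by simp
      finally show ?thesis .
    qed (simp add: set_lebesgue_integral_def)
    show "integral\<^sup>L lborel (\<lambda>x. indicat_real {a..b} x *\<^sub>R d x) = 0"
      using sub[of a b] by (simp add: set_lebesgue_integral_def)
    fix c e :: real
    have "indicat_real {c..e} x *\<^sub>R (indicat_real {a..b} x *\<^sub>R d x)
        = indicat_real {max a c..min b e} x *\<^sub>R d x" for x
      by (auto simp: indicator_def)
    then show "(LINT x:{c..e}|lborel. indicat_real {a..b} x *\<^sub>R d x) = 0"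
      using sub[of "max a c" "min b e"] unfolding set_lebesgue_integral_def
          by (simp only: max.cobounded1 min.cobounded1)
  qed
  then have "AE x in lebesgue. indicat_real {a..b} x *\<^sub>R d x = 0" by (rule AE_completion)
  then have "negligible {x. \<not> indicat_real {a..b} x *\<^sub>R d x = 0}"
    unfolding eventually_ae_filter_negligible using negligible_subset by blast
  moreover have "{x. \<not> indicat_real {a..b} x *\<^sub>R d x = 0} = {x \<in> {a..b}. g x \<noteq> h x}"
    by (auto simp: d_def indicator_def)
  ultimately show ?thesis by simp
qed

text \<open>Makes the Dirichlet integral independent of the chosen derivative.\<close>

lemma AC2_deriv_unique_sq:
  assumes "AC2 a b u g" "AC2 a b u h" "a \<le> b"
    and "g \<in> borel_measurable borel" "h \<in> borel_measurable borel"
  shows "integral {a..b} (\<lambda>x. (g x)\<^sup>2) = integral {a..b} (\<lambda>x. (h x)\<^sup>2)"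
  by (rule integral_spike[OF AC2_deriv_unique[OF assms]]) auto

section \<open>Periodic functions and weak derivatives\<close>

lemma periodic_add_int:
  assumes "periodic u"
  shows "u (x + 2 * pi * of_int k) = u x"
proof (induction k rule: int_induct[where k=0])
  case (step1 i)
  have "u (x + 2 * pi * of_int i + 2 * pi) = u (x + 2 * pi * of_int i)" using assms by (simp only: periodic_def)
  then show ?case using step1 by (simp add: algebra_simps)
next
  case (step2 i)
  have "u (x + 2 * pi * of_int (i - 1) + 2 * pi) = u (x + 2 * pi * of_int (i - 1))" using assms
      by (simp only: periodic_def)
  then show ?case using step2 by (simp add: algebra_simps)
qed simp

lemma periodic_diff_int: "periodic u \<Longrightarrow> u (x - 2 * pi * of_int k) = u x"
  using periodic_add_int[of u x "- k"] by simp

text \<open>Composition with \<open>wrap\<close> extends a function on one period to a periodic one;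
  all competitors are built in this way.\<close>

definition wrap :: "real \<Rightarrow> real" where
  "wrap x = x - 2 * pi * of_int \<lfloor>(x + pi) / (2 * pi)\<rfloor>"

lemma wrap_bounds: "- pi \<le> wrap x" "wrap x < pi"
proof -
  define q where "q = (x + pi) / (2 * pi)"
  have q: "2 * pi * q = x + pi" by (simp add: q_def)
  have "2 * pi * of_int \<lfloor>q\<rfloor> \<le> 2 * pi * q" by (intro mult_left_mono) auto
  moreover have "2 * pi * q < 2 * pi * (of_int \<lfloor>q\<rfloor> + 1)" by (intro mult_strict_left_mono) auto
  ultimately show "- pi \<le> wrap x" "wrap x < pi"
    unfolding wrap_def q_def[symmetric] q by (simp_all add: distrib_left)
qed

lemma wrap_eq: "- pi \<le> x \<Longrightarrow> x < pi \<Longrightarrow> wrap x = x"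
proof -
  assume "- pi \<le> x" "x < pi"
  then have "\<lfloor>(x + pi) / (2 * pi)\<rfloor> = 0" by (simp add: floor_eq_iff)
  then show ?thesis by (simp add: wrap_def)
qed

lemma wrap_periodic: "wrap (x + 2 * pi) = wrap x"
proof -
  have "(x + 2 * pi + pi) / (2 * pi) = (x + pi) / (2 * pi) + 1" by (simp add: field_simps)
  then show ?thesis by (simp add: wrap_def algebra_simps)
qed

lemma periodic_wrap: "periodic (\<lambda>x. f (wrap x))"
  by (simp add: periodic_def wrap_periodic)

lemma wrap_of_periodic: "periodic u \<Longrightarrow> u (wrap x) = u x"
  by (simp add: wrap_def periodic_diff_int)

lemma wrap_borel [measurable]: "wrap \<in> borel_measurable borel"
  unfolding wrap_def by measurable

text \<open>Only \<open>x = pi\<close> is critical: it is sent to \<open>-pi\<close>, hence the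
  matching of the end values.\<close>

lemma wrap_comp_eq:
  assumes "f pi = f (-pi)" "x \<in> {-pi..pi}"
  shows "f (wrap x) = f x"
proof (cases "x = pi")
  case True
  have "wrap (- pi + 2 * pi) = wrap (- pi)" by (rule wrap_periodic)
  then show ?thesis using True assms by (simp add: wrap_eq)
qed (use assms in \<open>simp add: wrap_eq\<close>)

text \<open>Two adjacent closed periods are glued, because every point has a translate in the
  interior of their union, even a multiple of the junction \<open>pi\<close>.\<close>

lemma periodic_continuous_on_UNIV:
  assumes p: "periodic u" and c: "continuous_on {-pi..pi} u"
  shows "continuous_on UNIV u"
proof -
  have "continuous_on {pi..3*pi} (\<lambda>x. u (x - 2 * pi))"
    by (rule continuous_on_compose2[OF c]) (auto intro!: continuous_intros)
  moreover have "u (x - 2 * pi) = u x" for x using periodic_diff_int[OF p, of x 1] by simp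
  ultimately have "continuous_on {pi..3*pi} u" by simp
  then have "continuous_on ({-pi..pi} \<union> {pi..3*pi}) u" using c by (intro continuous_on_closed_Un) auto
  then have c3: "continuous_on {-pi<..<3*pi} u" by (rule continuous_on_subset) auto
  have "isCont u x" for x
  proof -
    define k where "k = \<lfloor>(x + pi) / (2 * pi)\<rfloor> - 1"
    have "-pi < x - 2 * pi * of_int k" "x - 2 * pi * of_int k < 3 * pi"
      using wrap_bounds[of x] pi_gt_zero by (simp_all add: wrap_def k_def algebra_simps)
    then have "isCont u (x - 2 * pi * of_int k)"
      using c3 by (simp add: continuous_on_eq_continuous_at)
    then have "isCont (\<lambda>x. u (x - 2 * pi * of_int k)) x"
      by (intro continuous_within_compose3[where f = "\<lambda>x. x - 2 * pi * of_int k" and g = u]) auto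
    then show ?thesis by (simp add: periodic_diff_int[OF p])
  qed
  then show ?thesis by (simp add: continuous_at_imp_continuous_on)
qed

text \<open>The increment of a primitive over one period does not depend on the starting point, and
  over the base period it is the integral of \<open>P\<close>, that is, zero. Supplies the test
  functions for weak derivatives.\<close>

lemma periodic_antiderivative:
  assumes p: "periodic P" and c: "continuous_on UNIV P" and 0: "integral {-pi..pi} P = 0"
  obtains V where "periodic V" "\<And>x. (V has_real_derivative P x) (at x)"
proof -
  define V where "V = (\<lambda>x. LBINT y=0..x. P y)"
  have V: "(V has_real_derivative P x) (at x)" for x
  proof -
    have "((\<lambda>u. LBINT y=ereal 0..ereal u. P y) has_vector_derivative P x) (at x within {-\<bar>x\<bar>-1..\<bar>x\<bar>+1})"
      by (rule interval_integral_FTC2) (auto intro: continuous_on_subset[OF c])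
    then have "(V has_real_derivative P x) (at x within {-\<bar>x\<bar>-1..\<bar>x\<bar>+1})"
      unfolding V_def has_real_derivative_iff_has_vector_derivative by (simp add: zero_ereal_def)
    moreover have "x \<in> interior {-\<bar>x\<bar>-1..\<bar>x\<bar>+1}" by (auto simp: interior_atLeastAtMost_real)
    ultimately show ?thesis by (metis at_within_interior)
  qed
  have "((\<lambda>x. V (x + 2 * pi) - V x) has_real_derivative 0) (at x)" for x
  proof -
    have "((\<lambda>x. V (x + 2 * pi)) has_real_derivative P (x + 2 * pi)) (at x)"
      using V[of "x + 2 * pi"] by (simp add: DERIV_shift)
    then show ?thesis using V[of x] p by (auto intro!: derivative_eq_intros simp: periodic_def)
  qed
  then have "\<exists>c. \<forall>x\<in>UNIV. V (x + 2 * pi) - V x = c"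
    by (intro has_field_derivative_zero_constant) auto
  then obtain c where c: "\<And>x. V (x + 2 * pi) - V x = c" by auto
  have "(P has_integral V pi - V (-pi)) {-pi..pi}"
    by (intro fundamental_theorem_of_calculus) (auto simp:
        has_real_derivative_iff_has_vector_derivative[symmetric] intro: has_field_derivative_at_within V)
  then have "V pi - V (-pi) = 0" using 0 by (simp add: integral_unique)
  then have "c = 0" using c[of "-pi"] by simp
  then have "periodic V" using c by (simp add: periodic_def)
  then show ?thesis using V that by blast
qed

lemma C1_per_I:
  assumes "periodic V" "\<And>x. (V has_real_derivative P x) (at x)" "continuous_on UNIV P"
  shows "C1_per V" "deriv V = P"
proof -
  show d: "deriv V = P" using assms(2) by (auto intro: DERIV_imp_deriv)
  show "C1_per V" unfolding C1_per_def d using assms real_differentiable_def by blast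
qed

lemma C1_per_deriv:
  assumes "C1_per V"
  shows "(V has_real_derivative deriv V x) (at x)" "continuous_on UNIV (deriv V)" "periodic V"
  using assms unfolding C1_per_def
  by (auto simp: real_differentiable_def DERIV_deriv_iff_real_differentiable)

lemma C1_per_AC2:
  assumes "C1_per V"
  shows "AC2 a b V (deriv V)"
  using C1_per_deriv[OF assms]
  by (intro AC2_C1) (auto intro: has_field_derivative_at_within continuous_on_subset)

section \<open>Integrals over \<open>Omega\<close> and weak derivatives\<close>

lemma LINT_Omega:
  fixes f :: "real \<Rightarrow> real"
  assumes "f \<in> borel_measurable borel" "f absolutely_integrable_on {-pi..pi}"
  shows "set_integrable lborel Omega f" "(LINT x:Omega|lborel. f x) = integral {-pi..pi} f"
proof -
  show i: "set_integrable lborel Omega f"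
    using abs_integrable_Icc_lborel[OF assms] unfolding Omega_def by (rule set_integrable_subset) auto
  show "(LINT x:Omega|lborel. f x) = integral {-pi..pi} f"
    using set_borel_integral_eq_integral(2)[OF i] by (simp add: Omega_def integral_open_interval_real)
qed

lemma LINT_Omega_continuous:
  fixes f :: "real \<Rightarrow> real"
  assumes "continuous_on UNIV f"
  shows "(LINT x:Omega|lborel. f x) = integral {-pi..pi} f"
  using assms
  by (intro LINT_Omega borel_measurable_continuous_onI absolutely_integrable_continuous_real)
     (auto intro: continuous_on_subset)

lemma LINT_Omega_sqint:
  assumes "sqint (-pi) pi f" "sqint (-pi) pi g" "f \<in> borel_measurable borel" "g \<in> borel_measurable borel"
  shows "(LINT x:Omega|lborel. f x * g x) = integral {-pi..pi} (\<lambda>x. f x * g x)"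
  using assms by (intro LINT_Omega sqint_mult_abs_integrable) auto

lemma LINT_Omega_cong:
  assumes "\<And>x. x \<in> Omega \<Longrightarrow> f x = g x"
  shows "(LINT x:Omega|lborel. f x) = (LINT x:Omega|lborel. g x)"
  unfolding set_lebesgue_integral_def using assms
      by (intro Bochner_Integration.integral_cong) (auto simp: indicator_def)

text \<open>Square integrability in the sense of \<open>L2\<close> constrains a function on
  \<open>Omega\<close> only; extension by zero makes it Borel on the whole line.\<close>

definition restr :: "(real \<Rightarrow> real) \<Rightarrow> real \<Rightarrow> real" where
  "restr g x = indicator Omega x * g x"

lemma restr_eq: "x \<in> Omega \<Longrightarrow> restr g x = g x"
  by (simp add: restr_def)

lemma L2_restr:
  assumes "L2 g"
  shows "restr g \<in> borel_measurable borel" "sqint (-pi) pi (restr g)"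
proof -
  show m: "restr g \<in> borel_measurable borel"
    using assms by (simp add: L2_def set_borel_measurable_def restr_def[abs_def])
  have "set_integrable lborel Omega (\<lambda>x. (restr g x)\<^sup>2) \<longleftrightarrow> set_integrable lborel Omega (\<lambda>x. (g x)\<^sup>2)"
    by (rule set_integrable_cong) (auto simp: restr_eq)
  then have "(\<lambda>x. (restr g x)\<^sup>2) integrable_on Omega"
    using assms set_borel_integral_eq_integral(1) by (auto simp: L2_def)
  then have "(\<lambda>x. (restr g x)\<^sup>2) integrable_on {-pi..pi}"
    by (simp add: Omega_def integrable_on_Icc_iff_Ioo)
  then show "sqint (-pi) pi (restr g)" using m by (intro sqint_borel)
qed

text \<open>The lemma of du Bois-Reymond: the test function is a primitive of the very function,
  \<open>u\<close> minus a primitive of \<open>g\<close> minus a constant, that has to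
  vanish.\<close>

lemma weak_deriv_AC2:
  assumes p: "periodic u" and c: "continuous_on UNIV u" and w: "has_weak_deriv u g"
  shows "AC2 (-pi) pi u (restr g)"
proof -
  define h where "h = restr g"
  have "L2 g" using w by (simp add: has_weak_deriv_def)
  note h_meas = L2_restr(1)[OF this, folded h_def] and h = L2_restr(2)[OF this, folded h_def]
  have weak: "integral {-pi..pi} (\<lambda>x. u x * deriv \<phi> x) = - integral {-pi..pi} (\<lambda>x. h x * \<phi> x)" if "C1_per \<phi>" for \<phi>
  proof -
    note \<phi> = C1_per_deriv[OF that]
    have \<phi>c: "continuous_on UNIV \<phi>" using \<phi>(1) by (auto intro!: DERIV_continuous_on)
    have "(LINT x:Omega|lborel. u x * deriv \<phi> x) = integral {-pi..pi} (\<lambda>x. u x * deriv \<phi> x)"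
      by (intro LINT_Omega_continuous continuous_intros c \<phi>)
    moreover have "(LINT x:Omega|lborel. g x * \<phi> x) = (LINT x:Omega|lborel. h x * \<phi> x)"
      by (rule LINT_Omega_cong) (simp add: h_def restr_eq)
    moreover have "(LINT x:Omega|lborel. h x * \<phi> x) = integral {-pi..pi} (\<lambda>x. h x * \<phi> x)"
      using \<phi>c by (intro LINT_Omega_sqint h h_meas sqint_continuous_on borel_measurable_continuous_onI)
        (auto intro: continuous_on_subset)
    ultimately show ?thesis using w that by (simp add: has_weak_deriv_def)
  qed
  define G where "G = (\<lambda>x. integral {-pi..x} h)"
  have G_AC: "AC2 (-pi) pi G h" by (auto simp: AC2_def h G_def)
  \<comment> \<open>Periodic test functions include the constant 1, which gives \<open>g\<close>
    mean zero and so makes the primitive \<open>G\<close> periodic.\<close>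
  have "C1_per (\<lambda>_. 1)" by (simp add: C1_per_def periodic_def)
  from weak[OF this] have G_ends: "G (-pi) = 0" "G pi = 0" by (simp_all add: G_def)
  define Gp where "Gp = (\<lambda>x. G (wrap x))"
  have Gp_eq: "Gp x = G x" if "x \<in> {-pi..pi}" for x
    unfolding Gp_def using G_ends that by (intro wrap_comp_eq) auto
  have Gp_cont: "continuous_on UNIV Gp"
  proof (rule periodic_continuous_on_UNIV)
    show "periodic Gp" unfolding Gp_def by (rule periodic_wrap)
    show "continuous_on {-pi..pi} Gp"
      using AC2_continuous_on[OF G_AC] by (rule continuous_on_eq) (simp add: Gp_eq)
  qed
  \<comment> \<open>Subtracting the mean \<open>m\<close> makes the primitive of
    \<open>\<psi>\<close> periodic, hence an admissible test function.\<close>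
  define m where "m = integral {-pi..pi} (\<lambda>x. u x - Gp x) / (2 * pi)"
  define \<psi> where "\<psi> = (\<lambda>x. u x - Gp x - m)"
  have \<psi>_cont: "continuous_on UNIV \<psi>" unfolding \<psi>_def by (intro continuous_intros c Gp_cont)
  have int: "f integrable_on {-pi..pi}" if "continuous_on UNIV f" for f :: "real \<Rightarrow> real"
    using that by (auto intro: integrable_continuous_real continuous_on_subset)
  have "periodic \<psi>" using p periodic_wrap[of G] by (simp add: \<psi>_def Gp_def periodic_def)
  moreover have \<psi>0: "integral {-pi..pi} \<psi> = 0"
    unfolding \<psi>_def by (subst integral_diff) (auto intro!: int continuous_intros c Gp_cont simp: m_def
        content_real)
  ultimately obtain V where V: "periodic V" "\<And>x. (V has_real_derivative \<psi> x) (at x)"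
    using periodic_antiderivative \<psi>_cont by blast
  note V1 = C1_per_I[OF V \<psi>_cont]
  have "integral {-pi..pi} (\<lambda>x. u x * \<psi> x) = - integral {-pi..pi} (\<lambda>x. h x * V x)"
    using weak[OF V1(1)] V1(2) by simp
  moreover have "0 = integral {-pi..pi} (\<lambda>x. G x * \<psi> x + V x * h x)"
    using AC2_product_rule[OF G_AC C1_per_AC2[OF V1(1)]] G_ends V1(2) by simp
  moreover have "integral {-pi..pi} (\<lambda>x. G x * \<psi> x + V x * h x)
      = integral {-pi..pi} (\<lambda>x. Gp x * \<psi> x) + integral {-pi..pi} (\<lambda>x. h x * V x)"
  proof -
    have "integral {-pi..pi} (\<lambda>x. G x * \<psi> x + V x * h x) = integral {-pi..pi} (\<lambda>x. Gp x * \<psi> x + h x * V x)"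
      by (rule integral_cong) (simp add: Gp_eq mult.commute)
    also have "\<dots> = integral {-pi..pi} (\<lambda>x. Gp x * \<psi> x) + integral {-pi..pi} (\<lambda>x. h x * V x)"
      by (intro integral_add sqint_mult_integrable h sqint_continuous_on AC2_continuous_on[OF C1_per_AC2[OF
          V1(1)]] int
          continuous_intros Gp_cont \<psi>_cont)
    finally show ?thesis .
  qed
  \<comment> \<open>Two integrations by parts against the same \<open>V\<close>: the weak one for
    \<open>u\<close> and the one for absolutely continuous functions for \<open>G\<close>.\<close>
  ultimately have E: "integral {-pi..pi} (\<lambda>x. u x * \<psi> x) = integral {-pi..pi} (\<lambda>x. Gp x * \<psi> x)" by simp
  have "((\<lambda>x. u x * \<psi> x - Gp x * \<psi> x - m * \<psi> x) has_integral
     (integral {-pi..pi} (\<lambda>x. u x * \<psi> x) - integral {-pi..pi} (\<lambda>x. Gp x * \<psi> x)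
         - m * integral {-pi..pi} \<psi>)) {-pi..pi}"
    by (intro has_integral_diff has_integral_mult_right integrable_integral int continuous_intros c Gp_cont \<psi>_cont)
  moreover have "u x * \<psi> x - Gp x * \<psi> x - m * \<psi> x = (\<psi> x)\<^sup>2" for x
    by (simp add: \<psi>_def power2_eq_square algebra_simps)
  ultimately have "integral {-pi..pi} (\<lambda>x. (\<psi> x)\<^sup>2) = 0" using E \<psi>0 by (simp add: integral_unique)
  then have "\<forall>x\<in>{-pi..pi}. (\<psi> x)\<^sup>2 = 0"
    using integral_eq_0_iff[of "-pi" pi "\<lambda>x. (\<psi> x)\<^sup>2"] continuous_on_subset[OF \<psi>_cont]
    by (auto intro!: continuous_intros)
  then have *: "u x = G x + m" if "x \<in> {-pi..pi}" for x using that Gp_eq[OF that] by (force simp: \<psi>_def)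
  show ?thesis
  proof (rule AC2_I_diff)
    fix x assume "-pi \<le> x" "x \<le> pi"
    then show "u x - u (- pi) = integral {-pi..x} (restr g)"
      using *[of x] *[of "-pi"] G_ends by (simp add: G_def h_def)
  qed (use h h_def in simp)
qed

text \<open>The density is fixed as a Borel, periodic function defined everywhere, so that it can be
  shifted, reflected and cut pointwise along with \<open>u\<close>.\<close>

definition H1d :: "(real \<Rightarrow> real) \<Rightarrow> (real \<Rightarrow> real) \<Rightarrow> bool" where
  "H1d u g \<longleftrightarrow> periodic u \<and> periodic g \<and> g \<in> borel_measurable borel \<and> AC2 (-pi) pi u g"

lemma H1d_continuous: "H1d u g \<Longrightarrow> continuous_on UNIV u"
  unfolding H1d_def by (auto intro: periodic_continuous_on_UNIV AC2_continuous_on)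

lemma H1_per_imp_H1d:
  assumes "H1_per u"
  obtains g where "H1d u g"
proof -
  obtain g where w: "has_weak_deriv u g" and p: "periodic u" and c: "continuous_on UNIV u"
    using assms by (auto simp: H1_per_def)
  note AC = weak_deriv_AC2[OF p c w]
  have m: "restr g \<in> borel_measurable borel" using w L2_restr by (auto simp: has_weak_deriv_def)
  define h where "h = (\<lambda>x. restr g (wrap x))"
  have h_eq: "h x = restr g x" if "x \<in> {-pi..pi}" for x
    unfolding h_def using that by (intro wrap_comp_eq) (auto simp: restr_def Omega_def)
  have h_meas: "h \<in> borel_measurable borel" unfolding h_def using m by measurable
  have "H1d u h" unfolding H1d_def
  proof (intro conjI p h_meas AC2_I_diff sqint_borel)
    show "periodic h" unfolding h_def by (rule periodic_wrap)
    have "(\<lambda>x. (restr g x)\<^sup>2) integrable_on {-pi..pi}" using AC by (intro sqint_integrable_sq AC2_sqint)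
    then show "(\<lambda>x. (h x)\<^sup>2) integrable_on {-pi..pi}" by (rule integrable_eq) (simp add: h_eq)
    fix x assume x: "-pi \<le> x" "x \<le> pi"
    then have "u x - u (-pi) = integral {-pi..x} (restr g)" using AC2_diff[OF AC, of "-pi" x] by simp
    also have "\<dots> = integral {-pi..x} h" by (rule integral_cong) (use x h_eq in auto)
    finally show "u x - u (-pi) = integral {-pi..x} h" .
  qed
  then show ?thesis by (rule that)
qed

lemma H1d_L2: "H1d u g \<Longrightarrow> L2 g"
proof -
  assume u: "H1d u g"
  have "sqint (-pi) pi g" using u AC2_sqint unfolding H1d_def by blast
  then show "L2 g" unfolding L2_def power2_eq_square
    using u sqint_mult_abs_integrable[of "-pi" pi g g]
    by (intro conjI LINT_Omega(1)) (auto simp: H1d_def set_borel_measurable_def Omega_def)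
qed

lemma H1d_has_weak_deriv:
  assumes u: "H1d u g"
  shows "has_weak_deriv u g"
  unfolding has_weak_deriv_def
proof (intro conjI allI impI)
  show "L2 g" using u by (rule H1d_L2)
  fix \<phi> assume "C1_per \<phi>"
  note \<phi> = C1_per_deriv[OF this]
  have uc: "continuous_on UNIV u" using u by (rule H1d_continuous)
  have AC: "AC2 (-pi) pi u g" and gm: "g \<in> borel_measurable borel" and p: "periodic u" using u
      by (auto simp: H1d_def)
  have \<phi>_AC: "AC2 (-pi) pi \<phi> (deriv \<phi>)" using \<open>C1_per \<phi>\<close> by (rule C1_per_AC2)
  have \<phi>c: "continuous_on UNIV \<phi>" using \<phi>(1) by (auto intro!: DERIV_continuous_on)
  have "(LINT x:Omega|lborel. u x * deriv \<phi> x) = integral {-pi..pi} (\<lambda>x. u x * deriv \<phi> x)"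
    by (intro LINT_Omega_continuous continuous_intros uc \<phi>)
  moreover have "(LINT x:Omega|lborel. g x * \<phi> x) = integral {-pi..pi} (\<lambda>x. g x * \<phi> x)"
    using \<phi>c by (intro LINT_Omega_sqint gm AC2_sqint[OF AC] sqint_continuous_on borel_measurable_continuous_onI)
        (auto intro: continuous_on_subset)
  moreover have "u pi = u (-pi)" "\<phi> pi = \<phi> (-pi)"
    using p[unfolded periodic_def, rule_format, of "-pi"] \<phi>(3)[unfolded periodic_def, rule_format,
        of "-pi"] by simp_all
  moreover have "integral {-pi..pi} (\<lambda>x. u x * deriv \<phi> x + \<phi> x * g x)
      = integral {-pi..pi} (\<lambda>x. u x * deriv \<phi> x) + integral {-pi..pi} (\<lambda>x. \<phi> x * g x)"
    using uc \<phi>c \<phi>(2) by (intro integral_add sqint_mult_integrable AC2_sqint[OF AC] sqint_continuous_on)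
      (auto intro: continuous_on_subset)
  ultimately show "(LINT x:Omega|lborel. u x * deriv \<phi> x) = - (LINT x:Omega|lborel. g x * \<phi> x)"
    using AC2_product_rule[OF AC \<phi>_AC] by (simp add: mult.commute)
qed

lemma H1d_H1_per: "H1d u g \<Longrightarrow> H1_per u"
  using H1d_has_weak_deriv H1d_continuous by (auto simp: H1_per_def H1d_def)

text \<open>The choice behind \<open>weak_deriv\<close> yields some weak derivative; restricted to
  \<open>Omega\<close> it is a density of \<open>u\<close> just as \<open>g\<close> is, and two
  densities agree almost everywhere.\<close>

lemma energy_H1d:
  assumes u: "H1d u g"
  shows "energy \<alpha> u = 1 / 2 * integral {-pi..pi} (\<lambda>x. (g x)\<^sup>2 - \<alpha>\<^sup>2 * (u x)\<^sup>2)
      - integral {-pi..pi} (\<lambda>x. u x * cos x)"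
proof -
  define h where "h = restr (weak_deriv u)"
  have w: "has_weak_deriv u (weak_deriv u)"
    unfolding weak_deriv_def by (rule someI[of "has_weak_deriv u", OF H1d_has_weak_deriv[OF u]])
  have uc: "continuous_on UNIV u" using u by (rule H1d_continuous)
  have AC: "AC2 (-pi) pi u g" and gm: "g \<in> borel_measurable borel" and p: "periodic u" using u
      by (auto simp: H1d_def)
  have hAC: "AC2 (-pi) pi u h" unfolding h_def by (rule weak_deriv_AC2[OF p uc w])
  have hm: "h \<in> borel_measurable borel" unfolding h_def using w L2_restr by (auto simp: has_weak_deriv_def)
  have us: "sqint (-pi) pi u" using AC2_continuous_on[OF AC] by (rule sqint_continuous_on)
  have "(LINT x:Omega|lborel. (weak_deriv u x)\<^sup>2 - \<alpha>\<^sup>2 * (u x)\<^sup>2)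
      = (LINT x:Omega|lborel. (h x)\<^sup>2 - \<alpha>\<^sup>2 * (u x)\<^sup>2)"
    by (rule LINT_Omega_cong) (simp add: h_def restr_eq)
  also have "\<dots> = integral {-pi..pi} (\<lambda>x. (h x)\<^sup>2 - \<alpha>\<^sup>2 * (u x)\<^sup>2)"
  proof (rule LINT_Omega(2))
    show "(\<lambda>x. (h x)\<^sup>2 - \<alpha>\<^sup>2 * (u x)\<^sup>2) \<in> borel_measurable borel"
      using hm borel_measurable_continuous_onI[OF uc] by measurable
    have "(\<lambda>x. h x * h x - \<alpha>\<^sup>2 * (u x * u x)) absolutely_integrable_on {-pi..pi}"
      by (intro set_integral_diff(1) set_integrable_mult_right impI sqint_mult_abs_integrable us AC2_sqint[OF hAC])
    then show "(\<lambda>x. (h x)\<^sup>2 - \<alpha>\<^sup>2 * (u x)\<^sup>2) absolutely_integrable_on {-pi..pi}"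
      by (simp add: power2_eq_square)
  qed
  also have "\<dots> = integral {-pi..pi} (\<lambda>x. (h x)\<^sup>2) - integral {-pi..pi} (\<lambda>x. \<alpha>\<^sup>2 * (u x)\<^sup>2)"
    using us AC2_sqint[OF hAC] by (intro integral_diff integrable_on_mult_right sqint_integrable_sq)
  also have "integral {-pi..pi} (\<lambda>x. (h x)\<^sup>2) = integral {-pi..pi} (\<lambda>x. (g x)\<^sup>2)"
    by (rule AC2_deriv_unique_sq[OF hAC AC _ hm gm]) simp
  also have "\<dots> - integral {-pi..pi} (\<lambda>x. \<alpha>\<^sup>2 * (u x)\<^sup>2) = integral {-pi..pi} (\<lambda>x. (g x)\<^sup>2 - \<alpha>\<^sup>2 * (u x)\<^sup>2)"
    using us AC2_sqint[OF AC] by (intro integral_diff[symmetric] integrable_on_mult_right sqint_integrable_sq)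
  finally have 1: "(LINT x:Omega|lborel. (weak_deriv u x)\<^sup>2 - \<alpha>\<^sup>2 * (u x)\<^sup>2)
     = integral {-pi..pi} (\<lambda>x. (g x)\<^sup>2 - \<alpha>\<^sup>2 * (u x)\<^sup>2)" .
  have 2: "(LINT x:Omega|lborel. u x * cos x) = integral {-pi..pi} (\<lambda>x. u x * cos x)"
    by (intro LINT_Omega_continuous continuous_intros uc)
  show ?thesis unfolding energy_def 1 2 ..
qed

lemma admissible_iff:
  "u \<in> admissible M \<longleftrightarrow> (\<exists>g. H1d u g) \<and> (\<forall>x. 0 \<le> u x) \<and> integral {-pi..pi} u = M"
proof -
  have "(LINT x:Omega|lborel. u x) = integral {-pi..pi} u" if "H1d u g" for g
    using H1d_continuous[OF that] by (rule LINT_Omega_continuous)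
  moreover have "H1_per u \<longleftrightarrow> (\<exists>g. H1d u g)" using H1d_H1_per H1_per_imp_H1d by blast
  ultimately show ?thesis unfolding admissible_def by auto
qed

section \<open>Polarization\<close>

lemma H1d_add:
  assumes "H1d u g" "H1d v h"
  shows "H1d (\<lambda>x. u x + v x) (\<lambda>x. g x + h x)"
  using assms AC2_add[of "-pi" pi u g v h] unfolding H1d_def periodic_def by auto

lemma H1d_cmult:
  assumes "H1d u g"
  shows "H1d (\<lambda>x. c * u x) (\<lambda>x. c * g x)"
  using assms AC2_cmult[of "-pi" pi u g c] unfolding H1d_def periodic_def by auto

lemma H1d_diff:
  assumes "H1d u g" "H1d v h"
  shows "H1d (\<lambda>x. u x - v x) (\<lambda>x. g x - h x)"
  using H1d_add[OF assms(1) H1d_cmult[OF assms(2), of "-1"]] by simp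

lemma H1d_AC2: "H1d u g \<Longrightarrow> AC2 (-pi) pi u g"
  by (simp add: H1d_def)

lemma H1d_sqint: "H1d u g \<Longrightarrow> sqint (-pi) pi g"
  using H1d_AC2 AC2_sqint by blast

lemma H1d_sqint_fun: "H1d u g \<Longrightarrow> sqint (-pi) pi u"
  using H1d_AC2 AC2_continuous_on sqint_continuous_on by blast

lemma H1d_reflect:
  assumes "H1d u g"
  shows "H1d (\<lambda>x. u (- x)) (\<lambda>x. - g (- x))"
  unfolding H1d_def
proof (intro conjI AC2_I_diff sqint_borel)
  have per: "f (- (x + 2 * pi)) = f (- x)" if "periodic f" for f :: "real \<Rightarrow> real" and x
    using periodic_diff_int[OF that, of "- x" 1] by (simp add: algebra_simps)
  show "periodic (\<lambda>x. u (- x))" "periodic (\<lambda>x. - g (- x))"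
    using assms per unfolding H1d_def by (simp_all add: periodic_def[of "\<lambda>x. u (- x)"] periodic_def[of "\<lambda>x.
        - g (- x)"])
  have gm: "g \<in> borel_measurable borel" using assms by (simp add: H1d_def)
  show m: "(\<lambda>x. - g (- x)) \<in> borel_measurable borel" using gm by measurable
  show "(\<lambda>x. - g (- x)) \<in> borel_measurable borel" by (rule m)
  have "(\<lambda>x. (g x)\<^sup>2) integrable_on {-pi..pi}" using H1d_sqint[OF assms] by (rule sqint_integrable_sq)
  then have "(\<lambda>x. (g (- x))\<^sup>2) integrable_on {- pi..- (- pi)}"
    unfolding integrable_on_def using has_integral_reflect_real[of "\<lambda>x. (g x)\<^sup>2" _ pi "-pi"] by blast
  then show "(\<lambda>x. (- g (- x))\<^sup>2) integrable_on {-pi..pi}" by simp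
  fix x assume x: "- pi \<le> x" "x \<le> pi"
  have "integral {-pi..x} (\<lambda>t. - g (- t)) = - integral {- pi..- (- x)} (\<lambda>t. g (- t))" by simp
  also have "\<dots> = - integral {- x..pi} g" by (simp only: Henstock_Kurzweil_Integration.integral_reflect_real)
  also have "\<dots> = u (- x) - u pi" using AC2_diff[OF H1d_AC2[OF assms], of "- x" pi] x by simp
  finally show "u (- x) - u (- (- pi)) = integral {-pi..x} (\<lambda>t. - g (- t))" by simp
qed

section \<open>Translation by an angle\<close>

lemma periodic_integrable_on:
  fixes f :: "real \<Rightarrow> real"
  assumes p: "periodic f" and f: "f integrable_on {-pi..pi}"
  shows "f integrable_on {-pi..3*pi}"
proof (rule Henstock_Kurzweil_Integration.integrable_combine[where c=pi])
  show "f integrable_on {-pi..pi}" by (rule f)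
  have "(\<lambda>x. f (x + (- 2 * pi))) integrable_on {-pi - (- 2 * pi)..pi - (- 2 * pi)}"
    by (rule integrable_shift_real_ivl[OF f])
  moreover have "f (x + (- 2 * pi)) = f x" for x using periodic_diff_int[OF p, of x 1] by simp
  ultimately show "f integrable_on {pi..3*pi}" by simp
qed simp_all

lemma integral_periodic_shift:
  fixes f :: "real \<Rightarrow> real"
  assumes p: "periodic f" and f: "f integrable_on {-pi..pi}" and a: "0 \<le> a" "a \<le> 2 * pi"
  shows "integral {-pi..pi} (\<lambda>x. f (x + a)) = integral {-pi..pi} f"
proof -
  note f3 = periodic_integrable_on[OF p f]
  have on: "f integrable_on {c..d}" if "-pi \<le> c" "d \<le> 3 * pi" for c d
    using f3 by (rule integrable_on_subinterval) (use that in auto)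
  have "integral {-pi..pi} (\<lambda>x. f (x + a)) = integral {-pi+a..pi+a} f"
    using integral_shift_real_ivl[of "-pi+a" a "pi+a" f] by simp
  also have "\<dots> = integral {-pi+a..pi} f + integral {pi..pi+a} f"
    using Henstock_Kurzweil_Integration.integral_combine[of "-pi+a" pi "pi+a" f] on a by simp
  also have "integral {pi..pi+a} f = integral {-pi..-pi+a} (\<lambda>x. f (x + 2 * pi))"
    using integral_shift_real_ivl[of pi "2*pi" "pi+a" f] by (simp add: algebra_simps)
  also have "\<dots> = integral {-pi..-pi+a} f" using p by (simp add: periodic_def)
  also have "integral {-pi+a..pi} f + \<dots> = integral {-pi..pi} f"
    using Henstock_Kurzweil_Integration.integral_combine[of "-pi" "-pi+a" pi f] f a by simp
  finally show ?thesis .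
qed

text \<open>Two periods contain every window of length \<open>2 * pi\<close> that arises from a
  shift by \<open>a\<close> in \<open>[0, 2 * pi]\<close>.\<close>

lemma H1d_AC2_two_periods:
  assumes "H1d u g"
  shows "AC2 (-pi) (3*pi) u g"
proof (rule AC2_I_diff)
  have p: "periodic u" "periodic g" and gm: "g \<in> borel_measurable borel" using assms by (auto simp: H1d_def)
  note AC = H1d_AC2[OF assms]
  have "periodic (\<lambda>x. (g x)\<^sup>2)" using p by (simp add: periodic_def)
  then show "sqint (-pi) (3*pi) g"
    by (rule sqint_borel[OF gm periodic_integrable_on[OF _ sqint_integrable_sq[OF AC2_sqint[OF AC]]]])
  fix x assume x: "-pi \<le> x" "x \<le> 3*pi"
  show "u x - u (-pi) = integral {-pi..x} g"
  proof (cases "x \<le> pi")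
    case True
    then show ?thesis using AC2_diff[OF AC, of "-pi" x] x by simp
  next
    case False
    have "g integrable_on {-pi..x}"
      using periodic_integrable_on[OF p(2) sqint_integrable[OF H1d_sqint[OF assms]]]
      by (rule integrable_on_subinterval) (use x in auto)
    then have "integral {-pi..x} g = integral {-pi..pi} g + integral {pi..x} g"
      using Henstock_Kurzweil_Integration.integral_combine[of "-pi" pi x g] False by simp
    also have "integral {pi..x} g = integral {-pi..x-2*pi} (\<lambda>x. g (x + 2 * pi))"
      using integral_shift_real_ivl[of pi "2*pi" x g] by (simp add: algebra_simps)
    also have "\<dots> = integral {-pi..x-2*pi} g" using p by (simp add: periodic_def)
    also have "\<dots> = u (x - 2*pi) - u (-pi)" using AC2_diff[OF AC, of "-pi" "x-2*pi"] x False by simp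
    also have "u (x - 2*pi) = u x" using periodic_diff_int[OF p(1), of x 1] by simp
    also have "integral {-pi..pi} g = u pi - u (-pi)" using AC2_diff[OF AC, of "-pi" pi] by simp
    also have "u pi = u (-pi)" using p(1)[unfolded periodic_def, rule_format, of "-pi"] by simp
    finally show ?thesis by simp
  qed
qed

lemma H1d_shift:
  assumes u: "H1d u g" and a: "0 \<le> a" "a \<le> 2 * pi"
  shows "H1d (\<lambda>x. u (x + a)) (\<lambda>x. g (x + a))"
  unfolding H1d_def
proof (intro conjI AC2_I_diff sqint_borel)
  have p: "periodic u" "periodic g" and gm: "g \<in> borel_measurable borel" using u by (auto simp: H1d_def)
  have "f (x + 2 * pi + a) = f (x + a)" if "periodic f" for f :: "real \<Rightarrow> real" and x
    using that[unfolded periodic_def, rule_format, of "x + a"] by (simp add: algebra_simps)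
  then show "periodic (\<lambda>x. u (x + a))" "periodic (\<lambda>x. g (x + a))"
    using p by (simp_all add: periodic_def[of "\<lambda>x. u (x + a)"] periodic_def[of "\<lambda>x. g (x + a)"])
  show m: "(\<lambda>x. g (x + a)) \<in> borel_measurable borel" using gm by measurable
  show "(\<lambda>x. g (x + a)) \<in> borel_measurable borel" by (rule m)
  note AC = H1d_AC2_two_periods[OF u]
  have "(\<lambda>x. (g x)\<^sup>2) integrable_on {-pi+a..pi+a}"
    using sqint_integrable_sq[OF AC2_sqint[OF AC]] by (rule integrable_on_subinterval) (use a in auto)
  then show "(\<lambda>x. (g (x + a))\<^sup>2) integrable_on {-pi..pi}"
    using integrable_shift_real_ivl[of "\<lambda>x. (g x)\<^sup>2" "-pi+a" "pi+a" a] by simp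
  fix x assume x: "-pi \<le> x" "x \<le> pi"
  have "integral {-pi..x} (\<lambda>x. g (x + a)) = integral {-pi+a..x+a} g"
    using integral_shift_real_ivl[of "-pi+a" a "x+a" g] by simp
  then show "u (x + a) - u (-pi + a) = integral {-pi..x} (\<lambda>x. g (x + a))"
    using AC2_diff[OF AC, of "-pi+a" "x+a"] x a by simp
qed

text \<open>The quadratic part and the mass are invariant under translation, so the shift can be
  moved onto the cosine.\<close>

lemma energy_shift:
  assumes u: "H1d u g" and a: "0 \<le> a" "a \<le> 2 * pi"
  shows "energy \<alpha> (\<lambda>x. u (x + a)) =
    1 / 2 * integral {-pi..pi} (\<lambda>x. (g x)\<^sup>2 - \<alpha>\<^sup>2 * (u x)\<^sup>2) - integral {-pi..pi} (\<lambda>x. u x * cos (x - a))"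
    "integral {-pi..pi} (\<lambda>x. u (x + a)) = integral {-pi..pi} u"
proof -
  have p: "periodic u" "periodic g" using u by (auto simp: H1d_def)
  have "periodic (\<lambda>x. (g x)\<^sup>2 - \<alpha>\<^sup>2 * (u x)\<^sup>2)" using p by (simp add: periodic_def)
  moreover have "(\<lambda>x. (g x)\<^sup>2 - \<alpha>\<^sup>2 * (u x)\<^sup>2) integrable_on {-pi..pi}"
    by (intro integrable_diff integrable_on_mult_right sqint_integrable_sq H1d_sqint[OF u] H1d_sqint_fun[OF u])
  ultimately have 1: "integral {-pi..pi} (\<lambda>x. (g (x + a))\<^sup>2 - \<alpha>\<^sup>2 * (u (x + a))\<^sup>2)
     = integral {-pi..pi} (\<lambda>x. (g x)\<^sup>2 - \<alpha>\<^sup>2 * (u x)\<^sup>2)"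
    using a by (rule integral_periodic_shift)
  have "cos (x + 2 * pi - a) = cos (x - a)" for x using cos_periodic[of "x - a"] by (simp add: algebra_simps)
  then have "periodic (\<lambda>x. u x * cos (x - a))" using p by (simp add: periodic_def)
  moreover have "(\<lambda>x. u x * cos (x - a)) integrable_on {-pi..pi}"
    by (intro sqint_mult_integrable H1d_sqint_fun[OF u] sqint_continuous_on continuous_intros)
  ultimately have 2: "integral {-pi..pi} (\<lambda>x. u (x + a) * cos (x + a - a))
      = integral {-pi..pi} (\<lambda>x. u x * cos (x - a))"
    using a by (rule integral_periodic_shift)
  show "energy \<alpha> (\<lambda>x. u (x + a)) =
    1 / 2 * integral {-pi..pi} (\<lambda>x. (g x)\<^sup>2 - \<alpha>\<^sup>2 * (u x)\<^sup>2) - integral {-pi..pi} (\<lambda>x. u x * cos (x - a))"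
    unfolding energy_H1d[OF H1d_shift[OF u a]] 1 using 2 by simp
  show "integral {-pi..pi} (\<lambda>x. u (x + a)) = integral {-pi..pi} u"
    by (rule integral_periodic_shift[OF p(1) sqint_integrable[OF H1d_sqint_fun[OF u]] a])
qed

lemma energy_reflect:
  assumes "H1d u g"
  shows "energy \<alpha> (\<lambda>x. u (- x)) = energy \<alpha> u" "integral {-pi..pi} (\<lambda>x. u (- x)) = integral {-pi..pi} u"
proof -
  have r: "integral {-pi..pi} (\<lambda>x. f (- x)) = integral {-pi..pi} f" for f :: "real \<Rightarrow> real"
    using Henstock_Kurzweil_Integration.integral_reflect_real[of pi "-pi" f] by simp
  show "integral {-pi..pi} (\<lambda>x. u (- x)) = integral {-pi..pi} u" by (rule r)
  show "energy \<alpha> (\<lambda>x. u (- x)) = energy \<alpha> u"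
    unfolding energy_H1d[OF assms] energy_H1d[OF H1d_reflect[OF assms]]
    using r[of "\<lambda>x. (g x)\<^sup>2 - \<alpha>\<^sup>2 * (u x)\<^sup>2"] r[of "\<lambda>x. u x * cos x"] by simp
qed

text \<open>The energy is a quadratic polynomial, so the expansion is exact: the first bracket is
  the first variation at \<open>u\<close> in direction \<open>w\<close>, the last line the second
  variation.\<close>

lemma energy_add:
  assumes u: "H1d u g" and w: "H1d w h"
  shows "energy \<alpha> (\<lambda>x. u x + w x) = energy \<alpha> u
     + (integral {-pi..pi} (\<lambda>x. g x * h x) - \<alpha>\<^sup>2 * integral {-pi..pi} (\<lambda>x. u x * w x)
         - integral {-pi..pi} (\<lambda>x. w x * cos x))
     + 1 / 2 * (integral {-pi..pi} (\<lambda>x. (h x)\<^sup>2) - \<alpha>\<^sup>2 * integral {-pi..pi} (\<lambda>x. (w x)\<^sup>2))"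
proof -
  note sq = H1d_sqint[OF u] H1d_sqint[OF w] H1d_sqint_fun[OF u] H1d_sqint_fun[OF w]
  have c: "sqint (-pi) pi cos" by (intro sqint_continuous_on continuous_intros)
  let ?I = "integral {-pi..pi}"
  have I: "((\<lambda>x. ((g x)\<^sup>2 - \<alpha>\<^sup>2 * (u x)\<^sup>2) + 2 * (g x * h x - \<alpha>\<^sup>2 * (u x * w x)) + ((h x)\<^sup>2 - \<alpha>\<^sup>2 * (w x)\<^sup>2))
      has_integral
      (?I (\<lambda>x. (g x)\<^sup>2 - \<alpha>\<^sup>2 * (u x)\<^sup>2) + 2 * (?I (\<lambda>x. g x * h x) - \<alpha>\<^sup>2 * ?I (\<lambda>x. u x * w x))
       + (?I (\<lambda>x. (h x)\<^sup>2) - \<alpha>\<^sup>2 * ?I (\<lambda>x. (w x)\<^sup>2)))) {-pi..pi}"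
    by (intro has_integral_add has_integral_diff has_integral_mult_right integrable_integral integrable_diff
        integrable_on_mult_right sqint_integrable_sq sqint_mult_integrable sq)
  have "((g x)\<^sup>2 - \<alpha>\<^sup>2 * (u x)\<^sup>2) + 2 * (g x * h x - \<alpha>\<^sup>2 * (u x * w x)) + ((h x)\<^sup>2 - \<alpha>\<^sup>2 * (w x)\<^sup>2)
     = (g x + h x)\<^sup>2 - \<alpha>\<^sup>2 * (u x + w x)\<^sup>2" for x
    by (simp add: power2_eq_square algebra_simps)
  then have 1: "?I (\<lambda>x. (g x + h x)\<^sup>2 - \<alpha>\<^sup>2 * (u x + w x)\<^sup>2)
    = (?I (\<lambda>x. (g x)\<^sup>2 - \<alpha>\<^sup>2 * (u x)\<^sup>2) + 2 * (?I (\<lambda>x. g x * h x) - \<alpha>\<^sup>2 * ?I (\<lambda>x. u x * w x))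
       + (?I (\<lambda>x. (h x)\<^sup>2) - \<alpha>\<^sup>2 * ?I (\<lambda>x. (w x)\<^sup>2)))"
    using integral_unique[OF I] by simp
  have 2: "?I (\<lambda>x. (u x + w x) * cos x) = ?I (\<lambda>x. u x * cos x) + ?I (\<lambda>x. w x * cos x)"
    unfolding distrib_right by (intro integral_add sqint_mult_integrable sq c)
  show ?thesis
    unfolding energy_H1d[OF H1d_add[OF u w]] energy_H1d[OF u] 1 2 by (simp add: algebra_simps)
qed

section \<open>Comparison of a minimizer with its reflections\<close>

lemma minimizer_iff:
  "minimizer \<alpha> M u \<longleftrightarrow> u \<in> admissible M \<and> (\<forall>v\<in>admissible M. energy \<alpha> u \<le> energy \<alpha> v)"
  unfolding minimizer_def is_arg_min_linorder by blast

text \<open>Zero values at \<open>p\<close> and \<open>q\<close> keep the extension by zero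
  absolutely continuous. The density is cut to the open interval so that it vanishes at
  \<open>pi\<close> and \<open>-pi\<close> even if the interval reaches them; otherwise it would not
  be compatible with \<open>wrap\<close>.\<close>

lemma H1d_cutoff:
  assumes AC: "AC2 p q d e" and e: "e \<in> borel_measurable borel"
    and pq: "-pi \<le> p" "p \<le> q" "q \<le> pi" and d: "d p = 0" "d q = 0"
  defines "w \<equiv> \<lambda>x. if x \<in> {p..q} then d x else 0" and "h \<equiv> \<lambda>x. if x \<in> {p<..<q} then e x else 0"
  shows "H1d (\<lambda>x. w (wrap x)) (\<lambda>x. h (wrap x))"
    "\<And>x. x \<in> {-pi..pi} \<Longrightarrow> w (wrap x) = w x" "\<And>x. x \<in> {-pi..pi} \<Longrightarrow> h (wrap x) = h x"
proof -
  have w_ends: "w pi = 0" "w (-pi) = 0" "h pi = 0" "h (-pi) = 0"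
    using pq d by (auto simp: w_def h_def)
  show w_eq: "w (wrap x) = w x" and h_eq: "h (wrap x) = h x" if "x \<in> {-pi..pi}" for x
    using that w_ends by (auto intro: wrap_comp_eq)
  have h_int: "integral {-pi..x} h = integral {p..min x q} e" for x
  proof -
    have "integral {-pi..x} h = integral {-pi..x} (\<lambda>t. if t \<in> {p..q} then e t else 0)"
      by (rule integral_spike[of "{p,q}"]) (auto simp: h_def)
    also have "\<dots> = integral ({-pi..x} \<inter> {p..q}) e" by (simp only: integral_restrict_Int Int_commute)
    also have "{-pi..x} \<inter> {p..q} = {p..min x q}" using pq by auto
    finally show ?thesis .
  qed
  have h_meas: "h \<in> borel_measurable borel" unfolding h_def using e by measurable
  show "H1d (\<lambda>x. w (wrap x)) (\<lambda>x. h (wrap x))" unfolding H1d_def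
  proof (intro conjI periodic_wrap AC2_I_diff sqint_borel)
    show m: "(\<lambda>x. h (wrap x)) \<in> borel_measurable borel" using h_meas by measurable
    show "(\<lambda>x. h (wrap x)) \<in> borel_measurable borel" by (rule m)
    have "(\<lambda>x. (e x)\<^sup>2) integrable_on {p..q}" using AC by (intro sqint_integrable_sq AC2_sqint)
    moreover have "{-pi..pi} \<inter> {p..q} = {p..q}" using pq by auto
    ultimately have "(\<lambda>x. if x \<in> {p..q} then (e x)\<^sup>2 else 0) integrable_on {-pi..pi}"
      by (simp only: integrable_restrict_Int Int_commute)
    then show "(\<lambda>x. (h (wrap x))\<^sup>2) integrable_on {-pi..pi}"
    proof (rule integrable_spike[of _ _ "{p,q}"])
      fix x assume "x \<in> {-pi..pi} - {p,q}"
      then show "(h (wrap x))\<^sup>2 = (if x \<in> {p..q} then (e x)\<^sup>2 else 0)"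
        using h_eq[of x] by (auto simp: h_def)
    qed simp
    fix x assume x: "-pi \<le> x" "x \<le> pi"
    have "integral {-pi..x} (\<lambda>x. h (wrap x)) = integral {-pi..x} h"
      by (rule integral_cong) (use x h_eq in auto)
    also have "\<dots> = integral {p..min x q} e" by (rule h_int)
    also have "\<dots> = w x"
    proof (cases "p \<le> x")
      case True
      then show ?thesis using AC2_diff[OF AC, of p "min x q"] pq d by (auto simp: w_def min_def)
    qed (simp add: w_def)
    finally show "w (wrap x) - w (wrap (- pi)) = integral {-pi..x} (\<lambda>x. h (wrap x))"
      using x w_eq[of x] w_eq[of "-pi"] w_ends by simp
  qed
qed

text \<open>The ends are the last zero before \<open>x0\<close> and the first zero after it.\<close>

lemma negative_component:
  fixes d :: "real \<Rightarrow> real"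
  assumes c: "continuous_on {a..b} d" and x0: "a \<le> x0" "x0 \<le> b" "d x0 < 0" and ends: "d a = 0" "d b = 0"
  obtains p q where "a \<le> p" "p < x0" "x0 < q" "q \<le> b" "d p = 0" "d q = 0" "\<And>x. x \<in> {p<..<q} \<Longrightarrow> d x < 0"
proof -
  have zero: "\<exists>z. min x x0 \<le> z \<and> z \<le> max x x0 \<and> d z = 0" if "a \<le> x" "x \<le> b" "0 \<le> d x" for x
  proof (cases "x \<le> x0")
    case True
    then show ?thesis using IVT2'[of d x0 0 x] x0 that continuous_on_subset[OF c, of "{x..x0}"] by force
  next
    case False
    then show ?thesis using IVT'[of d x0 0 x] x0 that continuous_on_subset[OF c, of "{x0..x}"] by force
  qed
  have cl: "compact {x \<in> S. d x = 0}" if "compact S" "S \<subseteq> {a..b}" for S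
  proof -
    have "closed {x \<in> S. d x = 0}"
      using that c by (intro continuous_closed_preimage_constant) (auto intro: continuous_on_subset
          compact_imp_closed)
    then show ?thesis using that by (metis (no_types, lifting) compact_Int_closed inf.absorb2 mem_Collect_eq
        subsetI)
  qed
  obtain p where p: "a \<le> p" "p \<le> x0" "d p = 0" "\<And>x. a \<le> x \<Longrightarrow> x \<le> x0 \<Longrightarrow> d x = 0 \<Longrightarrow> x \<le> p"
    using compact_attains_sup[OF cl[of "{a..x0}"]] x0 ends by force
  obtain q where q: "x0 \<le> q" "q \<le> b" "d q = 0" "\<And>x. x0 \<le> x \<Longrightarrow> x \<le> b \<Longrightarrow> d x = 0 \<Longrightarrow> q \<le> x"
    using compact_attains_inf[OF cl[of "{x0..b}"]] x0 ends by force
  have ne: "p \<noteq> x0" "x0 \<noteq> q" using x0 p q by auto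
  have "d x < 0" if x: "x \<in> {p<..<q}" for x
  proof (rule ccontr)
    assume "\<not> d x < 0"
    then obtain z where z: "min x x0 \<le> z" "z \<le> max x x0" "d z = 0" using zero[of x] x p q by auto
    moreover have "p < min x x0" "max x x0 < q" using x p(2) q(1) ne by auto
    ultimately have "p < z" "z < q" by linarith+
    then show False using p(4)[of z] q(4)[of z] p(1) q(2) z(3) by linarith
  qed
  then show ?thesis using that[of p q] p q ne by force
qed

lemma integral_odd_zero:
  fixes k :: "real \<Rightarrow> real"
  assumes "\<And>x. x \<in> {-pi..pi} \<Longrightarrow> k (- x) = - k x"
  shows "integral {-pi..pi} k = 0"
proof -
  have "integral {-pi..pi} k = integral {-pi..pi} (\<lambda>x. k (- x))"
    using Henstock_Kurzweil_Integration.integral_reflect_real[of pi "-pi" k] by simp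
  also have "\<dots> = integral {-pi..pi} (\<lambda>x. - k x)" by (rule integral_cong) (rule assms)
  finally show ?thesis by simp
qed

text \<open>If \<open>u\<close> were smaller than its reflection somewhere on the half circle centred closer to the
  origin, exchanging the two on one component of that set would keep the quadratic part of the
  energy and the mass but increase \<open>\<integral> u cos\<close>.\<close>

lemma minimizer_polarized:
  assumes min: "minimizer \<alpha> M u" and a: "0 < a" "a < pi" and x0: "-pi < x0" "x0 < 0"
  shows "u (a - x0) \<le> u (a + x0)"
proof (rule ccontr)
  assume neg: "\<not> u (a - x0) \<le> u (a + x0)"
  obtain g0 where u: "H1d u g0" and u_nonneg: "\<And>x. 0 \<le> u x" and mass: "integral {-pi..pi} u = M"
    using min by (auto simp: minimizer_iff admissible_iff)
  \<comment> \<open>Shifting by \<open>a\<close> moves the axis of reflection to the origin, at the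
    price of the cosine becoming \<open>cos (x + a)\<close>.\<close>
  define v g where "v = (\<lambda>x. u (x + a))" and "g = (\<lambda>x. g0 (x + a))"
  have a2: "0 \<le> a" "a \<le> 2 * pi" "0 \<le> 2 * pi - a" "2 * pi - a \<le> 2 * pi" using a by auto
  have v: "H1d v g" unfolding v_def g_def by (rule H1d_shift[OF u a2(1,2)])
  define d e where "d = (\<lambda>x. v x - v (- x))" and "e = (\<lambda>x. g x - - g (- x))"
  have d: "H1d d e" unfolding d_def e_def by (rule H1d_diff[OF v H1d_reflect[OF v]])
  have "periodic v" using v by (simp add: H1d_def)
  then have "v pi = v (-pi)" using periodic_def[of v, THEN iffD1, rule_format, of "-pi"] by simp
  then have d_ends: "d (-pi) = 0" "d 0 = 0" by (simp_all add: d_def)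
  have "d x0 < 0" using neg by (simp add: d_def v_def algebra_simps)
  then obtain p q where pq: "-pi \<le> p" "p < x0" "x0 < q" "q \<le> 0" "d p = 0" "d q = 0"
      and d_neg: "\<And>x. x \<in> {p<..<q} \<Longrightarrow> d x < 0"
    using negative_component[of "-pi" 0 d x0] continuous_on_subset[OF H1d_continuous[OF d]] x0 d_ends by auto
  define w where "w = (\<lambda>x. if x \<in> {p..q} then d x else 0)"
  define h where "h = (\<lambda>x. if x \<in> {p<..<q} then e x else 0)"
  have dpq: "AC2 p q d e" using H1d_AC2[OF d] by (rule AC2_subinterval) (use pq in auto)
  have em: "e \<in> borel_measurable borel" using d by (simp add: H1d_def)
  have pq': "-pi \<le> p" "p \<le> q" "q \<le> pi" using pq by auto
  have cut: "H1d (\<lambda>x. w (wrap x)) (\<lambda>x. h (wrap x))"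
      "\<And>x. x \<in> {-pi..pi} \<Longrightarrow> w (wrap x) = w x" "\<And>x. x \<in> {-pi..pi} \<Longrightarrow> h (wrap x) = h x"
    unfolding w_def h_def using H1d_cutoff[OF dpq em pq' pq(5,6)] by blast+
  \<comment> \<open>Adding \<open>\<delta>\<close> exchanges \<open>v\<close> with its mirror image
    on the component and on the reflected component, and changes nothing elsewhere.\<close>
  define \<delta> where "\<delta> = (\<lambda>x. w (wrap (- x)) - w (wrap x))"
  define \<eta> where "\<eta> = (\<lambda>x. - h (wrap (- x)) - h (wrap x))"
  have \<delta>: "H1d \<delta> \<eta>" unfolding \<delta>_def \<eta>_def by (rule H1d_diff[OF H1d_reflect[OF cut(1)] cut(1)])
  define v' g' where "v' = (\<lambda>x. v x + \<delta> x)" and "g' = (\<lambda>x. g x + \<eta> x)"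
  have v': "H1d v' g'" unfolding v'_def g'_def by (rule H1d_add[OF v \<delta>])
  have \<delta>_eq: "\<delta> x = w (- x) - w x" "\<eta> x = - h (- x) - h x" if "x \<in> {-pi..pi}" for x
    using that cut(2)[of x] cut(2)[of "-x"] cut(3)[of x] cut(3)[of "-x"] by (auto simp: \<delta>_def \<eta>_def)
  have v'_swap: "(v' x = v x \<and> v' (- x) = v (- x)) \<or> (v' x = v (- x) \<and> v' (- x) = v x)"
    if "x \<in> {-pi..pi}" for x
    using \<delta>_eq[of x] \<delta>_eq[of "-x"] that pq d_ends
    by (cases x "0 :: real" rule: linorder_cases) (auto simp: v'_def w_def d_def)
  have g'_swap: "(g' x = g x \<and> g' (- x) = g (- x)) \<or> (g' x = - g (- x) \<and> g' (- x) = - g x)"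
    if "x \<in> {-pi..pi}" for x
    using \<delta>_eq[of x] \<delta>_eq[of "-x"] that pq
    by (cases x "0 :: real" rule: linorder_cases) (auto simp: g'_def h_def e_def)
  \<comment> \<open>An exchange of the values at \<open>x\<close> and \<open>-x\<close> preserves
    the sum over the pair, hence every integral of a local expression.\<close>
  have sym: "integral {-pi..pi} f = integral {-pi..pi} f'"
    if "f integrable_on {-pi..pi}" "f' integrable_on {-pi..pi}" "\<And>x. x \<in> {-pi..pi} \<Longrightarrow> f x + f (- x) = f' x
        + f' (- x)"
    for f f' :: "real \<Rightarrow> real"
  proof -
    have "integral {-pi..pi} (\<lambda>x. f x - f' x) = 0"
    proof (rule integral_odd_zero)
      fix x assume "x \<in> {-pi..pi}"
      then show "f (- x) - f' (- x) = - (f x - f' x)" using that(3)[of x] by linarith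
    qed
    then show ?thesis using that by (simp add: integral_diff)
  qed
  have v'_nonneg: "0 \<le> v' x" for x
  proof -
    have "wrap x \<in> {-pi..pi}" using wrap_bounds[of x] by auto
    then have "0 \<le> v' (wrap x)" using v'_swap[of "wrap x"] u_nonneg by (auto simp: v_def)
    then show ?thesis using v' wrap_of_periodic[of v' x] by (simp add: H1d_def)
  qed
  have int1: "integral {-pi..pi} v' = integral {-pi..pi} v"
  proof (rule sym[OF sqint_integrable[OF H1d_sqint_fun[OF v']] sqint_integrable[OF H1d_sqint_fun[OF v]]])
    fix x assume "x \<in> {-pi..pi}"
    then show "v' x + v' (- x) = v x + v (- x)" using v'_swap[of x] by auto
  qed
  have int2: "integral {-pi..pi} (\<lambda>x. (g' x)\<^sup>2 - \<alpha>\<^sup>2 * (v' x)\<^sup>2) = integral {-pi..pi} (\<lambda>x. (g x)\<^sup>2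
      - \<alpha>\<^sup>2 * (v x)\<^sup>2)"
  proof (rule sym)
    show "(\<lambda>x. (g' x)\<^sup>2 - \<alpha>\<^sup>2 * (v' x)\<^sup>2) integrable_on {-pi..pi}" "(\<lambda>x. (g x)\<^sup>2
        - \<alpha>\<^sup>2 * (v x)\<^sup>2) integrable_on {-pi..pi}"
      by (intro integrable_diff integrable_on_mult_right sqint_integrable_sq H1d_sqint[OF v] H1d_sqint_fun[OF v]
        H1d_sqint[OF v'] H1d_sqint_fun[OF v'])+
    fix x assume x: "x \<in> {-pi..pi}"
    then show "(g' x)\<^sup>2 - \<alpha>\<^sup>2 * (v' x)\<^sup>2 + ((g' (- x))\<^sup>2 - \<alpha>\<^sup>2 * (v' (- x))\<^sup>2)
       = (g x)\<^sup>2 - \<alpha>\<^sup>2 * (v x)\<^sup>2 + ((g (- x))\<^sup>2 - \<alpha>\<^sup>2 * (v (- x))\<^sup>2)"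
      using v'_swap[OF x] g'_swap[OF x] by auto
  qed
  have \<delta>c: "continuous_on UNIV \<delta>" by (rule H1d_continuous[OF \<delta>])
  have pos: "0 < integral {-pi..pi} (\<lambda>x. \<delta> x * cos (x + a))"
  proof -
    have int: "f integrable_on {-pi..pi}" if "continuous_on UNIV f" for f :: "real \<Rightarrow> real"
      using that by (auto intro: integrable_continuous_real continuous_on_subset)
    \<comment> \<open>Since \<open>\<delta>\<close> is odd, only the odd part
      \<open>- sin a * sin x\<close> of \<open>cos (x + a)\<close> contributes, and
      \<open>- \<delta> x * sin x\<close> has a sign.\<close>
    have "integral {-pi..pi} (\<lambda>x. \<delta> x * cos (x + a)) = integral {-pi..pi} (\<lambda>x. sin a * (- \<delta> x * sin x))"
    proof (rule sym)
      fix x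
      have "\<delta> (- x) = - \<delta> x" by (simp add: \<delta>_def)
      then show "\<delta> x * cos (x + a) + \<delta> (- x) * cos (- x + a) = sin a * (- \<delta> x * sin x)
          + sin a * (- \<delta> (- x) * sin (- x))"
        by (simp add: cos_add cos_diff algebra_simps)
    qed (intro int continuous_intros \<delta>c)+
    also have "\<dots> = sin a * integral {-pi..pi} (\<lambda>x. - \<delta> x * sin x)" by simp
    finally have *: "integral {-pi..pi} (\<lambda>x. \<delta> x * cos (x + a)) = sin a * integral {-pi..pi} (\<lambda>x. - \<delta> x * sin x)" .
    have w_le: "w x \<le> 0" for x using d_neg[of x] pq by (cases "x = p \<or> x = q") (auto simp: w_def)
    have nonneg: "0 \<le> - \<delta> x * sin x" if x: "x \<in> {-pi..pi}" for x
    proof (cases "x \<le> 0")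
      case True
      then have "sin x \<le> 0" using sin_ge_zero[of "- x"] x by auto
      moreover have "w (- x) = 0" using True pq d_ends by (cases "x = 0") (auto simp: w_def)
      then have "0 \<le> \<delta> x" using \<delta>_eq[OF x] w_le[of x] by simp
      ultimately show ?thesis by (simp add: mult_nonneg_nonpos)
    next
      case False
      then have "0 \<le> sin x" using sin_ge_zero[of x] x by auto
      moreover have "w x = 0" using False pq by (auto simp: w_def)
      then have "\<delta> x \<le> 0" using \<delta>_eq[OF x] w_le[of "-x"] by simp
      ultimately show ?thesis by (simp add: mult_nonpos_nonneg)
    qed
    have "\<delta> x0 = - d x0" using \<delta>_eq(1)[of x0] x0 pq by (auto simp: w_def)
    moreover have "sin x0 < 0" using sin_gt_zero[of "- x0"] x0 by simp
    ultimately have "- \<delta> x0 * sin x0 \<noteq> 0" using \<open>d x0 < 0\<close> by simp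
    moreover have "continuous_on {-pi..pi} (\<lambda>x. - \<delta> x * sin x)"
      using continuous_on_subset[OF \<delta>c] by (auto intro!: continuous_intros)
    ultimately have "integral {-pi..pi} (\<lambda>x. - \<delta> x * sin x) \<noteq> 0"
      using integral_eq_0_iff[of "-pi" pi "\<lambda>x. - \<delta> x * sin x"] nonneg x0 by force
    moreover have "0 \<le> integral {-pi..pi} (\<lambda>x. - \<delta> x * sin x)"
      using nonneg by (intro integral_nonneg int continuous_intros \<delta>c) auto
    ultimately have "0 < integral {-pi..pi} (\<lambda>x. - \<delta> x * sin x)" by linarith
    then show ?thesis unfolding * using sin_gt_zero[OF a] by (rule mult_pos_pos[rotated])
  qed
  \<comment> \<open>The inverse translation is by \<open>2 * pi - a\<close> instead of
    \<open>- a\<close>, which keeps the shift nonnegative.\<close>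
  have shift: "energy \<alpha> (\<lambda>x. f (x + (2 * pi - a))) =
    1 / 2 * integral {-pi..pi} (\<lambda>x. (f' x)\<^sup>2 - \<alpha>\<^sup>2 * (f x)\<^sup>2) - integral {-pi..pi} (\<lambda>x. f x * cos (x + a))"
    if "H1d f f'" for f f'
  proof -
    have "cos (x - (2 * pi - a)) = cos (x + a)" for x using cos_periodic[of "x - (2 * pi - a)"]
        by (simp add: algebra_simps)
    then show ?thesis using energy_shift(1)[OF that a2(3,4)] by simp
  qed
  have "(\<lambda>x. v (x + (2 * pi - a))) = u"
    using u by (auto simp: v_def fun_eq_iff H1d_def periodic_def algebra_simps)
  then have E: "energy \<alpha> u = 1 / 2 * integral {-pi..pi} (\<lambda>x. (g x)\<^sup>2 - \<alpha>\<^sup>2 * (v x)\<^sup>2)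
      - integral {-pi..pi} (\<lambda>x. v x * cos (x + a))"
    using shift[OF v] by simp
  have "integral {-pi..pi} (\<lambda>x. v' x * cos (x + a)) = integral {-pi..pi} (\<lambda>x. v x * cos (x + a))
      + integral {-pi..pi} (\<lambda>x. \<delta> x * cos (x + a))"
    unfolding v'_def distrib_right
    by (intro integral_add sqint_mult_integrable H1d_sqint_fun[OF v] H1d_sqint_fun[OF \<delta>] sqint_continuous_on
        continuous_intros)
  then have "energy \<alpha> (\<lambda>x. v' (x + (2 * pi - a))) < energy \<alpha> u"
    unfolding shift[OF v'] E int2 using pos by simp
  moreover have "(\<lambda>x. v' (x + (2 * pi - a))) \<in> admissible M"
    unfolding admissible_iff
    using H1d_shift[OF v' a2(3,4)] v'_nonneg energy_shift(2)[OF v' a2(3,4)] int1 energy_shift(2)[OF u a2(1,2)] mass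
    by (auto simp: v_def)
  ultimately show False using min unfolding minimizer_iff by force
qed

lemma minimizer_reflect:
  assumes "minimizer \<alpha> M u"
  shows "minimizer \<alpha> M (\<lambda>x. u (- x))"
proof -
  obtain g where u: "H1d u g" using assms by (auto simp: minimizer_iff admissible_iff)
  show ?thesis using assms H1d_reflect[OF u] energy_reflect[OF u] by (auto simp: minimizer_iff admissible_iff)
qed

text \<open>Polarization about \<open>(x + y) / 2\<close> compares the two values whenever
  \<open>\<bar>x\<bar> < y\<close>. Evenness is the limit case \<open>x = - y\<close>, used for the
  minimizer and for its reflection, which is a minimizer as well.\<close>

lemma minimizer_symm_decr:
  assumes min: "minimizer \<alpha> M u"
  shows "u (- x) = u x" "0 \<le> x \<Longrightarrow> x \<le> y \<Longrightarrow> y \<le> pi \<Longrightarrow> u y \<le> u x"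
proof -
  have mono: "u y \<le> u x" if min: "minimizer \<alpha> M u" and xy: "- y < x" "x < y" "y \<le> pi" for u x y
    using minimizer_polarized[OF min, of "(x + y) / 2" "(x - y) / 2"] xy by (simp add: field_simps)
  show "u y \<le> u x" if "0 \<le> x" "x \<le> y" "y \<le> pi"
    using mono[OF min, of y x] that by (cases "x = y") auto
  have le: "u y \<le> u (- y)" if min: "minimizer \<alpha> M u" and y: "0 < y" "y \<le> pi" for u y
  proof -
    obtain g where "H1d u g" using min by (auto simp: minimizer_iff admissible_iff)
    then have "continuous_on UNIV u" by (rule H1d_continuous)
    then have "(u \<longlongrightarrow> u (- y)) (at_right (- y))"
      by (auto simp: continuous_on_def intro: tendsto_within_subset)
    moreover have "\<forall>\<^sub>F x in at_right (- y). u y \<le> u x"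
      using eventually_at_right_real[of "- y" y] y by (auto elim!: eventually_mono intro: mono[OF min])
    ultimately show ?thesis by (rule tendsto_lowerbound) simp
  qed
  have eq: "u (- y) = u y" if y: "0 < y" "y \<le> pi" for y
    using le[OF min y] le[OF minimizer_reflect[OF min] y] by simp
  obtain g where g: "H1d u g" using min by (auto simp: minimizer_iff admissible_iff)
  have p: "periodic u" "periodic (\<lambda>x. u (- x))" using g H1d_reflect[OF g] by (auto simp: H1d_def)
  have "u (- wrap x) = u (wrap x)"
    using eq[of "wrap x"] eq[of "- wrap x"] wrap_bounds[of x]
        by (cases "wrap x" "0 :: real" rule: linorder_cases) auto
  then show "u (- x) = u x" using wrap_of_periodic[OF p(1)] wrap_of_periodic[OF p(2)] by simp
qed

section \<open>Existence of minimizers\<close>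

text \<open>Subtracting the common end value reduces this to the cutoff on the full period; the
  density changes at most at the two end points.\<close>

lemma AC2_periodic_extension:
  assumes AC: "AC2 (-pi) pi f g" and gm: "g \<in> borel_measurable borel" and ends: "f pi = f (-pi)"
  obtains h where "H1d (\<lambda>x. f (wrap x)) h" "integral {-pi..pi} (\<lambda>x. (h x)\<^sup>2) = integral {-pi..pi} (\<lambda>x. (g x)\<^sup>2)"
proof -
  define d where "d = (\<lambda>x. f x - f (-pi))"
  have d: "AC2 (-pi) pi d g" unfolding d_def using AC2_diff_fun[OF AC AC2_const, of "f (-pi)"] by simp
  define h where "h = (\<lambda>x. if wrap x \<in> {-pi<..<pi} then g (wrap x) else 0)"
  have cut: "H1d (\<lambda>x. if wrap x \<in> {-pi..pi} then d (wrap x) else 0) h"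
     "\<And>x. x \<in> {-pi..pi} \<Longrightarrow> h x = (if x \<in> {-pi<..<pi} then g x else 0)"
    unfolding h_def using H1d_cutoff[OF d gm] ends by (simp_all add: d_def)
  have "H1d (\<lambda>_. f (-pi)) (\<lambda>_. 0)" by (simp add: H1d_def periodic_def AC2_const)
  from H1d_add[OF cut(1) this]
  have "H1d (\<lambda>x. (if wrap x \<in> {-pi..pi} then d (wrap x) else 0) + f (-pi)) h" by simp
  moreover have "(\<lambda>x. (if wrap x \<in> {-pi..pi} then d (wrap x) else 0) + f (-pi)) = (\<lambda>x. f (wrap x))"
    using wrap_bounds by (auto simp: d_def fun_eq_iff less_imp_le)
  ultimately have "H1d (\<lambda>x. f (wrap x)) h" by simp
  moreover have "integral {-pi..pi} (\<lambda>x. (h x)\<^sup>2) = integral {-pi..pi} (\<lambda>x. (g x)\<^sup>2)"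
    by (rule integral_spike[of "{-pi,pi}"]) (auto simp: cut(2))
  ultimately show ?thesis using that by blast
qed

lemma LINT_Icc:
  fixes f :: "real \<Rightarrow> real"
  assumes "f \<in> borel_measurable borel" "f absolutely_integrable_on {a..b}"
  shows "integrable lborel (\<lambda>x. indicator {a..b} x * f x)"
    "(LINT x|lborel. indicator {a..b} x * f x) = integral {a..b} f"
  using abs_integrable_Icc_lborel[OF assms] set_borel_integral_eq_integral(2)[OF abs_integrable_Icc_lborel[OF
      assms]]
  by (simp_all add: set_integrable_def set_lebesgue_integral_def)

text \<open>Completeness of \<open>L\<^sup>2\<close> along a rapidly converging sequence, with the pointwise limit of the
  derivatives given by a telescoping series, and Fatou's lemma for the Dirichlet integral.\<close>

lemma H1d_limit:
  assumes V: "\<And>n. H1d (V n) (D n)" and conv: "\<And>x. x \<in> {-pi..pi} \<Longrightarrow> (\<lambda>n. V n x) \<longlonglongrightarrow> f x"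
    and fast: "\<And>n. integral {-pi..pi} (\<lambda>x. (D (Suc n) x - D n x)\<^sup>2) \<le> (1/4)^n"
    and L: "(\<lambda>n. integral {-pi..pi} (\<lambda>x. (D n x)\<^sup>2)) \<longlonglongrightarrow> L"
  obtains g where "AC2 (-pi) pi f g" "g \<in> borel_measurable borel" "integral {-pi..pi} (\<lambda>x. (g x)\<^sup>2) \<le> L"
proof -
  have Dm: "D n \<in> borel_measurable borel" for n using V[of n] by (simp add: H1d_def)
  define \<delta> where "\<delta> n x = D (Suc n) x - D n x" for n x
  have \<delta>m: "\<delta> n \<in> borel_measurable borel" for n unfolding \<delta>_def[abs_def] using Dm by measurable
  have \<delta>s: "sqint (-pi) pi (\<delta> n)" for n
    unfolding \<delta>_def[abs_def] by (intro sqint_diff H1d_sqint[OF V])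
  \<comment> \<open>Cauchy-Schwarz turns the L2 rate \<open>(1/4)^n\<close> into the summable L1
    rate \<open>(1/2)^n\<close>.\<close>
  have \<delta>_L1: "integral {-pi..pi} (\<lambda>x. \<bar>\<delta> n x\<bar>) \<le> sqrt (2 * pi) * (1/2)^n" for n
  proof -
    have "(integral {-pi..pi} (\<lambda>x. \<bar>\<delta> n x\<bar>))\<^sup>2 \<le> 2 * pi * integral {-pi..pi} (\<lambda>x. (\<delta> n x)\<^sup>2)"
      using integral_abs_sq_le[OF \<delta>s[of n]] by simp
    also have "\<dots> \<le> 2 * pi * (1/4)^n" using fast[of n] by (intro mult_left_mono) (auto simp: \<delta>_def)
    also have "\<dots> = (sqrt (2 * pi) * (1/2)^n)\<^sup>2"
    proof -
      have "((1/2::real)^n)\<^sup>2 = (1/4)^n" by (simp add: power2_eq_square flip: power_mult_distrib)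
      then show ?thesis by (simp add: power_mult_distrib)
    qed
    finally show ?thesis by (rule power2_le_imp_le) simp
  qed
  define F where "F n x = indicator {-pi..pi} x * \<delta> n x" for n x
  have Fm: "F n \<in> borel_measurable borel" for n unfolding F_def[abs_def] using \<delta>m by measurable
  have Fi: "integrable lborel (F n)" for n
    unfolding F_def[abs_def] by (rule LINT_Icc(1)[OF \<delta>m sqint_abs_integrable[OF \<delta>s]])
  have Fn: "(LINT x|lborel. norm (F n x)) = integral {-pi..pi} (\<lambda>x. \<bar>\<delta> n x\<bar>)" for n
  proof -
    have "(LINT x|lborel. indicator {-pi..pi} x * \<bar>\<delta> n x\<bar>) = integral {-pi..pi} (\<lambda>x. \<bar>\<delta> n x\<bar>)"
      using \<delta>m[of n] sqint_abs_integrable[OF \<delta>s[of n]]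
      by (intro LINT_Icc(2)) (auto simp: absolutely_integrable_on_def)
    then show ?thesis by (simp add: F_def abs_mult)
  qed
  have geo: "summable (\<lambda>n. sqrt (2 * pi) * (1/2)^n)" by (intro summable_mult summable_geometric) simp
  have Fsum: "summable (\<lambda>n. LINT x|lborel. norm (F n x))"
    unfolding Fn
    by (rule summable_comparison_test[OF _ geo])
       (use \<delta>_L1 in \<open>auto intro!: exI[of _ 0] simp: abs_of_nonneg integral_nonneg sqint_integrable_abs[OF \<delta>s]\<close>)
  have AEsum: "AE x in lborel. summable (\<lambda>n. norm (F n x))"
  proof -
    have "(\<integral>\<^sup>+x. (\<Sum>n. ennreal (norm (F n x))) \<partial>lborel) = (\<Sum>n. \<integral>\<^sup>+x. ennreal (norm (F n x)) \<partial>lborel)"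
      using Fm by (intro nn_integral_suminf) simp
    also have "\<dots> = (\<Sum>n. ennreal (LINT x|lborel. norm (F n x)))"
      using Fi by (intro suminf_cong nn_integral_eq_integral) auto
    also have "\<dots> = ennreal (\<Sum>n. LINT x|lborel. norm (F n x))"
      by (intro suminf_ennreal2 Fsum) simp
    finally have "(\<integral>\<^sup>+x. (\<Sum>n. ennreal (norm (F n x))) \<partial>lborel) \<noteq> \<infinity>" by simp
    then have "AE x in lborel. (\<Sum>n. ennreal (norm (F n x))) \<noteq> \<infinity>"
      using Fm by (intro nn_integral_PInf_AE) auto
    then show ?thesis by eventually_elim (rule summable_suminf_not_top, auto)
  qed
  define S where "S x = (\<Sum>n. F n x)" for x
  have Sm: "S \<in> borel_measurable borel" unfolding S_def[abs_def] using Fm by measurable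
  define g where "g x = D 0 x + S x" for x
  have gm: "g \<in> borel_measurable borel" unfolding g_def[abs_def] using Sm Dm by measurable
  have tele: "(\<Sum>i<n. F i x) = indicator {-pi..pi} x * (D n x - D 0 x)" for n x
    by (induction n) (auto simp: F_def \<delta>_def algebra_simps)
  have S_int: "(LINT y|lborel. indicator {-pi..x} y * S y) = f x - f (-pi) - integral {-pi..x} (D 0)"
     and S_abs: "set_integrable lborel {-pi..pi} S" if x: "x \<in> {-pi..pi}" for x
  proof -
    have Fxi: "integrable lborel (\<lambda>y. indicator {-pi..x} y * F n y)" for n
      using integrable_mult_indicator[OF _ Fi[of n], of "{-pi..x}"] by simp
    \<comment> \<open>Each term of the series integrates to an increment of \<open>V (Suc n)\<close>
      minus one of \<open>V n\<close>. The sum telescopes and converges to the increment of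
      \<open>f\<close>, which identifies \<open>g\<close> as its density.\<close>
    have Fx: "(LINT y|lborel. indicator {-pi..x} y * F n y) = V (Suc n) x - V (Suc n) (-pi) - (V n x
        - V n (-pi))" for n
    proof -
      have "(\<lambda>y. indicator {-pi..x} y * F n y) = (\<lambda>y. indicator {-pi..x} y * \<delta> n y)"
        using x by (auto simp: F_def indicator_def fun_eq_iff)
      then have "(LINT y|lborel. indicator {-pi..x} y * F n y) = integral {-pi..x} (\<delta> n)"
        using x sqint_subinterval[OF \<delta>s[of n], of "-pi" x] by (simp add: LINT_Icc(2) \<delta>m sqint_abs_integrable)
      also have "\<dots> = integral {-pi..x} (D (Suc n)) - integral {-pi..x} (D n)"
        unfolding \<delta>_def using x
        by (intro integral_diff sqint_integrable sqint_subinterval[OF H1d_sqint[OF V]]) auto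
      also have "\<dots> = V (Suc n) x - V (Suc n) (-pi) - (V n x - V n (-pi))"
        using AC2_diff[OF H1d_AC2[OF V], of "-pi" x] x by simp
      finally show ?thesis .
    qed
    have ae: "AE y in lborel. summable (\<lambda>n. norm (indicator {-pi..x} y * F n y))"
      using AEsum by eventually_elim (auto simp: indicator_def)
    have "summable (\<lambda>n. LINT y|lborel. norm (indicator {-pi..x} y * F n y))"
    proof (rule summable_comparison_test[OF _ Fsum], intro exI allI impI)
      fix n :: nat
      have "(LINT y|lborel. norm (indicator {-pi..x} y * F n y)) \<le> (LINT y|lborel. norm (F n y))"
        using Fxi[of n] Fi[of n] by (intro integral_mono) (auto simp: indicator_def)
      then show "norm (LINT y|lborel. norm (indicator {-pi..x} y * F n y)) \<le> (LINT y|lborel. norm (F n y))"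
        by simp
    qed
    note si = sums_integral[OF Fxi ae this] and ii = integrable_suminf[OF Fxi ae this]
    have "(\<Sum>n. indicator {-pi..x} y * F n y) = indicator {-pi..x} y * S y" for y
      by (auto simp: S_def indicator_def)
    then have "(\<lambda>n. LINT y|lborel. indicator {-pi..x} y * F n y) sums (LINT y|lborel. indicator {-pi..x} y * S y)"
      using si by simp
    then have s1: "(\<lambda>n. \<Sum>i<n. V (Suc i) x - V (Suc i) (-pi) - (V i x
        - V i (-pi))) \<longlonglongrightarrow> (LINT y|lborel. indicator {-pi..x} y * S y)"
      unfolding Fx sums_def .
    have "(\<Sum>i<n. V (Suc i) x - V (Suc i) (-pi) - (V i x - V i (-pi))) = V n x - V n (-pi)
        - integral {-pi..x} (D 0)" for n
      using sum_lessThan_telescope[of "\<lambda>i. V i x - V i (-pi)" n] AC2_diff[OF H1d_AC2[OF V[of 0]],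
          of "-pi" x] x by simp
    moreover have "(\<lambda>n. V n x - V n (-pi) - integral {-pi..x} (D 0)) \<longlonglongrightarrow> f x - f (-pi) - integral {-pi..x} (D 0)"
      using conv x by (intro tendsto_intros) auto
    ultimately show "(LINT y|lborel. indicator {-pi..x} y * S y) = f x - f (-pi) - integral {-pi..x} (D 0)"
      using s1 LIMSEQ_unique by fastforce
    have "integrable lborel S" unfolding S_def[abs_def] by (rule integrable_suminf[OF Fi AEsum Fsum])
    then show "set_integrable lborel {-pi..pi} S"
      unfolding set_integrable_def by (intro integrable_mult_indicator) auto
  qed
  have g_lim: "AE x in lborel. x \<in> {-pi..pi} \<longrightarrow> (\<lambda>n. D n x) \<longlonglongrightarrow> g x"
    using AEsum
  proof eventually_elim
    case (elim x)
    then have "(\<lambda>n. F n x) sums S x" unfolding S_def by (rule summable_sums[OF summable_norm_cancel])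
    then have "x \<in> {-pi..pi} \<longrightarrow> (\<lambda>n. D n x - D 0 x) \<longlonglongrightarrow> S x"
      by (cases "x \<in> {-pi..pi}") (auto simp: sums_def tele)
    moreover have "(\<lambda>n. D n x) \<longlonglongrightarrow> g x" if "(\<lambda>n. D n x - D 0 x) \<longlonglongrightarrow> S x"
      using tendsto_add[OF tendsto_const[of "D 0 x"] that] by (simp add: g_def)
    ultimately show ?case by blast
  qed
  have Di: "(\<integral>\<^sup>+x. ennreal (indicator {-pi..pi} x * (D n x)\<^sup>2) \<partial>lborel)
      = ennreal (integral {-pi..pi} (\<lambda>x. (D n x)\<^sup>2))" for n
  proof -
    have m: "(\<lambda>x. (D n x)\<^sup>2) \<in> borel_measurable borel" using Dm by measurable
    have a: "(\<lambda>x. (D n x)\<^sup>2) absolutely_integrable_on {-pi..pi}"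
      by (intro nonnegative_absolutely_integrable_1 sqint_integrable_sq H1d_sqint[OF V]) auto
    show ?thesis
      using nn_integral_eq_integral[OF LINT_Icc(1)[OF m a]] LINT_Icc(2)[OF m a] by simp
  qed
  have L0: "0 \<le> L"
    by (rule LIMSEQ_le_const[OF L]) (auto intro!: integral_nonneg sqint_integrable_sq H1d_sqint[OF V])
  \<comment> \<open>Only the upper bound by \<open>L\<close> is needed, because the limit will be a
    minimizer; no equality of Dirichlet integrals is claimed.\<close>
  have fatou: "(\<integral>\<^sup>+x. ennreal (indicator {-pi..pi} x * (g x)\<^sup>2) \<partial>lborel) \<le> ennreal L"
  proof -
    have "(\<integral>\<^sup>+x. ennreal (indicator {-pi..pi} x * (g x)\<^sup>2) \<partial>lborel)
        = (\<integral>\<^sup>+x. liminf (\<lambda>n. ennreal (indicator {-pi..pi} x * (D n x)\<^sup>2)) \<partial>lborel)"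
    proof (rule nn_integral_cong_AE)
      show "AE x in lborel. ennreal (indicator {-pi..pi} x * (g x)\<^sup>2)
          = liminf (\<lambda>n. ennreal (indicator {-pi..pi} x * (D n x)\<^sup>2))"
        using g_lim
      proof eventually_elim
        case (elim x)
        have "(\<lambda>n. indicator {-pi..pi} x * (D n x)\<^sup>2) \<longlonglongrightarrow> indicator {-pi..pi} x * (g x)\<^sup>2"
        proof (cases "x \<in> {-pi..pi}")
          case True
          then show ?thesis using elim by (auto intro!: tendsto_intros)
        qed simp
        then have "(\<lambda>n. ennreal (indicator {-pi..pi} x * (D n x)\<^sup>2)) \<longlonglongrightarrow> ennreal (indicator {-pi..pi} x * (g x)\<^sup>2)"
          by (rule tendsto_ennrealI)
        then show ?case by (intro lim_imp_Liminf[symmetric]) auto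
      qed
    qed
    also have "\<dots> \<le> liminf (\<lambda>n. \<integral>\<^sup>+x. ennreal (indicator {-pi..pi} x * (D n x)\<^sup>2) \<partial>lborel)"
      using Dm by (intro nn_integral_liminf) measurable
    also have "\<dots> = ennreal L"
      unfolding Di by (intro lim_imp_Liminf tendsto_ennrealI L) simp
    finally show ?thesis .
  qed
  have g2m: "(\<lambda>x. (g x)\<^sup>2) \<in> borel_measurable borel" using gm by measurable
  have "integrable lborel (\<lambda>x. indicator {-pi..pi} x * (g x)\<^sup>2)"
  proof (rule integrableI_nonneg)
    show "(\<integral>\<^sup>+x. ennreal (indicator {-pi..pi} x * (g x)\<^sup>2) \<partial>lborel) < \<infinity>"
      using fatou by (rule order_le_less_trans) simp
  qed (use gm in auto)
  then have g2i: "set_integrable lborel {-pi..pi} (\<lambda>x. (g x)\<^sup>2)" by (simp add: set_integrable_def)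
  have g2: "(\<lambda>x. (g x)\<^sup>2) integrable_on {-pi..pi}" "integral {-pi..pi} (\<lambda>x. (g x)\<^sup>2) \<le> L"
  proof -
    show "(\<lambda>x. (g x)\<^sup>2) integrable_on {-pi..pi}" using g2i by (rule set_borel_integral_eq_integral(1))
    have "ennreal (LINT x|lborel. indicator {-pi..pi} x * (g x)\<^sup>2) \<le> ennreal L"
      using fatou nn_integral_eq_integral[of lborel "\<lambda>x. indicator {-pi..pi} x * (g x)\<^sup>2"] g2i
      by (simp add: set_integrable_def)
    then have "(LINT x|lborel. indicator {-pi..pi} x * (g x)\<^sup>2) \<le> L" using L0 by (simp add: ennreal_le_iff)
    then show "integral {-pi..pi} (\<lambda>x. (g x)\<^sup>2) \<le> L"
      using set_borel_integral_eq_integral(2)[OF g2i] by (simp add: set_lebesgue_integral_def)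
  qed
  have "AC2 (-pi) pi f g"
  proof (rule AC2_I_diff)
    show "sqint (-pi) pi g" using gm g2(1) by (rule sqint_borel)
    fix x assume x: "-pi \<le> x" "x \<le> pi"
    have Si: "set_integrable lborel {-pi..x} S"
      using S_abs[of 0] by (rule set_integrable_subset) (use x in auto)
    have "integral {-pi..x} g = integral {-pi..x} (D 0) + integral {-pi..x} S"
      unfolding g_def using x Si sqint_subinterval[OF H1d_sqint[OF V[of 0]], of "-pi" x]
      by (intro integral_add) (auto intro: sqint_integrable set_borel_integral_eq_integral(1))
    also have "integral {-pi..x} S = f x - f (-pi) - integral {-pi..x} (D 0)"
      using S_int[of x] x set_borel_integral_eq_integral(2)[OF Si] by (simp add: set_lebesgue_integral_def)
    finally show "f x - f (-pi) = integral {-pi..x} g" by simp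
  qed
  then show ?thesis using gm g2(2) that by blast
qed

section \<open>Coercivity and compactness of minimizing sequences\<close>

lemma energy_split:
  assumes "H1d u g"
  shows "energy \<alpha> u = 1 / 2 * integral {-pi..pi} (\<lambda>x. (g x)\<^sup>2) - \<alpha>\<^sup>2 / 2 * integral {-pi..pi} (\<lambda>x. (u x)\<^sup>2)
     - integral {-pi..pi} (\<lambda>x. u x * cos x)"
proof -
  have "integral {-pi..pi} (\<lambda>x. (g x)\<^sup>2 - \<alpha>\<^sup>2 * (u x)\<^sup>2)
      = integral {-pi..pi} (\<lambda>x. (g x)\<^sup>2) - integral {-pi..pi} (\<lambda>x. \<alpha>\<^sup>2 * (u x)\<^sup>2)"
    by (intro integral_diff integrable_on_mult_right sqint_integrable_sq H1d_sqint[OF assms] H1d_sqint_fun[OF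
        assms])
  then show ?thesis unfolding energy_H1d[OF assms] by (simp add: field_simps)
qed

text \<open>The minimum of \<open>u\<close> is at most its mean, and the oscillation is at most the
  L1 norm of the density.\<close>

lemma H1d_sup_bound:
  assumes u: "H1d u g" and nonneg: "\<And>x. 0 \<le> u x" and x: "x \<in> {-pi..pi}"
  shows "u x \<le> integral {-pi..pi} u / (2 * pi) + integral {-pi..pi} (\<lambda>x. \<bar>g x\<bar>)"
proof -
  note c = AC2_continuous_on[OF H1d_AC2[OF u]]
  obtain y where y: "y \<in> {-pi..pi}" "\<And>z. z \<in> {-pi..pi} \<Longrightarrow> u y \<le> u z"
    using continuous_attains_inf[of "{-pi..pi}" u] c by auto
  have "integral {-pi..pi} (\<lambda>_. u y) \<le> integral {-pi..pi} u"
    using y(2) c by (intro integral_le) (auto intro: integrable_continuous_real)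
  then have "u y \<le> integral {-pi..pi} u / (2 * pi)" by (simp add: content_real field_simps)
  moreover have "\<bar>u x - u y\<bar> \<le> integral {-pi..pi} (\<lambda>x. \<bar>g x\<bar>)"
  proof (cases "x \<le> y")
    case True
    then have "u y - u x = integral {x..y} g" using AC2_diff[OF H1d_AC2[OF u]] x y by auto
    then show ?thesis using sqint_integral_abs_le[OF H1d_sqint[OF u], of x y] x y by auto
  next
    case False
    then have "u x - u y = integral {y..x} g" using AC2_diff[OF H1d_AC2[OF u]] x y by auto
    then show ?thesis using sqint_integral_abs_le[OF H1d_sqint[OF u], of y x] x y by auto
  qed
  ultimately show ?thesis by linarith
qed

text \<open>At fixed mass, \<open>u \<ge> 0\<close> bounds the integral of \<open>u^2\<close> by the
  mass times the supremum. The negative term is therefore only linear in the L1 norm of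
  \<open>g\<close> and is absorbed by the quadratic Dirichlet term, however large
  \<open>\<alpha>\<close> is.\<close>

lemma energy_coercive:
  assumes u: "H1d u g" and nonneg: "\<And>x. 0 \<le> u x" and mass: "integral {-pi..pi} u = M"
    and k_def: "k = \<alpha>\<^sup>2 * M / 2"
  shows "1 / 4 * integral {-pi..pi} (\<lambda>x. (g x)\<^sup>2) - (2 * pi * k\<^sup>2 + k * M / (2 * pi) + M) \<le> energy \<alpha> u"
proof -
  define G I where "G = integral {-pi..pi} (\<lambda>x. (g x)\<^sup>2)" and "I = integral {-pi..pi} (\<lambda>x. \<bar>g x\<bar>)"
  have us: "sqint (-pi) pi u" using H1d_sqint_fun[OF u] .
  have B: "u x \<le> M / (2 * pi) + I" if "x \<in> {-pi..pi}" for x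
    using H1d_sup_bound[OF u nonneg that] mass by (simp add: I_def)
  have "integral {-pi..pi} (\<lambda>x. (u x)\<^sup>2) \<le> integral {-pi..pi} (\<lambda>x. (M / (2 * pi) + I) * u x)"
    using B nonneg us by (intro integral_le integrable_on_mult_right sqint_integrable sqint_integrable_sq)
       (auto simp: power2_eq_square intro!: mult_right_mono)
  then have "integral {-pi..pi} (\<lambda>x. (u x)\<^sup>2) \<le> (M / (2 * pi) + I) * M" using mass by simp
  then have 1: "\<alpha>\<^sup>2 / 2 * integral {-pi..pi} (\<lambda>x. (u x)\<^sup>2) \<le> \<alpha>\<^sup>2 / 2 * ((M / (2 * pi) + I) * M)"
    by (intro mult_left_mono) auto
  have "u x * cos x \<le> u x" for x using mult_left_mono[OF cos_le_one nonneg] by simp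
  then have "integral {-pi..pi} (\<lambda>x. u x * cos x) \<le> integral {-pi..pi} u"
    by (intro integral_le sqint_mult_integrable sqint_integrable[OF us] us sqint_continuous_on[of _ _ cos]
        continuous_intros)
  then have 2: "integral {-pi..pi} (\<lambda>x. u x * cos x) \<le> M" using mass by simp
  have 3: "I\<^sup>2 \<le> 2 * pi * G"
    using integral_abs_sq_le[OF H1d_sqint[OF u]] by (simp add: I_def G_def)
  \<comment> \<open>Young's inequality; the weight \<open>1 / (8 * pi)\<close> makes the square of
    \<open>I\<close> cost just a quarter of the Dirichlet integral, half of what is
    available.\<close>
  have "0 \<le> (I - 4 * pi * k)\<^sup>2 / (8 * pi)" by simp
  also have "\<dots> = I\<^sup>2 / (8 * pi) - k * I + 2 * pi * k\<^sup>2" by (simp add: power2_diff field_simps power2_eq_square)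
  also have "I\<^sup>2 / (8 * pi) \<le> G / 4" using 3 by (simp add: field_simps)
  finally have 4: "k * I \<le> G / 4 + 2 * pi * k\<^sup>2" by simp
  have "\<alpha>\<^sup>2 / 2 * ((M / (2 * pi) + I) * M) = k * M / (2 * pi) + k * I" by (simp add: k_def field_simps)
  then show ?thesis using 1 2 4 unfolding energy_split[OF u] G_def[symmetric] by linarith
qed

text \<open>For two almost minimal competitors the left side is small, since their midpoint is
  admissible too. Once the functions are uniformly close, their derivatives are then close in
  L2.\<close>

lemma energy_parallelogram:
  assumes u: "H1d u g" and v: "H1d v h"
  shows "energy \<alpha> u + energy \<alpha> v - 2 * energy \<alpha> (\<lambda>x. 1 / 2 * (u x + v x))
    = 1 / 4 * integral {-pi..pi} (\<lambda>x. (g x - h x)\<^sup>2) - \<alpha>\<^sup>2 / 4 * integral {-pi..pi} (\<lambda>x. (u x - v x)\<^sup>2)"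
proof -
  note mid = H1d_cmult[OF H1d_add[OF u v], of "1 / 2"]
  have par: "integral {-pi..pi} (\<lambda>x. (1 / 2 * (f x + f' x))\<^sup>2)
     = 1 / 2 * integral {-pi..pi} (\<lambda>x. (f x)\<^sup>2) + 1 / 2 * integral {-pi..pi} (\<lambda>x. (f' x)\<^sup>2)
         - 1 / 4 * integral {-pi..pi} (\<lambda>x. (f x - f' x)\<^sup>2)"
    if s: "sqint (-pi) pi f" "sqint (-pi) pi f'" for f f'
  proof (rule integral_unique)
    have I: "((\<lambda>x. 1 / 2 * (f x)\<^sup>2 + 1 / 2 * (f' x)\<^sup>2 - 1 / 4 * (f x - f' x)\<^sup>2) has_integral
     (1 / 2 * integral {-pi..pi} (\<lambda>x. (f x)\<^sup>2) + 1 / 2 * integral {-pi..pi} (\<lambda>x. (f' x)\<^sup>2)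
         - 1 / 4 * integral {-pi..pi} (\<lambda>x. (f x - f' x)\<^sup>2)))
      {-pi..pi}"
      by (intro has_integral_add has_integral_diff
          has_integral_mult_right integrable_integral sqint_integrable_sq sqint_diff s)
    have "1 / 2 * (f x)\<^sup>2 + 1 / 2 * (f' x)\<^sup>2 - 1 / 4 * (f x - f' x)\<^sup>2 = (1 / 2 * (f x + f' x))\<^sup>2" for x
      by (simp add: power2_eq_square field_simps)
    then show "((\<lambda>x. (1 / 2 * (f x + f' x))\<^sup>2) has_integral
     (1 / 2 * integral {-pi..pi} (\<lambda>x. (f x)\<^sup>2) + 1 / 2 * integral {-pi..pi} (\<lambda>x. (f' x)\<^sup>2)
         - 1 / 4 * integral {-pi..pi} (\<lambda>x. (f x - f' x)\<^sup>2)))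
      {-pi..pi}" using I by simp
  qed
  have c: "sqint (-pi) pi cos" by (intro sqint_continuous_on continuous_intros)
  have lin: "integral {-pi..pi} (\<lambda>x. 1 / 2 * (u x + v x) * cos x)
      = 1 / 2 * integral {-pi..pi} (\<lambda>x. u x * cos x) + 1 / 2 * integral {-pi..pi} (\<lambda>x. v x * cos x)"
  proof -
    have "((\<lambda>x. 1 / 2 * (u x * cos x) + 1 / 2 * (v x * cos x)) has_integral
      (1 / 2 * integral {-pi..pi} (\<lambda>x. u x * cos x) + 1 / 2 * integral {-pi..pi} (\<lambda>x. v x * cos x))) {-pi..pi}"
      by (intro has_integral_add has_integral_mult_right integrable_integral sqint_mult_integrable c
         H1d_sqint_fun[OF u] H1d_sqint_fun[OF v])
    then show ?thesis by (intro integral_unique) (simp add: field_simps)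
  qed
  show ?thesis
    unfolding energy_split[OF u] energy_split[OF v] energy_split[OF mid] lin
      par[OF H1d_sqint[OF u] H1d_sqint[OF v]] par[OF H1d_sqint_fun[OF u] H1d_sqint_fun[OF v]]
    by (simp add: algebra_simps)
qed

text \<open>Partial sums of the thresholds give a strictly increasing choice that dominates each
  threshold from its index on.\<close>

lemma fast_subsequence:
  fixes P :: "nat \<Rightarrow> nat \<Rightarrow> nat \<Rightarrow> bool"
  assumes "\<And>n. \<exists>N. \<forall>a\<ge>N. \<forall>b\<ge>N. P n a b"
  obtains r where "strict_mono r" "\<And>n. P n (r (Suc n)) (r n)"
proof -
  obtain N where N: "\<And>n a b. N n \<le> a \<Longrightarrow> N n \<le> b \<Longrightarrow> P n a b" using assms by metis
  define r where "r n = n + (\<Sum>i\<le>n. N i)" for n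
  have "strict_mono r" by (auto simp: strict_mono_Suc_iff r_def)
  moreover have "N n \<le> r n" for n unfolding r_def using member_le_sum[of n "{..n}" N] by simp
  then have "P n (r (Suc n)) (r n)" for n
    using N[of n "r (Suc n)" "r n"] strict_mono_Suc_iff[THEN iffD1, OF \<open>strict_mono r\<close>, rule_format, of n]
    by (meson less_imp_le order_trans)
  ultimately show ?thesis using that by blast
qed

lemma minimizer_exists:
  assumes "M > 0"
  shows "\<exists>u. minimizer \<alpha> M u"
proof -
  define \<kappa> where "\<kappa> = \<alpha>\<^sup>2 * M / 2"
  define C where "C = 2 * pi * \<kappa>\<^sup>2 + \<kappa> * M / (2 * pi) + M"
  define m where "m = Inf (energy \<alpha> ` admissible M)"
  have coer: "1 / 4 * integral {-pi..pi} (\<lambda>x. (g x)\<^sup>2) - C \<le> energy \<alpha> u"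
    if "H1d u g" "u \<in> admissible M" for u g
    using energy_coercive[OF that(1) _ _ \<kappa>_def] that(2) unfolding C_def by (auto simp: admissible_iff)
  have lower: "- C \<le> energy \<alpha> u" if u: "u \<in> admissible M" for u
  proof -
    obtain g where g: "H1d u g" using u by (auto simp: admissible_iff)
    have "0 \<le> integral {-pi..pi} (\<lambda>x. (g x)\<^sup>2)" by (intro integral_nonneg sqint_integrable_sq H1d_sqint[OF g]) auto
    then show ?thesis using coer[OF g u] by linarith
  qed
  have bdd: "bdd_below (energy \<alpha> ` admissible M)" using lower by (rule bdd_belowI2)
  have m_le: "m \<le> energy \<alpha> u" if "u \<in> admissible M" for u
    unfolding m_def using bdd that by (intro cInf_lower) auto
  have "H1d (\<lambda>_. M / (2 * pi)) (\<lambda>_. 0)" by (simp add: H1d_def periodic_def AC2_const)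
  then have "(\<lambda>_. M / (2 * pi)) \<in> admissible M"
    using assms by (auto simp: admissible_iff content_real)
  then have ne: "energy \<alpha> ` admissible M \<noteq> {}" by blast
  have "\<exists>u g. H1d u g \<and> u \<in> admissible M \<and> energy \<alpha> u < m + 1 / Suc n" for n
  proof -
    have "Inf (energy \<alpha> ` admissible M) < m + 1 / Suc n" by (simp add: m_def)
    then obtain u where u: "u \<in> admissible M" "energy \<alpha> u < m + 1 / Suc n"
      using cInf_less_iff[OF ne bdd] by auto
    then obtain g where "H1d u g" by (auto simp: admissible_iff)
    then show ?thesis using u by blast
  qed
  then obtain V0 D0 where V0: "\<And>n. H1d (V0 n) (D0 n)" "\<And>n. V0 n \<in> admissible M" "\<And>n. energy \<alpha> (V0 n) < m
      + 1 / Suc n"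
    by metis
  \<comment> \<open>Coercivity bounds the Dirichlet integral of any competitor with energy below
    \<open>m + 1\<close>.\<close>
  define Gm where "Gm = 4 * (m + 1 + C)"
  have G_bound: "integral {-pi..pi} (\<lambda>x. (D0 n x)\<^sup>2) \<le> Gm" for n
  proof -
    have "energy \<alpha> (V0 n) < m + 1" using V0(3)[of n] by (rule order_less_le_trans) simp
    then show ?thesis using coer[OF V0(1,2), of n] unfolding Gm_def by simp
  qed
  have Gm0: "0 \<le> Gm"
    using order_trans[OF integral_nonneg[OF sqint_integrable_sq[OF H1d_sqint[OF V0(1)]]] G_bound, of 0] by simp
  have V_nonneg: "0 \<le> V0 n x" and V_mass: "integral {-pi..pi} (V0 n) = M" for n x
    using V0(2)[of n] by (auto simp: admissible_iff)
  define B where "B = M / (2 * pi) + sqrt (2 * pi * Gm)"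
  have V_bound: "\<bar>V0 n x\<bar> \<le> B" if "x \<in> {-pi..pi}" for n x
  proof -
    have "(integral {-pi..pi} (\<lambda>x. \<bar>D0 n x\<bar>))\<^sup>2 \<le> 2 * pi * Gm"
      using order_trans[OF integral_abs_sq_le[OF H1d_sqint[OF V0(1)]] mult_left_mono[OF G_bound]] by force
    then have "integral {-pi..pi} (\<lambda>x. \<bar>D0 n x\<bar>) \<le> sqrt (2 * pi * Gm)" by (rule real_le_rsqrt)
    then show ?thesis using H1d_sup_bound[OF V0(1) V_nonneg that, of n] V_nonneg[of n x] V_mass
        by (simp add: B_def)
  qed
  \<comment> \<open>Hoelder continuity of exponent 1/2 with a common constant, which provides the
    equicontinuity for Arzela-Ascoli.\<close>
  have equi: "(V0 n x - V0 n y)\<^sup>2 \<le> \<bar>x - y\<bar> * Gm" if xy: "x \<in> {-pi..pi}" "y \<in> {-pi..pi}" for n x y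
  proof -
    have *: "(V0 n y - V0 n x)\<^sup>2 \<le> (y - x) * Gm" if "-pi \<le> x" "x \<le> y" "y \<le> pi" for x y
    proof -
      note s = sqint_subinterval[OF H1d_sqint[OF V0(1)[of n]] that(1,3)]
      have "V0 n y - V0 n x = integral {x..y} (D0 n)" using AC2_diff[OF H1d_AC2[OF V0(1)] that] .
      moreover have "\<bar>integral {x..y} (D0 n)\<bar> \<le> integral {x..y} (\<lambda>t. \<bar>D0 n t\<bar>)"
        using sqint_integral_abs_le[OF s, of x y] by simp
      ultimately have "(V0 n y - V0 n x)\<^sup>2 \<le> (integral {x..y} (\<lambda>t. \<bar>D0 n t\<bar>))\<^sup>2"
        by (metis abs_le_square_iff abs_ge_zero abs_of_nonneg order_trans)
      also have "\<dots> \<le> (y - x) * integral {x..y} (\<lambda>t. (D0 n t)\<^sup>2)" by (rule integral_abs_sq_le[OF s that(2)])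
      also have "integral {x..y} (\<lambda>t. (D0 n t)\<^sup>2) \<le> integral {-pi..pi} (\<lambda>t. (D0 n t)\<^sup>2)"
        using that by (intro integral_subset_le sqint_integrable_sq[OF s] sqint_integrable_sq[OF H1d_sqint[OF
            V0(1)]]) auto
      also have "\<dots> \<le> Gm" by (rule G_bound)
      finally show ?thesis using that by (simp add: mult_left_mono)
    qed
    show ?thesis
      using *[of x y] *[of y x] xy by (cases "x \<le> y") (auto simp: power2_commute)
  qed
  obtain f k where k: "strict_mono (k :: nat \<Rightarrow> nat)"
    and unif: "\<And>e. 0 < e \<Longrightarrow> \<exists>N. \<forall>n x. n \<ge> N \<and> x \<in> {-pi..pi} \<longrightarrow> norm (V0 (k n) x - f x) < e"
  proof (rule Arzela_Ascoli[of "{-pi..pi}" V0 B])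
    show "norm (V0 n x) \<le> B" if "x \<in> {-pi..pi}" for n x using V_bound[OF that] by simp
    fix x e :: real assume x: "x \<in> {-pi..pi}" and e: "0 < e"
    have "\<bar>V0 n x - V0 n y\<bar> < e" if "y \<in> {-pi..pi}" "\<bar>x - y\<bar> < e\<^sup>2 / (Gm + 1)" for n y
    proof -
      have "(V0 n x - V0 n y)\<^sup>2 \<le> \<bar>x - y\<bar> * Gm" by (rule equi[OF x that(1)])
      also have "\<dots> \<le> \<bar>x - y\<bar> * (Gm + 1)" by (intro mult_left_mono) auto
      also have "\<dots> < e\<^sup>2" using that(2) Gm0 by (simp add: field_simps)
      finally show ?thesis using e by (metis abs_of_pos power2_abs power2_less_imp_less less_imp_le)
    qed
    then show "\<exists>d>0. \<forall>n y. y \<in> {-pi..pi} \<and> norm (x - y) < d \<longrightarrow> norm (V0 n x - V0 n y) < e"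
      using e Gm0 by (intro exI[of _ "e\<^sup>2 / (Gm + 1)"]) auto
  qed auto
  have Cauchy: "\<exists>N. \<forall>a\<ge>N. \<forall>b\<ge>N. integral {-pi..pi} (\<lambda>x. (D0 (k a) x - D0 (k b) x)\<^sup>2) \<le> (1/4)^n" for n :: nat
  proof -
    define \<epsilon> where "\<epsilon> = (1/4::real)^n"
    have \<epsilon>: "\<epsilon> > 0" by (simp add: \<epsilon>_def)
    \<comment> \<open>Functions within \<open>\<eta>\<close> of the limit differ by at most
      \<open>2 * \<eta>\<close>, so their squared difference integrates to at most
      \<open>8 * pi * \<eta>^2\<close>. The summand 1 in \<open>\<alpha>^2 + 1\<close> avoids a
      division by zero at \<open>\<alpha> = 0\<close>.\<close>
    define \<eta> where "\<eta> = sqrt (\<epsilon> / (16 * pi * (\<alpha>\<^sup>2 + 1)))"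
    have \<eta>: "\<eta> > 0" "\<alpha>\<^sup>2 * (8 * pi * \<eta>\<^sup>2) \<le> \<epsilon> / 2"
    proof -
      have pos: "0 < 16 * pi * (\<alpha>\<^sup>2 + 1)" by (simp add: add_nonneg_pos)
      then show "\<eta> > 0" using \<epsilon> unfolding \<eta>_def by simp
      have "\<eta>\<^sup>2 = \<epsilon> / (16 * pi * (\<alpha>\<^sup>2 + 1))" using pos \<epsilon> unfolding \<eta>_def by (simp add: less_imp_le)
      then have "(\<alpha>\<^sup>2 + 1) * (8 * pi * \<eta>\<^sup>2) = \<epsilon> / 2" using pos by (simp add: field_simps)
      moreover have "\<alpha>\<^sup>2 * (8 * pi * \<eta>\<^sup>2) \<le> (\<alpha>\<^sup>2 + 1) * (8 * pi * \<eta>\<^sup>2)" by (intro mult_right_mono) auto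
      ultimately show "\<alpha>\<^sup>2 * (8 * pi * \<eta>\<^sup>2) \<le> \<epsilon> / 2" by linarith
    qed
    obtain N1 where N1: "\<And>n x. n \<ge> N1 \<Longrightarrow> x \<in> {-pi..pi} \<Longrightarrow> \<bar>V0 (k n) x - f x\<bar> < \<eta>"
      using unif[OF \<eta>(1)] by auto
    obtain N2 :: nat where N2: "16 / \<epsilon> < N2" using reals_Archimedean2 by blast
    have "integral {-pi..pi} (\<lambda>x. (D0 (k a) x - D0 (k b) x)\<^sup>2) \<le> \<epsilon>"
      if ab: "max N1 N2 \<le> a" "max N1 N2 \<le> b" for a b
    proof -
      have small: "1 / Suc (k c) \<le> \<epsilon> / 16" if "N2 \<le> c" for c
      proof -
        have "16 / \<epsilon> < Suc (k c)" using N2 that seq_suble[OF k, of c] by linarith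
        then show ?thesis using \<epsilon> by (simp add: field_simps)
      qed
      have "(V0 (k a) x - V0 (k b) x)\<^sup>2 \<le> 4 * \<eta>\<^sup>2" if "x \<in> {-pi..pi}" for x
      proof -
        have "\<bar>V0 (k a) x - V0 (k b) x\<bar> \<le> \<bar>2 * \<eta>\<bar>" using N1[OF _ that, of a] N1[OF _ that, of b] ab by force
        then show ?thesis unfolding abs_le_square_iff by (simp add: power_mult_distrib)
      qed
      then have "integral {-pi..pi} (\<lambda>x. (V0 (k a) x - V0 (k b) x)\<^sup>2) \<le> integral {-pi..pi} (\<lambda>_. 4 * \<eta>\<^sup>2)"
        by (intro integral_le sqint_integrable_sq sqint_diff H1d_sqint_fun[OF V0(1)]) auto
      then have "integral {-pi..pi} (\<lambda>x. (V0 (k a) x - V0 (k b) x)\<^sup>2) \<le> 8 * pi * \<eta>\<^sup>2" by (simp add: content_real)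
      then have 1: "\<alpha>\<^sup>2 * integral {-pi..pi} (\<lambda>x. (V0 (k a) x - V0 (k b) x)\<^sup>2) \<le> \<epsilon> / 2"
        using \<eta>(2) mult_left_mono[of _ _ "\<alpha>\<^sup>2"] by (meson order_trans zero_le_power2)
      define w where "w = (\<lambda>x. 1 / 2 * (V0 (k a) x + V0 (k b) x))"
      have "w \<in> admissible M"
        unfolding admissible_iff w_def
      proof (intro conjI allI exI)
        show "H1d (\<lambda>x. 1 / 2 * (V0 (k a) x + V0 (k b) x)) (\<lambda>x. 1 / 2 * (D0 (k a) x + D0 (k b) x))"
          by (intro H1d_cmult H1d_add V0)
        show "0 \<le> 1 / 2 * (V0 (k a) x + V0 (k b) x)" for x using V_nonneg by simp
        have "integral {-pi..pi} (\<lambda>x. V0 (k a) x + V0 (k b) x) = M + M"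
          by (subst integral_add) (auto simp: V_mass intro: sqint_integrable H1d_sqint_fun[OF V0(1)])
        then show "integral {-pi..pi} (\<lambda>x. 1 / 2 * (V0 (k a) x + V0 (k b) x)) = M" by simp
      qed
      then have "m \<le> energy \<alpha> w" by (rule m_le)
      then have "1 / 4 * integral {-pi..pi} (\<lambda>x. (D0 (k a) x - D0 (k b) x)\<^sup>2)
          \<le> 1 / Suc (k a) + 1 / Suc (k b) + 1 / 4 * (\<alpha>\<^sup>2 * integral {-pi..pi} (\<lambda>x. (V0 (k a) x - V0 (k b) x)\<^sup>2))"
        using energy_parallelogram[OF V0(1) V0(1), of \<alpha> "k a" "k b"] V0(3)[of "k a"] V0(3)[of "k b"]
        unfolding w_def by simp
      \<comment> \<open>The shares add up to \<open>\<epsilon> / 4\<close>, matching the factor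
        \<open>1 / 4\<close> in front of the Dirichlet term.\<close>
      also have "\<dots> \<le> \<epsilon> / 16 + \<epsilon> / 16 + 1 / 4 * (\<epsilon> / 2)"
        using small[of a] small[of b] 1 ab by (intro add_mono mult_left_mono) auto
      finally show ?thesis by simp
    qed
    then show ?thesis unfolding \<epsilon>_def by blast
  qed
  obtain r where r: "strict_mono r"
      "\<And>n. integral {-pi..pi} (\<lambda>x. (D0 (k (r (Suc n))) x - D0 (k (r n)) x)\<^sup>2) \<le> (1/4)^n"
    using fast_subsequence[of "\<lambda>n a b. integral {-pi..pi} (\<lambda>x. (D0 (k a) x - D0 (k b) x)\<^sup>2)
        \<le> (1/4)^n"] Cauchy by blast
  define V D where "V n = V0 (k (r n))" and "D n = D0 (k (r n))" for n
  have V: "H1d (V n) (D n)" for n unfolding V_def D_def by (rule V0)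
  have conv: "(\<lambda>n. V n x) \<longlonglongrightarrow> f x" if x: "x \<in> {-pi..pi}" for x
  proof -
    have "(\<lambda>n. V0 (k n) x) \<longlonglongrightarrow> f x"
      unfolding LIMSEQ_iff using unif x by (metis real_norm_def)
    from LIMSEQ_subseq_LIMSEQ[OF this r(1)] show ?thesis by (simp add: V_def o_def)
  qed
  have E_lim: "(\<lambda>n. energy \<alpha> (V n)) \<longlonglongrightarrow> m"
  proof (rule tendsto_sandwich)
    show "\<forall>\<^sub>F n in sequentially. m \<le> energy \<alpha> (V n)" using m_le V0(2) by (auto simp: V_def)
    have "strict_mono (\<lambda>n. k (r n))" using k r(1) by (auto simp: strict_mono_def)
    then have "energy \<alpha> (V n) \<le> m + 1 / Suc n" for n
      using V0(3)[of "k (r n)"] seq_suble[of "\<lambda>n. k (r n)" n] unfolding V_def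
      by (smt (verit) frac_le of_nat_0_less_iff of_nat_le_iff Suc_le_mono zero_less_Suc)
    then show "\<forall>\<^sub>F n in sequentially. energy \<alpha> (V n) \<le> m + 1 / Suc n" by simp
    have "(\<lambda>n. m + 1 / Suc n) \<longlonglongrightarrow> m + 0" by (intro tendsto_intros LIMSEQ_Suc lim_1_over_n)
    then show "(\<lambda>n. m + 1 / Suc n) \<longlonglongrightarrow> m" by simp
  qed simp
  have dc: "(\<lambda>n. integral {-pi..pi} (\<lambda>x. F (V n x) x)) \<longlonglongrightarrow> integral {-pi..pi} (\<lambda>x. F (f x) x)"
    if F: "\<And>n. (\<lambda>x. F (V n x) x) integrable_on {-pi..pi}" "\<And>y x. \<bar>y\<bar> \<le> B \<Longrightarrow> \<bar>F y x\<bar>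
        \<le> K" "\<And>x y. isCont (\<lambda>y. F y x) y"
    for F :: "real \<Rightarrow> real \<Rightarrow> real" and K
  proof (rule dominated_convergence(2)[where h="\<lambda>_. K"])
    show "norm (F (V n x) x) \<le> K" if "x \<in> {-pi..pi}" for n x
      using F(2)[OF V_bound[OF that]] by (simp add: V_def)
    show "(\<lambda>n. F (V n x) x) \<longlonglongrightarrow> F (f x) x" if "x \<in> {-pi..pi}" for x
      using isCont_tendsto_compose[OF F(3) conv[OF that]] .
  qed (use F in auto)
  note Vs = H1d_sqint_fun[OF V]
  have lim1: "(\<lambda>n. integral {-pi..pi} (\<lambda>x. V n x)) \<longlonglongrightarrow> integral {-pi..pi} f"
    using dc[of "\<lambda>y x. y" B] Vs by (simp add: sqint_integrable)
  have lim2: "(\<lambda>n. integral {-pi..pi} (\<lambda>x. (V n x)\<^sup>2)) \<longlonglongrightarrow> integral {-pi..pi} (\<lambda>x. (f x)\<^sup>2)"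
  proof (rule dc[of "\<lambda>y x. y\<^sup>2" "B\<^sup>2"])
    show "\<bar>y\<^sup>2\<bar> \<le> B\<^sup>2" if "\<bar>y\<bar> \<le> B" for y x using that by (simp add: abs_le_square_iff[symmetric])
  qed (auto intro: sqint_integrable_sq Vs)
  have lim3: "(\<lambda>n. integral {-pi..pi} (\<lambda>x. V n x * cos x)) \<longlonglongrightarrow> integral {-pi..pi} (\<lambda>x. f x * cos x)"
  proof (rule dc[of "\<lambda>y x. y * cos x" B])
    show "\<bar>y * cos x\<bar> \<le> B" if "\<bar>y\<bar> \<le> B" for y x
      using mult_mono[OF that abs_cos_le_one] that by (simp add: abs_mult)
    show "(\<lambda>x. V n x * cos x) integrable_on {-pi..pi}" for n
      by (intro sqint_mult_integrable Vs sqint_continuous_on continuous_intros)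
  qed auto
  \<comment> \<open>The Dirichlet integrals converge to \<open>L\<close> because the energies tend
    to the infimum and the terms of lower order converge.\<close>
  define L where "L = 2 * (m + \<alpha>\<^sup>2 / 2 * integral {-pi..pi} (\<lambda>x. (f x)\<^sup>2) + integral {-pi..pi} (\<lambda>x. f x * cos x))"
  have "(\<lambda>n. 2 * (energy \<alpha> (V n) + \<alpha>\<^sup>2 / 2 * integral {-pi..pi} (\<lambda>x. (V n x)\<^sup>2)
      + integral {-pi..pi} (\<lambda>x. V n x * cos x))) \<longlonglongrightarrow> L"
    unfolding L_def by (intro tendsto_intros E_lim lim2 lim3)
  then have D_lim: "(\<lambda>n. integral {-pi..pi} (\<lambda>x. (D n x)\<^sup>2)) \<longlonglongrightarrow> L"
    unfolding energy_split[OF V] by simp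
  have fast: "integral {-pi..pi} (\<lambda>x. (D (Suc n) x - D n x)\<^sup>2) \<le> (1/4)^n" for n
    using r(2) by (simp add: D_def)
  obtain g where g: "AC2 (-pi) pi f g" "g \<in> borel_measurable borel" "integral {-pi..pi} (\<lambda>x. (g x)\<^sup>2) \<le> L"
    by (rule H1d_limit[OF V conv fast D_lim])
  have "f pi = f (-pi)"
  proof (rule LIMSEQ_unique)
    show "(\<lambda>n. V n pi) \<longlonglongrightarrow> f pi" by (rule conv) simp
    have "V n pi = V n (-pi)" for n
      using V[of n] periodic_def[of "V n", THEN iffD1, rule_format, of "-pi"] by (simp add: H1d_def)
    then show "(\<lambda>n. V n pi) \<longlonglongrightarrow> f (-pi)" using conv[of "-pi"] by simp
  qed
  obtain h where h: "H1d (\<lambda>x. f (wrap x)) h" "integral {-pi..pi} (\<lambda>x. (h x)\<^sup>2) = integral {-pi..pi} (\<lambda>x. (g x)\<^sup>2)"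
    by (rule AC2_periodic_extension[OF g(1,2) \<open>f pi = f (-pi)\<close>])
  have wrap_eq: "f (wrap x) = f x" if "x \<in> {-pi..pi}" for x using that \<open>f pi = f (-pi)\<close> by (intro wrap_comp_eq)
  have cong: "integral {-pi..pi} (\<lambda>x. F (f (wrap x)) x) = integral {-pi..pi} (\<lambda>x. F (f x) x)"
      for F :: "real \<Rightarrow> real \<Rightarrow> real"
    by (rule integral_cong) (simp add: wrap_eq)
  have "energy \<alpha> (\<lambda>x. f (wrap x)) = 1 / 2 * integral {-pi..pi} (\<lambda>x. (g x)\<^sup>2)
      - \<alpha>\<^sup>2 / 2 * integral {-pi..pi} (\<lambda>x. (f x)\<^sup>2)
     - integral {-pi..pi} (\<lambda>x. f x * cos x)"
    unfolding energy_split[OF h(1)] h(2) using cong[of "\<lambda>y x. y\<^sup>2"] cong[of "\<lambda>y x. y * cos x"] by simp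
  then have "energy \<alpha> (\<lambda>x. f (wrap x)) \<le> m" using g(3) unfolding L_def by simp
  moreover have "(\<lambda>x. f (wrap x)) \<in> admissible M"
    unfolding admissible_iff
  proof (intro conjI exI allI)
    show "H1d (\<lambda>x. f (wrap x)) h" by (rule h)
    show "0 \<le> f (wrap x)" for x
      using wrap_bounds[of x] V_nonneg by (intro LIMSEQ_le_const[OF conv]) (auto simp: V_def)
    have "(\<lambda>n. M) \<longlonglongrightarrow> integral {-pi..pi} f" using lim1 by (simp add: V_def V_mass)
    then have "integral {-pi..pi} f = M" by (simp add: LIMSEQ_const_iff)
    then show "integral {-pi..pi} (\<lambda>x. f (wrap x)) = M" using cong[of "\<lambda>y x. y"] by simp
  qed
  ultimately show ?thesis unfolding minimizer_iff using m_le by (metis order_trans)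
qed

section \<open>The family of droplets\<close>

text \<open>On the support of a droplet, \<open>p = u'\<close> solves \<open>p'' + \<alpha>\<^sup>2 p = sin\<close>. Here \<open>homog\<close> is the odd
  solution of the homogeneous equation with slope \<open>1\<close> at \<open>0\<close>, \<open>partic\<close> an odd particular solution,
  \<open>dpartic\<close> its derivative, and \<open>ihomog\<close>, \<open>ipartic\<close> are primitives of \<open>- homog\<close> and \<open>partic\<close>.\<close>

definition homog :: "real \<Rightarrow> real \<Rightarrow> real" where
  "homog \<alpha> t = (if \<alpha> = 0 then t else sin (\<alpha> * t) / \<alpha>)"

definition ihomog :: "real \<Rightarrow> real \<Rightarrow> real" where
  "ihomog \<alpha> t = (if \<alpha> = 0 then - t\<^sup>2 / 2 else (cos (\<alpha> * t) - 1) / \<alpha>\<^sup>2)"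

definition partic :: "real \<Rightarrow> real \<Rightarrow> real" where
  "partic \<alpha> t = (if \<alpha> = 1 then - (t * cos t) / 2 else - sin t / (1 - \<alpha>\<^sup>2))"

definition dpartic :: "real \<Rightarrow> real \<Rightarrow> real" where
  "dpartic \<alpha> t = (if \<alpha> = 1 then (t * sin t - cos t) / 2 else - cos t / (1 - \<alpha>\<^sup>2))"

definition ipartic :: "real \<Rightarrow> real \<Rightarrow> real" where
  "ipartic \<alpha> t = (if \<alpha> = 1 then - (t * sin t + cos t) / 2 else cos t / (1 - \<alpha>\<^sup>2))"

text \<open>The coefficient that makes \<open>slope\<close> vanish at the contact angle, so that the
  droplet meets zero with slope zero. Its strict growth in \<open>\<tau>\<close> governs signs,
  ordering and masses.\<close>

definition ratio :: "real \<Rightarrow> real \<Rightarrow> real" where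
  "ratio \<alpha> t = partic \<alpha> t / homog \<alpha> t"

definition slope :: "real \<Rightarrow> real \<Rightarrow> real \<Rightarrow> real" where
  "slope \<alpha> \<tau> t = partic \<alpha> t - ratio \<alpha> \<tau> * homog \<alpha> t"

definition profile :: "real \<Rightarrow> real \<Rightarrow> real \<Rightarrow> real" where
  "profile \<alpha> \<tau> t = ipartic \<alpha> t - ipartic \<alpha> \<tau> + ratio \<alpha> \<tau> * (ihomog \<alpha> t - ihomog \<alpha> \<tau>)"

text \<open>The contact angles for which \<open>homog\<close> is positive up to and including
  \<open>\<tau>\<close>. The value \<open>pi\<close> belongs to it for \<open>\<alpha> < 1\<close>
  only and stands for the droplet that covers the circle.\<close>

definition radii :: "real \<Rightarrow> real set" where
  "radii \<alpha> = {\<tau>. 0 < \<tau> \<and> \<tau> \<le> pi \<and> \<alpha> * \<tau> < pi}"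

lemma one_minus_sq_nonzero: "0 \<le> \<alpha> \<Longrightarrow> \<alpha> \<noteq> 1 \<Longrightarrow> 1 - (\<alpha>::real)\<^sup>2 \<noteq> 0"
  by (simp add: power2_eq_1_iff)

lemma DERIV_homog: "(homog \<alpha> has_real_derivative cos (\<alpha> * t)) (at t)"
  unfolding homog_def[abs_def] by (cases "\<alpha> = 0") (auto intro!: derivative_eq_intros)

lemma DERIV_ihomog: "(ihomog \<alpha> has_real_derivative - homog \<alpha> t) (at t)"
  unfolding homog_def ihomog_def[abs_def]
  by (cases "\<alpha> = 0") (auto intro!: derivative_eq_intros simp: power2_eq_square)

lemma DERIV_partic: "(partic \<alpha> has_real_derivative dpartic \<alpha> t) (at t)"
proof (cases "\<alpha> = 1")
  case True
  then show ?thesis unfolding partic_def[abs_def] dpartic_def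
      by (auto intro!: derivative_eq_intros simp: field_simps)
next
  case False
  have "((\<lambda>t. - sin t / (1 - \<alpha>\<^sup>2)) has_real_derivative - cos t / (1 - \<alpha>\<^sup>2)) (at t)"
    by (rule DERIV_cdivide) (auto intro!: derivative_eq_intros)
  then show ?thesis using False by (simp add: partic_def[abs_def] dpartic_def)
qed

lemma DERIV_ipartic: "(ipartic \<alpha> has_real_derivative partic \<alpha> t) (at t)"
proof (cases "\<alpha> = 1")
  case True
  then show ?thesis unfolding ipartic_def[abs_def] partic_def
      by (auto intro!: derivative_eq_intros simp: field_simps)
next
  case False
  have "((\<lambda>t. cos t / (1 - \<alpha>\<^sup>2)) has_real_derivative - sin t / (1 - \<alpha>\<^sup>2)) (at t)"
    by (rule DERIV_cdivide) (auto intro!: derivative_eq_intros)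
  then show ?thesis using False by (simp add: ipartic_def[abs_def] partic_def)
qed

lemma DERIV_dpartic:
  assumes "0 \<le> \<alpha>"
  shows "(dpartic \<alpha> has_real_derivative sin t - \<alpha>\<^sup>2 * partic \<alpha> t) (at t)"
proof (cases "\<alpha> = 1")
  case True
  then show ?thesis
    unfolding dpartic_def[abs_def] partic_def by (auto intro!: derivative_eq_intros simp: field_simps)
next
  case False
  have "((\<lambda>t. - cos t / (1 - \<alpha>\<^sup>2)) has_real_derivative sin t / (1 - \<alpha>\<^sup>2)) (at t)"
    by (rule DERIV_cdivide) (auto intro!: derivative_eq_intros)
  then have "(dpartic \<alpha> has_real_derivative sin t / (1 - \<alpha>\<^sup>2)) (at t)"
    using False by (simp add: dpartic_def[abs_def])
  moreover have "sin t / (1 - \<alpha>\<^sup>2) = sin t - \<alpha>\<^sup>2 * partic \<alpha> t"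
    unfolding partic_def using False one_minus_sq_nonzero[OF assms False] by (simp add: field_simps)
  ultimately show ?thesis by simp
qed

lemma homog_odd: "homog \<alpha> (- t) = - homog \<alpha> t" by (simp add: homog_def)
lemma partic_odd: "partic \<alpha> (- t) = - partic \<alpha> t" by (simp add: partic_def)
lemma slope_odd: "slope \<alpha> \<tau> (- t) = - slope \<alpha> \<tau> t" by (simp add: slope_def homog_odd partic_odd)
lemma profile_even: "profile \<alpha> \<tau> (- t) = profile \<alpha> \<tau> t" by (simp add: profile_def ipartic_def ihomog_def)
lemma profile_abs: "profile \<alpha> \<tau> \<bar>t\<bar> = profile \<alpha> \<tau> t" by (simp add: abs_if profile_even)

lemma homog_0 [simp]: "homog \<alpha> 0 = 0" by (simp add: homog_def)
lemma partic_0 [simp]: "partic \<alpha> 0 = 0" by (simp add: partic_def)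
lemma slope_0 [simp]: "slope \<alpha> \<tau> 0 = 0" by (simp add: slope_def)
lemma profile_end [simp]: "profile \<alpha> \<tau> \<tau> = 0" by (simp add: profile_def)

lemma isCont_homog: "isCont (homog \<alpha>) t" using DERIV_homog by (rule DERIV_isCont)
lemma isCont_partic: "isCont (partic \<alpha>) t" using DERIV_partic by (rule DERIV_isCont)
lemma isCont_ihomog: "isCont (ihomog \<alpha>) t" using DERIV_ihomog by (rule DERIV_isCont)
lemma isCont_ipartic: "isCont (ipartic \<alpha>) t" using DERIV_ipartic by (rule DERIV_isCont)

lemma continuous_on_homog [continuous_intros]: "continuous_on A f \<Longrightarrow> continuous_on A (\<lambda>x. homog \<alpha> (f x))"
  by (rule continuous_on_compose2[of UNIV]) (auto intro!: continuous_at_imp_continuous_on isCont_homog)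
lemma continuous_on_partic [continuous_intros]: "continuous_on A f \<Longrightarrow> continuous_on A (\<lambda>x. partic \<alpha> (f x))"
  by (rule continuous_on_compose2[of UNIV]) (auto intro!: continuous_at_imp_continuous_on isCont_partic)
lemma continuous_on_ihomog [continuous_intros]: "continuous_on A f \<Longrightarrow> continuous_on A (\<lambda>x. ihomog \<alpha> (f x))"
  by (rule continuous_on_compose2[of UNIV]) (auto intro!: continuous_at_imp_continuous_on isCont_ihomog)
lemma continuous_on_ipartic [continuous_intros]: "continuous_on A f \<Longrightarrow> continuous_on A (\<lambda>x. ipartic \<alpha> (f x))"
  by (rule continuous_on_compose2[of UNIV]) (auto intro!: continuous_at_imp_continuous_on isCont_ipartic)

lemma homog_pos:
  assumes "0 \<le> \<alpha>" "0 < t" "\<alpha> * t < pi"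
  shows "0 < homog \<alpha> t"
  using assms sin_gt_zero[of "\<alpha> * t"] by (auto simp: homog_def)

lemma radii_le: "\<tau> \<in> radii \<alpha> \<Longrightarrow> 0 \<le> \<alpha> \<Longrightarrow> 0 < t \<Longrightarrow> t \<le> \<tau> \<Longrightarrow> t \<in> radii \<alpha>"
  using mult_left_mono[of t \<tau> \<alpha>] by (auto simp: radii_def)

lemma homog_radii_pos: "\<tau> \<in> radii \<alpha> \<Longrightarrow> 0 \<le> \<alpha> \<Longrightarrow> 0 < homog \<alpha> \<tau>"
  by (rule homog_pos) (auto simp: radii_def)

lemma homog_nonneg: "\<tau> \<in> radii \<alpha> \<Longrightarrow> 0 \<le> \<alpha> \<Longrightarrow> 0 \<le> t \<Longrightarrow> t \<le> \<tau> \<Longrightarrow> 0 \<le> homog \<alpha> t"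
  using homog_radii_pos[of t \<alpha>] radii_le[of \<tau> \<alpha> t] by (cases "t = 0") auto

text \<open>The Wronskian of \<open>homog\<close> and \<open>partic\<close> has derivative \<open>homog \<cdot> sin\<close>.\<close>

lemma wronskian_pos:
  assumes \<alpha>: "0 \<le> \<alpha>" and \<tau>: "\<tau> \<in> radii \<alpha>"
  shows "0 < dpartic \<alpha> \<tau> * homog \<alpha> \<tau> - partic \<alpha> \<tau> * cos (\<alpha> * \<tau>)"
proof -
  define W where "W t = dpartic \<alpha> t * homog \<alpha> t - partic \<alpha> t * cos (\<alpha> * t)" for t
  have W': "(W has_real_derivative homog \<alpha> t * sin t) (at t)" for t
  proof -
    have "(W has_real_derivative ((sin t - \<alpha>\<^sup>2 * partic \<alpha> t) * homog \<alpha> t + cos (\<alpha> * t) * dpartic \<alpha> t)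
        - (dpartic \<alpha> t * cos (\<alpha> * t) + (- sin (\<alpha> * t) * \<alpha>) * partic \<alpha> t)) (at t)"
      unfolding W_def[abs_def]
      by (intro DERIV_diff DERIV_mult DERIV_dpartic \<alpha> DERIV_homog DERIV_partic) (auto intro!: derivative_eq_intros)
    moreover have "\<alpha>\<^sup>2 * homog \<alpha> t = sin (\<alpha> * t) * \<alpha>" by (simp add: homog_def power2_eq_square)
    then have "(sin t - \<alpha>\<^sup>2 * partic \<alpha> t) * homog \<alpha> t + cos (\<alpha> * t) * dpartic \<alpha> t
        - (dpartic \<alpha> t * cos (\<alpha> * t) + (- sin (\<alpha> * t) * \<alpha>) * partic \<alpha> t) = homog \<alpha> t * sin t"
      by (simp add: algebra_simps)
    ultimately show ?thesis by simp
  qed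
  have "W 0 < W \<tau>"
  proof (rule DERIV_pos_imp_increasing_open[where f=W and a=0 and b=\<tau>])
    show "0 < \<tau>" using \<tau> by (simp add: radii_def)
    show "\<exists>y. (W has_real_derivative y) (at t) \<and> 0 < y" if "0 < t" "t < \<tau>" for t
      using W'[of t] homog_radii_pos[OF radii_le[OF \<tau> \<alpha>], of t] sin_gt_zero[of t] that \<alpha> \<tau>
      by (intro exI[of _ "homog \<alpha> t * sin t"]) (auto simp: radii_def)
    show "continuous_on {0..\<tau>} W" using W' by (meson DERIV_isCont continuous_at_imp_continuous_on)
  qed
  then show ?thesis by (simp add: W_def)
qed

text \<open>The numerator is the Wronskian of the previous lemma, so \<open>ratio\<close> has
  positive derivative on the radii.\<close>

lemma DERIV_ratio:
  assumes \<alpha>: "0 \<le> \<alpha>" and \<tau>: "\<tau> \<in> radii \<alpha>"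
  shows "(ratio \<alpha> has_real_derivative
    (dpartic \<alpha> \<tau> * homog \<alpha> \<tau> - partic \<alpha> \<tau> * cos (\<alpha> * \<tau>)) / (homog \<alpha> \<tau>)\<^sup>2) (at \<tau>)"
  unfolding ratio_def[abs_def] using homog_radii_pos[OF \<tau> \<alpha>]
  by (auto intro!: derivative_eq_intros DERIV_partic DERIV_homog simp: power2_eq_square)

lemma ratio_less:
  assumes \<alpha>: "0 \<le> \<alpha>" and st: "0 < s" "s < t" "t \<in> radii \<alpha>"
  shows "ratio \<alpha> s < ratio \<alpha> t"
proof (rule DERIV_pos_imp_increasing[OF st(2), where f="ratio \<alpha>"])
  fix x assume "s \<le> x" "x \<le> t"
  then have "x \<in> radii \<alpha>" using radii_le[OF st(3) \<alpha>] st by simp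
  then show "\<exists>y. (ratio \<alpha> has_real_derivative y) (at x) \<and> 0 < y"
    using DERIV_ratio[OF \<alpha>] wronskian_pos[OF \<alpha>] homog_radii_pos[OF _ \<alpha>] by (metis divide_pos_pos zero_less_power)
qed

text \<open>This factorization reduces the sign of the slope to the monotonicity of
  \<open>ratio\<close>.\<close>

lemma slope_eq: "0 < homog \<alpha> t \<Longrightarrow> slope \<alpha> \<tau> t = homog \<alpha> t * (ratio \<alpha> t - ratio \<alpha> \<tau>)"
  by (simp add: slope_def ratio_def field_simps)

lemma slope_neg:
  assumes \<alpha>: "0 \<le> \<alpha>" and \<tau>: "\<tau> \<in> radii \<alpha>" and t: "0 < t" "t < \<tau>"
  shows "slope \<alpha> \<tau> t < 0"
proof -
  have "0 < homog \<alpha> t" using homog_radii_pos[OF radii_le[OF \<tau> \<alpha>]] \<alpha> t by simp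
  then show ?thesis using ratio_less[OF \<alpha> t \<tau>] by (simp add: slope_eq mult_pos_neg)
qed

lemma slope_end: "0 \<le> \<alpha> \<Longrightarrow> \<tau> \<in> radii \<alpha> \<Longrightarrow> slope \<alpha> \<tau> \<tau> = 0"
  using homog_radii_pos[of \<tau> \<alpha>] by (simp add: slope_eq)

lemma DERIV_profile: "(profile \<alpha> \<tau> has_real_derivative slope \<alpha> \<tau> t) (at t)"
  unfolding profile_def[abs_def] slope_def
  by (auto intro!: derivative_eq_intros DERIV_ipartic DERIV_ihomog)

lemma DERIV_slope: "(slope \<alpha> \<tau> has_real_derivative dpartic \<alpha> t - ratio \<alpha> \<tau> * cos (\<alpha> * t)) (at t)"
  unfolding slope_def[abs_def]
  by (auto intro!: derivative_eq_intros DERIV_partic DERIV_homog)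

lemma profile_strict_decr:
  assumes \<alpha>: "0 \<le> \<alpha>" and \<tau>: "\<tau> \<in> radii \<alpha>" and st: "0 \<le> s" "s < t" "t \<le> \<tau>"
  shows "profile \<alpha> \<tau> t < profile \<alpha> \<tau> s"
proof (rule DERIV_neg_imp_decreasing_open[OF st(2), where f="profile \<alpha> \<tau>"])
  show "\<exists>y. (profile \<alpha> \<tau> has_real_derivative y) (at x) \<and> y < 0" if "s < x" "x < t" for x
    using DERIV_profile slope_neg[OF \<alpha> \<tau>] that st by force
  show "continuous_on {s..t} (profile \<alpha> \<tau>)"
    using DERIV_profile by (meson DERIV_isCont continuous_at_imp_continuous_on)
qed

lemma profile_pos: "0 \<le> \<alpha> \<Longrightarrow> \<tau> \<in> radii \<alpha> \<Longrightarrow> 0 \<le> t \<Longrightarrow> t < \<tau> \<Longrightarrow> 0 < profile \<alpha> \<tau> t"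
  using profile_strict_decr[of \<alpha> \<tau> t \<tau>] by simp

lemma profile_nonneg: "0 \<le> \<alpha> \<Longrightarrow> \<tau> \<in> radii \<alpha> \<Longrightarrow> 0 \<le> t \<Longrightarrow> t \<le> \<tau> \<Longrightarrow> 0 \<le> profile \<alpha> \<tau> t"
  using profile_pos[of \<alpha> \<tau> t] by (cases "t = \<tau>") auto

text \<open>The slopes differ by a nonpositive multiple of \<open>homog\<close>, so the gap between
  the profiles is smallest at \<open>\<tau>1\<close>, where the smaller droplet vanishes and the
  larger one is still positive.\<close>

lemma profile_less_radius:
  assumes \<alpha>: "0 \<le> \<alpha>" and \<tau>: "\<tau>2 \<in> radii \<alpha>" "0 < \<tau>1" "\<tau>1 < \<tau>2" and t: "0 \<le> t" "t \<le> \<tau>1"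
  shows "profile \<alpha> \<tau>1 t < profile \<alpha> \<tau>2 t"
proof -
  define d where "d t = profile \<alpha> \<tau>2 t - profile \<alpha> \<tau>1 t" for t
  have \<tau>1: "\<tau>1 \<in> radii \<alpha>" using radii_le[OF \<tau>(1) \<alpha>] \<tau> by simp
  have "d \<tau>1 \<le> d t"
  proof (rule DERIV_nonpos_imp_nonincreasing[OF t(2), where f=d])
    fix x assume x: "t \<le> x" "x \<le> \<tau>1"
    have "(d has_real_derivative slope \<alpha> \<tau>2 x - slope \<alpha> \<tau>1 x) (at x)"
      unfolding d_def[abs_def] by (intro DERIV_diff DERIV_profile)
    moreover have "slope \<alpha> \<tau>2 x - slope \<alpha> \<tau>1 x = (ratio \<alpha> \<tau>1 - ratio \<alpha> \<tau>2) * homog \<alpha> x"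
      by (simp add: slope_def algebra_simps)
    moreover have "\<dots> \<le> 0"
      using ratio_less[OF \<alpha> \<tau>(2,3,1)] homog_nonneg[OF \<tau>1 \<alpha>, of x] x t by (simp add: mult_nonpos_nonneg)
    ultimately show "\<exists>y. (d has_real_derivative y) (at x) \<and> y \<le> 0" by metis
  qed
  moreover have "0 < d \<tau>1" using profile_pos[OF \<alpha> \<tau>(1), of \<tau>1] \<tau> by (simp add: d_def)
  ultimately show ?thesis by (simp add: d_def)
qed

text \<open>The multiplier in \<open>u'' + \<alpha>^2 * u + cos = - \<mu>\<close>, read off at the
  contact angle, where the profile vanishes.\<close>

definition lagrange :: "real \<Rightarrow> real \<Rightarrow> real" where
  "lagrange \<alpha> \<tau> = - (dpartic \<alpha> \<tau> - ratio \<alpha> \<tau> * cos (\<alpha> * \<tau>)) - cos \<tau>"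

text \<open>The equation for the slope, integrated once: \<open>ipartic\<close> satisfies it with
  right side zero and \<open>ihomog\<close> up to a constant, so the total is the constant found at
  the contact angle.\<close>

lemma profile_ode:
  assumes "0 \<le> \<alpha>"
  shows "dpartic \<alpha> t - ratio \<alpha> \<tau> * cos (\<alpha> * t) + \<alpha>\<^sup>2 * profile \<alpha> \<tau> t + cos t = - lagrange \<alpha> \<tau>"
proof -
  have 1: "dpartic \<alpha> t + \<alpha>\<^sup>2 * ipartic \<alpha> t + cos t = 0" for t
  proof (cases "\<alpha> = 1")
    case False
    define X where "X = cos t / (1 - \<alpha>\<^sup>2)"
    have "cos t = (1 - \<alpha>\<^sup>2) * X" using one_minus_sq_nonzero[OF assms False] by (simp add: X_def)
    moreover have "dpartic \<alpha> t = - X" "ipartic \<alpha> t = X" using False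
        by (simp_all add: dpartic_def ipartic_def X_def)
    ultimately show ?thesis by (simp add: algebra_simps)
  qed (simp add: dpartic_def ipartic_def field_simps)
  have 2: "cos (\<alpha> * t) - \<alpha>\<^sup>2 * ihomog \<alpha> t = 1" for t by (simp add: ihomog_def)
  have "\<alpha>\<^sup>2 * ipartic \<alpha> t = - dpartic \<alpha> t - cos t" "\<alpha>\<^sup>2 * ihomog \<alpha> t = cos (\<alpha> * t) - 1" for t
    using 1[of t] 2[of t] by simp_all
  then have "\<alpha>\<^sup>2 * profile \<alpha> \<tau> t = - dpartic \<alpha> t - cos t + dpartic \<alpha> \<tau> + cos \<tau> + ratio \<alpha> \<tau> * (cos (\<alpha> * t)
      - cos (\<alpha> * \<tau>))"
    by (simp add: profile_def distrib_left right_diff_distrib mult.left_commute[of "\<alpha>\<^sup>2"])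
  then show ?thesis by (simp add: lagrange_def algebra_simps)
qed

text \<open>At the contact angle the left side is minus the one-sided second derivative of the
  profile, which is the Wronskian divided by \<open>homog\<close> and hence positive. Beyond it the
  cosine only decreases.\<close>

lemma lagrange_less:
  assumes \<alpha>: "0 \<le> \<alpha>" and \<tau>: "\<tau> \<in> radii \<alpha>" and x: "\<tau> \<le> x" "x \<le> pi"
  shows "cos x + lagrange \<alpha> \<tau> < 0"
proof -
  have "cos x \<le> cos \<tau>" using x \<tau> by (intro cos_monotone_0_pi_le) (auto simp: radii_def)
  moreover have "dpartic \<alpha> \<tau> - ratio \<alpha> \<tau> * cos (\<alpha> * \<tau>) = (dpartic \<alpha> \<tau> * homog \<alpha> \<tau>
      - partic \<alpha> \<tau> * cos (\<alpha> * \<tau>)) / homog \<alpha> \<tau>"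
    using homog_radii_pos[OF \<tau> \<alpha>] by (simp add: ratio_def field_simps)
  moreover have "\<dots> > 0" using homog_radii_pos[OF \<tau> \<alpha>] wronskian_pos[OF \<alpha> \<tau>] by simp
  ultimately show ?thesis by (simp add: lagrange_def)
qed

lemma ratio_at_pi:
  assumes "0 \<le> \<alpha>" "\<alpha> < 1"
  shows "ratio \<alpha> pi = 0" "profile \<alpha> pi t = (1 + cos t) / (1 - \<alpha>\<^sup>2)" "slope \<alpha> pi t = - sin t / (1 - \<alpha>\<^sup>2)"
proof -
  show 1: "ratio \<alpha> pi = 0" using assms by (simp add: ratio_def partic_def)
  show "profile \<alpha> pi t = (1 + cos t) / (1 - \<alpha>\<^sup>2)" using assms
      by (simp add: profile_def 1 ipartic_def add_divide_distrib)
  show "slope \<alpha> pi t = - sin t / (1 - \<alpha>\<^sup>2)" using assms by (simp add: slope_def 1 partic_def)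
qed

lemma pi_in_radii: "0 \<le> \<alpha> \<Longrightarrow> pi \<in> radii \<alpha> \<longleftrightarrow> \<alpha> < 1"
  by (auto simp: radii_def)

text \<open>As \<open>\<tau>\<close> approaches \<open>pi / \<alpha>\<close>, \<open>homog\<close>
  tends to zero from above while \<open>partic\<close> keeps a positive limit. This is why
  arbitrarily large masses fit into a droplet when \<open>\<alpha> \<ge> 1\<close>.\<close>

lemma ratio_unbounded:
  assumes \<alpha>: "1 \<le> \<alpha>" and \<tau>0: "\<tau>0 < pi / \<alpha>"
  shows "\<exists>\<tau>\<in>radii \<alpha>. \<tau>0 < \<tau> \<and> R < ratio \<alpha> \<tau>"
proof -
  let ?b = "pi / \<alpha>"
  let ?l = "max 0 \<tau>0"
  have b: "0 < ?b" "?b \<le> pi" "\<alpha> * ?b = pi" using \<alpha> by (auto simp: field_simps)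
  have partic_b: "0 < partic \<alpha> ?b"
  proof (cases "\<alpha> = 1")
    case False
    then have "\<alpha> > 1" using \<alpha> by simp
    then have "1 < \<alpha>\<^sup>2" by (simp add: one_less_power)
    moreover have "0 < sin ?b" using b \<open>\<alpha> > 1\<close> by (intro sin_gt_zero) (auto simp: field_simps)
    ultimately show ?thesis using False by (simp add: partic_def divide_pos_neg)
  qed (simp add: partic_def)
  have near: "\<forall>\<^sub>F t in at_left ?b. t \<in> {?l<..<?b}" using \<tau>0 b by (intro eventually_at_left_real) auto
  have "filterlim (\<lambda>t. partic \<alpha> t / homog \<alpha> t) at_top (at_left ?b)"
  proof (rule LIM_at_top_divide)
    show "(partic \<alpha> \<longlongrightarrow> partic \<alpha> ?b) (at_left ?b)"
      using isCont_partic[of ?b \<alpha>] unfolding isCont_def by (rule filterlim_mono) (auto simp: at_le)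
    have "(homog \<alpha> \<longlongrightarrow> homog \<alpha> ?b) (at_left ?b)"
      using isCont_homog[of ?b \<alpha>] unfolding isCont_def by (rule filterlim_mono) (auto simp: at_le)
    then show "(homog \<alpha> \<longlongrightarrow> 0) (at_left ?b)" using b \<alpha> by (simp add: homog_def)
    show "\<forall>\<^sub>F t in at_left ?b. 0 < homog \<alpha> t"
      using near by eventually_elim (use \<alpha> in \<open>auto intro!: homog_pos simp: field_simps\<close>)
  qed (rule partic_b)
  then have "\<forall>\<^sub>F t in at_left ?b. R < ratio \<alpha> t" by (simp add: filterlim_at_top_dense ratio_def)
  with near have "\<forall>\<^sub>F t in at_left ?b. t \<in> {?l<..<?b} \<and> R < ratio \<alpha> t" by (rule eventually_conj)
  then obtain t where t: "0 < t" "\<tau>0 < t" "t < ?b" "R < ratio \<alpha> t"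
    using eventually_happens'[of "at_left ?b"] by auto
  have "t \<le> pi" using t(3) b(2) by linarith
  moreover have "\<alpha> * t < pi" using t(3) \<alpha> by (simp add: field_simps)
  ultimately show ?thesis using t by (auto simp: radii_def)
qed

section \<open>Comparison with droplets\<close>

text \<open>\<open>arccos (cos x)\<close> is the distance from \<open>x\<close> to the nearest
  multiple of \<open>2 * pi\<close>, which builds in evenness and periodicity; the minimum with
  \<open>\<tau>\<close> freezes the profile at zero. The constant \<open>c\<close> lifts the full
  droplet to a strictly positive minimizer.\<close>

definition drop_fun :: "real \<Rightarrow> real \<Rightarrow> real \<Rightarrow> real \<Rightarrow> real" where
  "drop_fun \<alpha> \<tau> c x = c + profile \<alpha> \<tau> (min \<tau> (arccos (cos x)))"

text \<open>The sign of the sine restores oddness, since the distance forgets on which side of the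
  origin a point lies.\<close>

definition drop_deriv :: "real \<Rightarrow> real \<Rightarrow> real \<Rightarrow> real" where
  "drop_deriv \<alpha> \<tau> x = sgn (sin x) * slope \<alpha> \<tau> (min \<tau> (arccos (cos x)))"

lemma arccos_cos_abs: "\<bar>x\<bar> \<le> pi \<Longrightarrow> arccos (cos x) = \<bar>x\<bar>"
  using arccos_cos[of "\<bar>x\<bar>"] by simp

lemma arccos_cos_bounds: "0 \<le> arccos (cos x)" "arccos (cos x) \<le> pi"
  by (auto intro: arccos_lbound arccos_ubound)

lemma continuous_on_arccos_cos: "continuous_on A (\<lambda>x. arccos (cos x))"
  by (intro continuous_on_arccos continuous_intros) auto

lemma drop_fun_periodic: "periodic (drop_fun \<alpha> \<tau> c)" "periodic (drop_deriv \<alpha> \<tau>)"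
  by (simp_all add: periodic_def drop_fun_def drop_deriv_def)

lemma drop_fun_even: "drop_fun \<alpha> \<tau> c (- x) = drop_fun \<alpha> \<tau> c x"
  by (simp add: drop_fun_def)

text \<open>Within one period this clamp replaces the distance function and needs no case
  distinction on signs in the calculus.\<close>

definition truncate_at :: "real \<Rightarrow> real \<Rightarrow> real" where
  "truncate_at \<tau> x = max (- \<tau>) (min \<tau> x)"

lemma drop_fun_truncate_at:
  assumes "\<tau> \<in> radii \<alpha>" "\<bar>x\<bar> \<le> pi"
  shows "drop_fun \<alpha> \<tau> c x = c + profile \<alpha> \<tau> (truncate_at \<tau> x)"
proof -
  have "\<bar>truncate_at \<tau> x\<bar> = min \<tau> \<bar>x\<bar>" using assms by (auto simp: truncate_at_def radii_def)
  then show ?thesis using assms by (metis arccos_cos_abs drop_fun_def profile_abs)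
qed

lemma drop_deriv_truncate_at:
  assumes \<alpha>: "0 \<le> \<alpha>" and \<tau>: "\<tau> \<in> radii \<alpha>" and x: "\<bar>x\<bar> \<le> pi"
  shows "drop_deriv \<alpha> \<tau> x = slope \<alpha> \<tau> (truncate_at \<tau> x)"
proof -
  have \<tau>0: "0 < \<tau>" "\<tau> \<le> pi" using \<tau> by (auto simp: radii_def)
  consider "x = 0" | "\<bar>x\<bar> = pi" | "0 < x" "x < pi" | "-pi < x" "x < 0" using x by linarith
  then show ?thesis
  proof cases
    case 2
    then have "truncate_at \<tau> x = \<tau> \<or> truncate_at \<tau> x = - \<tau>" using \<tau>0
        by (auto simp: truncate_at_def abs_if split: if_splits)
    then have "slope \<alpha> \<tau> (truncate_at \<tau> x) = 0" using slope_end[OF \<alpha> \<tau>] slope_odd[of \<alpha> \<tau> \<tau>] by auto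
    moreover have "sin \<bar>x\<bar> = 0" using 2 by simp
    then have "sin x = 0" by (simp add: abs_if split: if_splits)
    ultimately show ?thesis by (simp add: drop_deriv_def)
  next
    case 3
    then show ?thesis using sin_gt_zero[of x] \<tau>0 x by (auto simp: drop_deriv_def truncate_at_def arccos_cos_abs)
  next
    case 4
    then have "sin x < 0" using sin_gt_zero[of "- x"] by simp
    moreover have "truncate_at \<tau> x = - min \<tau> (- x)" using 4 \<tau>0 by (auto simp: truncate_at_def)
    ultimately show ?thesis using 4 x by (simp add: drop_deriv_def arccos_cos_abs slope_odd)
  qed (use \<tau>0 in \<open>simp add: drop_deriv_def truncate_at_def\<close>)
qed

lemma continuous_on_slope: "continuous_on A (slope \<alpha> \<tau>)"
  using DERIV_slope by (meson DERIV_isCont continuous_at_imp_continuous_on)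

lemma continuous_on_profile: "continuous_on A (profile \<alpha> \<tau>)"
  using DERIV_profile by (meson DERIV_isCont continuous_at_imp_continuous_on)

lemma continuous_on_truncate_at: "continuous_on A (truncate_at \<tau>)"
  unfolding truncate_at_def by (intro continuous_intros)

lemma drop_deriv_continuous:
  assumes \<alpha>: "0 \<le> \<alpha>" and \<tau>: "\<tau> \<in> radii \<alpha>"
  shows "continuous_on UNIV (drop_deriv \<alpha> \<tau>)"
proof (rule periodic_continuous_on_UNIV[OF drop_fun_periodic(2)])
  have "continuous_on {-pi..pi} (\<lambda>x. slope \<alpha> \<tau> (truncate_at \<tau> x))"
    by (rule continuous_on_compose2[OF continuous_on_slope continuous_on_truncate_at]) auto
  then show "continuous_on {-pi..pi} (drop_deriv \<alpha> \<tau>)"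
    by (rule continuous_on_eq) (simp add: drop_deriv_truncate_at[OF \<alpha> \<tau>] abs_le_iff)
qed

lemma drop_fun_H1d:
  assumes \<alpha>: "0 \<le> \<alpha>" and \<tau>: "\<tau> \<in> radii \<alpha>"
  shows "H1d (drop_fun \<alpha> \<tau> c) (drop_deriv \<alpha> \<tau>)"
  unfolding H1d_def
proof (intro conjI drop_fun_periodic AC2_I_diff)
  note c = drop_deriv_continuous[OF \<alpha> \<tau>]
  show "drop_deriv \<alpha> \<tau> \<in> borel_measurable borel" using c by (rule borel_measurable_continuous_onI)
  show "sqint (-pi) pi (drop_deriv \<alpha> \<tau>)" using c by (intro sqint_continuous_on) (auto intro: continuous_on_subset)
  fix x assume x: "-pi \<le> x" "x \<le> pi"
  have \<tau>0: "0 < \<tau>" "\<tau> \<le> pi" using \<tau> by (auto simp: radii_def)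
  define F where "F t = profile \<alpha> \<tau> (truncate_at \<tau> t)" for t
  have "((\<lambda>t. slope \<alpha> \<tau> (truncate_at \<tau> t)) has_integral F x - F (-pi)) {-pi..x}"
  \<comment> \<open>The two contact points are left out as exceptional; the slope is zero there from
    both sides, so the density stays continuous.\<close>
  proof (rule fundamental_theorem_of_calculus_strong[of "{-\<tau>,\<tau>}"])
    fix t assume "t \<in> {-pi..x} - {-\<tau>,\<tau>}"
    then consider "-\<tau> < t" "t < \<tau>" | "t < - \<tau>" | "\<tau> < t" by fastforce
    then have "(F has_real_derivative slope \<alpha> \<tau> (truncate_at \<tau> t)) (at t)"
    proof cases
      case 1
      have "(F has_real_derivative slope \<alpha> \<tau> t) (at t)"
        by (rule has_field_derivative_transform_within_open[OF DERIV_profile, where S="{-\<tau><..<\<tau>}"])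
           (use 1 in \<open>auto simp: F_def truncate_at_def\<close>)
      moreover have "truncate_at \<tau> t = t" using 1 by (simp add: truncate_at_def)
      ultimately show ?thesis by simp
    next
      case 2
      have "(F has_real_derivative 0) (at t)"
        by (rule has_field_derivative_transform_within_open[OF DERIV_const[of "F (-\<tau>)"], where S="{..<-\<tau>}"])
           (use 2 \<tau>0 in \<open>auto simp: F_def truncate_at_def\<close>)
      moreover have "truncate_at \<tau> t = - \<tau>" using 2 \<tau>0 by (simp add: truncate_at_def)
      ultimately show ?thesis using slope_end[OF \<alpha> \<tau>] by (simp add: slope_odd)
    next
      case 3
      have "(F has_real_derivative 0) (at t)"
        by (rule has_field_derivative_transform_within_open[OF DERIV_const[of "F \<tau>"], where S="{\<tau><..}"])
           (use 3 \<tau>0 in \<open>auto simp: F_def truncate_at_def\<close>)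
      moreover have "truncate_at \<tau> t = \<tau>" using 3 \<tau>0 by (simp add: truncate_at_def)
      ultimately show ?thesis using slope_end[OF \<alpha> \<tau>] by simp
    qed
    then show "(F has_vector_derivative slope \<alpha> \<tau> (truncate_at \<tau> t)) (at t)"
      by (simp add: has_real_derivative_iff_has_vector_derivative)
  next
    show "continuous_on {-pi..x} F" unfolding F_def
      by (rule continuous_on_compose2[OF continuous_on_profile continuous_on_truncate_at]) auto
  qed (use x in auto)
  then have "integral {-pi..x} (\<lambda>t. slope \<alpha> \<tau> (truncate_at \<tau> t)) = F x - F (-pi)" by (rule integral_unique)
  moreover have "integral {-pi..x} (drop_deriv \<alpha> \<tau>) = integral {-pi..x} (\<lambda>t. slope \<alpha> \<tau> (truncate_at \<tau> t))"
    by (rule integral_cong) (use x in \<open>auto simp: drop_deriv_truncate_at[OF \<alpha> \<tau>] abs_le_iff\<close>)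
  ultimately show "drop_fun \<alpha> \<tau> c x - drop_fun \<alpha> \<tau> c (- pi) = integral {-pi..x} (drop_deriv \<alpha> \<tau>)"
    using x by (simp add: drop_fun_truncate_at[OF \<tau>] F_def abs_le_iff)
qed

text \<open>A continuous density has a periodic primitive that is differentiable everywhere, and
  \<open>u\<close> differs from it by a constant.\<close>

lemma H1d_DERIV:
  assumes u: "H1d u P" and c: "continuous_on UNIV P"
  shows "(u has_real_derivative P x) (at x)"
proof -
  have p: "periodic u" "periodic P" using u by (auto simp: H1d_def)
  have "u pi = u (-pi)" using p(1)[unfolded periodic_def, rule_format, of "-pi"] by simp
  then have "integral {-pi..pi} P = 0" using AC2_diff[OF H1d_AC2[OF u], of "-pi" pi] by simp
  then obtain V where V: "periodic V" "\<And>x. (V has_real_derivative P x) (at x)"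
    using periodic_antiderivative[OF p(2) c] by blast
  have V_AC: "AC2 (-pi) pi V P"
    using C1_per_AC2[OF C1_per_I(1)[OF V c]] C1_per_I(2)[OF V c] by simp
  define e where "e = u (-pi) - V (-pi)"
  have "u x = V x + e" if "x \<in> {-pi..pi}" for x
    using AC2_diff[OF H1d_AC2[OF u], of "-pi" x] AC2_diff[OF V_AC, of "-pi" x] that by (simp add: e_def)
  then have "u (wrap x) = V (wrap x) + e" for x using wrap_bounds[of x] by simp
  then have "u = (\<lambda>x. V x + e)" using wrap_of_periodic[OF p(1)] wrap_of_periodic[OF V(1)] by (simp add: fun_eq_iff)
  then show ?thesis using V(2) by (auto intro!: derivative_eq_intros)
qed

lemma drop_fun_off: "\<tau> \<in> radii \<alpha> \<Longrightarrow> \<tau> \<le> \<bar>x\<bar> \<Longrightarrow> \<bar>x\<bar> \<le> pi \<Longrightarrow> drop_fun \<alpha> \<tau> c x = c"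
  by (simp add: drop_fun_def arccos_cos_abs)

lemma drop_fun_on: "\<bar>x\<bar> \<le> \<tau> \<Longrightarrow> \<tau> \<le> pi \<Longrightarrow> drop_fun \<alpha> \<tau> c x = c + profile \<alpha> \<tau> x"
  by (simp add: drop_fun_def arccos_cos_abs profile_abs)

lemma drop_fun_ge: 
  assumes "0 \<le> \<alpha>" "\<tau> \<in> radii \<alpha>" shows "c \<le> drop_fun \<alpha> \<tau> c x"
  using profile_nonneg[OF assms, of "min \<tau> (arccos (cos x))"] arccos_cos_bounds[of x] assms
  by (auto simp: drop_fun_def radii_def)

lemma integral_split3:
  fixes f :: "real \<Rightarrow> real"
  assumes "f integrable_on {-pi..pi}" "0 \<le> t" "t \<le> pi"
  shows "integral {-pi..pi} f = integral {-pi..-t} f + integral {-t..t} f + integral {t..pi} f"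
proof -
  have "f integrable_on {-t..pi}" using assms(1) by (rule integrable_on_subinterval) (use assms in auto)
  then show ?thesis
    using Henstock_Kurzweil_Integration.integral_combine[of "-pi" "-t" pi f]
      Henstock_Kurzweil_Integration.integral_combine[of "-t" t pi f] assms by simp
qed

lemma integral_split3_zero:
  fixes f :: "real \<Rightarrow> real"
  assumes "f integrable_on {-pi..pi}" "0 \<le> t" "t \<le> pi" "\<And>x. t < \<bar>x\<bar> \<Longrightarrow> \<bar>x\<bar> \<le> pi \<Longrightarrow> f x = 0"
  shows "integral {-pi..pi} f = integral {-t..t} f"
proof -
  have "integral {-pi..-t} f = integral {-pi..-t} (\<lambda>_. 0)"
    by (rule integral_spike[of "{-t}"]) (use assms in auto)
  moreover have "integral {t..pi} f = integral {t..pi} (\<lambda>_. 0)"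
    by (rule integral_spike[of "{t}"]) (use assms in auto)
  ultimately show ?thesis using integral_split3[OF assms(1-3)] by simp
qed

text \<open>With the Lagrange multiplier \<open>\<mu>\<close>, the first variation equals \<open>- \<integral> (cos + \<mu>) v\<close> over the set where the
  droplet vanishes, hence is nonnegative; the second variation is controlled by Wirtinger's
  inequality on an interval of length at most \<open>2 \<pi> / \<alpha>\<close>.\<close>

lemma droplet_comparison:
  assumes \<alpha>: "0 \<le> \<alpha>" and \<tau>: "\<tau> \<in> radii \<alpha>" and c: "\<tau> < pi \<Longrightarrow> c = 0"
    and v: "H1d v g" and v_nonneg: "\<And>x. 0 \<le> v x"
    and mass: "integral {-pi..pi} v = integral {-pi..pi} (drop_fun \<alpha> \<tau> c)"
    and supp: "\<And>x. 1 < \<alpha> \<Longrightarrow> pi / \<alpha> \<le> \<bar>x\<bar> \<Longrightarrow> \<bar>x\<bar> \<le> pi \<Longrightarrow> v x = 0"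
  shows "energy \<alpha> (drop_fun \<alpha> \<tau> c) \<le> energy \<alpha> v"
    and "energy \<alpha> v \<le> energy \<alpha> (drop_fun \<alpha> \<tau> c) \<Longrightarrow> v = drop_fun \<alpha> \<tau> c"
proof -
  define u P where "u = drop_fun \<alpha> \<tau> c" and "P = drop_deriv \<alpha> \<tau>"
  define w h where "w x = v x - u x" and "h x = g x - P x" for x
  define \<mu> where "\<mu> = lagrange \<alpha> \<tau>"
  have \<tau>0: "0 < \<tau>" "\<tau> \<le> pi" "\<alpha> * \<tau> < pi" using \<tau> by (auto simp: radii_def)
  have u: "H1d u P" unfolding u_def P_def by (rule drop_fun_H1d[OF \<alpha> \<tau>])
  have w: "H1d w h" unfolding w_def[abs_def] h_def[abs_def] by (rule H1d_diff[OF v u])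
  have uc: "continuous_on A u" and wc: "continuous_on A w" and vc: "continuous_on A v" for A
    using H1d_continuous[OF u] H1d_continuous[OF w] H1d_continuous[OF v] by (auto intro: continuous_on_subset)
  have int: "f integrable_on {a..b}" if "continuous_on UNIV f" for f :: "real \<Rightarrow> real" and a b
    using that by (auto intro: integrable_continuous_real continuous_on_subset)
  have w_mass: "integral {-pi..pi} w = 0"
    unfolding w_def using mass by (subst integral_diff) (auto simp: u_def intro!: int uc[unfolded u_def] vc)
  have w_per: "w pi = w (-pi)"
    using w periodic_def[of w, THEN iffD1, rule_format, of "-pi"] by (simp add: H1d_def)
  have u_off: "u x = 0" if "\<tau> < pi" "\<tau> \<le> \<bar>x\<bar>" "\<bar>x\<bar> \<le> pi" for x
    unfolding u_def using drop_fun_off[OF \<tau> that(2,3)] c[OF that(1)] by simp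
  \<comment> \<open>The Euler-Lagrange expression applied to \<open>w\<close>. Lifting by
    \<open>c\<close> changes the multiplier by \<open>\<alpha>^2 * c\<close>, and since
    \<open>w\<close> has mean zero the constant does not affect its integral over the
    circle.\<close>
  define F where "F x = (\<mu> - \<alpha>\<^sup>2 * c + \<alpha>\<^sup>2 * u x + cos x) * w x" for x
  have Fc: "continuous_on UNIV F" unfolding F_def[abs_def] by (intro continuous_intros uc wc)
  have F_off: "F x = (cos x + \<mu>) * v x" if "\<tau> < pi" "\<tau> \<le> \<bar>x\<bar>" "\<bar>x\<bar> \<le> pi" for x
    using u_off[OF that] c[OF that(1)] by (simp add: F_def w_def)
  define X where "X = integral {-pi..-\<tau>} (\<lambda>x. - F x) + integral {\<tau>..pi} (\<lambda>x. - F x)"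
  have F_neg: "0 \<le> - F x" if "\<tau> < pi" "\<tau> \<le> \<bar>x\<bar>" "\<bar>x\<bar> \<le> pi" for x
    using F_off[OF that] lagrange_less[OF \<alpha> \<tau> that(2,3)] v_nonneg[of x]
    by (simp add: \<mu>_def mult_nonpos_nonneg)
  have outer: "0 \<le> integral {-pi..-\<tau>} (\<lambda>x. - F x)" "0 \<le> integral {\<tau>..pi} (\<lambda>x. - F x)"
  proof -
    have nonneg: "0 \<le> integral {a..b} (\<lambda>x. - F x)" if "\<And>x. x \<in> {a..b} \<Longrightarrow> \<tau> \<le> \<bar>x\<bar> \<and> \<bar>x\<bar> \<le> pi" "\<tau> < pi" for a b
      using F_neg[OF that(2)] that(1) by (intro integral_nonneg int continuous_intros Fc) blast
    show "0 \<le> integral {-pi..-\<tau>} (\<lambda>x. - F x)" "0 \<le> integral {\<tau>..pi} (\<lambda>x. - F x)"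
      using nonneg[of "-pi" "-\<tau>"] nonneg[of \<tau> pi] \<tau>0 by (cases "\<tau> < pi"; auto)+
  qed
  \<comment> \<open>Integration by parts on the droplet only; the boundary terms vanish because the
    slope is zero at the contact angles.\<close>
  have Ph: "integral {-pi..pi} (\<lambda>x. P x * h x) = integral {-\<tau>..\<tau>} F"
  proof -
    have P_on: "P x = slope \<alpha> \<tau> x" if x: "x \<in> {-\<tau>..\<tau>}" for x
    proof -
      have "\<bar>x\<bar> \<le> pi" "truncate_at \<tau> x = x" using x \<tau>0 by (auto simp: truncate_at_def)
      then show ?thesis using drop_deriv_truncate_at[OF \<alpha> \<tau>, of x] by (simp add: P_def)
    qed
    have P_off: "P x = 0" if "\<tau> < \<bar>x\<bar>" "\<bar>x\<bar> \<le> pi" for x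
    proof -
      have "truncate_at \<tau> x = \<tau> \<or> truncate_at \<tau> x = - \<tau>" using that \<tau>0
          by (auto simp: truncate_at_def abs_if split: if_splits)
      then show ?thesis using drop_deriv_truncate_at[OF \<alpha> \<tau> that(2)] slope_end[OF \<alpha> \<tau>] slope_odd[of \<alpha> \<tau> \<tau>]
          by (auto simp: P_def)
    qed
    have slope_AC: "AC2 (-\<tau>) \<tau> (slope \<alpha> \<tau>) (\<lambda>t. dpartic \<alpha> t - ratio \<alpha> \<tau> * cos (\<alpha> * t))"
    proof (rule AC2_C1)
      show "(slope \<alpha> \<tau> has_real_derivative dpartic \<alpha> x - ratio \<alpha> \<tau> * cos (\<alpha> * x)) (at x within {-\<tau>..\<tau>})" for x
        using DERIV_slope by (rule has_field_derivative_at_within)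
      have "continuous_on {-\<tau>..\<tau>} (dpartic \<alpha>)"
        using DERIV_dpartic[OF \<alpha>] by (meson DERIV_isCont continuous_at_imp_continuous_on)
      then show "continuous_on {-\<tau>..\<tau>} (\<lambda>t. dpartic \<alpha> t - ratio \<alpha> \<tau> * cos (\<alpha> * t))" by (intro continuous_intros)
    qed
    have w_AC: "AC2 (-\<tau>) \<tau> w h" using H1d_AC2[OF w] by (rule AC2_subinterval) (use \<tau>0 in auto)
    have sl: "sqint (-\<tau>) \<tau> (slope \<alpha> \<tau>)" by (intro sqint_continuous_on continuous_on_slope)
    have "integral {-pi..pi} (\<lambda>x. P x * h x) = integral {-\<tau>..\<tau>} (\<lambda>x. P x * h x)"
      using \<tau>0 P_off by (intro integral_split3_zero sqint_mult_integrable H1d_sqint[OF u] H1d_sqint[OF w]) auto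
    also have "\<dots> = integral {-\<tau>..\<tau>} (\<lambda>x. slope \<alpha> \<tau> x * h x)"
      by (rule integral_cong) (simp add: P_on)
    also have "\<dots> = integral {-\<tau>..\<tau>} (\<lambda>x. slope \<alpha> \<tau> x * h x + w x * (dpartic \<alpha> x - ratio \<alpha> \<tau> * cos (\<alpha> * x)))
        - integral {-\<tau>..\<tau>} (\<lambda>x. w x * (dpartic \<alpha> x - ratio \<alpha> \<tau> * cos (\<alpha> * x)))"
      by (subst integral_add) (auto intro!: sqint_mult_integrable sl AC2_sqint[OF w_AC] AC2_sqint[OF slope_AC]
          sqint_continuous_on wc)
    also have "integral {-\<tau>..\<tau>} (\<lambda>x. slope \<alpha> \<tau> x * h x + w x * (dpartic \<alpha> x - ratio \<alpha> \<tau> * cos (\<alpha> * x))) = 0"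
      using AC2_product_rule[OF slope_AC w_AC] \<tau>0 slope_end[OF \<alpha> \<tau>] by (simp add: slope_odd)
    also have "0 - integral {-\<tau>..\<tau>} (\<lambda>x. w x * (dpartic \<alpha> x - ratio \<alpha> \<tau> * cos (\<alpha> * x))) = integral {-\<tau>..\<tau>} F"
    proof -
      have "- (w x * (dpartic \<alpha> x - ratio \<alpha> \<tau> * cos (\<alpha> * x))) = F x" if "x \<in> {-\<tau>..\<tau>}" for x
      proof -
        have ux: "u x = c + profile \<alpha> \<tau> x" unfolding u_def using that \<tau>0 by (intro drop_fun_on) auto
        have "dpartic \<alpha> x - ratio \<alpha> \<tau> * cos (\<alpha> * x) = - (\<mu> - \<alpha>\<^sup>2 * c + \<alpha>\<^sup>2 * u x + cos x)"
          using profile_ode[OF \<alpha>, of x \<tau>] unfolding ux \<mu>_def by (simp add: algebra_simps)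
        then show ?thesis unfolding F_def by (metis minus_equation_iff mult.commute mult_minus_right)
      qed
      then have "integral {-\<tau>..\<tau>} (\<lambda>x. - (w x * (dpartic \<alpha> x - ratio \<alpha> \<tau> * cos (\<alpha> * x)))) = integral {-\<tau>..\<tau>} F"
        by (intro integral_cong) auto
      then show ?thesis by simp
    qed
    finally show ?thesis .
  qed
  have lin: "integral {-pi..pi} (\<lambda>x. P x * h x) - \<alpha>\<^sup>2 * integral {-pi..pi} (\<lambda>x. u x * w x)
      - integral {-pi..pi} (\<lambda>x. w x * cos x) = X"
  proof -
    have "(F has_integral ((\<mu> - \<alpha>\<^sup>2 * c) * integral {-pi..pi} w + \<alpha>\<^sup>2 * integral {-pi..pi} (\<lambda>x. u x * w x)
        + integral {-pi..pi} (\<lambda>x. w x * cos x))) {-pi..pi}"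
    proof -
      have "((\<lambda>x. (\<mu> - \<alpha>\<^sup>2 * c) * w x + \<alpha>\<^sup>2 * (u x * w x) + w x * cos x) has_integral ((\<mu>
          - \<alpha>\<^sup>2 * c) * integral {-pi..pi} w + \<alpha>\<^sup>2 * integral {-pi..pi} (\<lambda>x. u x * w x)
          + integral {-pi..pi} (\<lambda>x. w x * cos x))) {-pi..pi}"
        by (intro has_integral_add has_integral_mult_right integrable_integral int continuous_intros uc wc)
      moreover have "(\<lambda>x. (\<mu> - \<alpha>\<^sup>2 * c) * w x + \<alpha>\<^sup>2 * (u x * w x) + w x * cos x) = F"
        by (simp add: F_def fun_eq_iff algebra_simps)
      ultimately show ?thesis by simp
    qed
    then have "integral {-pi..pi} F = \<alpha>\<^sup>2 * integral {-pi..pi} (\<lambda>x. u x * w x)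
        + integral {-pi..pi} (\<lambda>x. w x * cos x)"
      using w_mass by (simp add: integral_unique)
    moreover have "integral {-pi..pi} F = integral {-pi..-\<tau>} F + integral {-\<tau>..\<tau>} F + integral {\<tau>..pi} F"
      using \<tau>0 by (intro integral_split3 int Fc) auto
    ultimately show ?thesis unfolding Ph X_def by simp
  qed
  define Q where "Q = integral {-pi..pi} (\<lambda>x. (h x)\<^sup>2) - \<alpha>\<^sup>2 * integral {-pi..pi} (\<lambda>x. (w x)\<^sup>2)"
  have "(\<lambda>x. u x + w x) = v" by (simp add: w_def)
  then have E: "energy \<alpha> v = energy \<alpha> u + X + 1 / 2 * Q"
    using energy_add[OF u w, of \<alpha>] lin by (simp add: Q_def)
  have X0: "0 \<le> X" using outer by (simp add: X_def)
  \<comment> \<open>Wirtinger is applied on an arc outside of which \<open>w\<close> vanishes;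
    enlarging the domain of the integral of \<open>h^2\<close> back to the circle costs
    nothing.\<close>
  have wirt: "(pi / b)\<^sup>2 * integral {-pi..pi} (\<lambda>x. (w x)\<^sup>2) \<le> integral {-pi..pi} (\<lambda>x. (h x)\<^sup>2)"
    if b: "0 < b" "b \<le> pi" and w0: "\<And>x. b < \<bar>x\<bar> \<Longrightarrow> \<bar>x\<bar> \<le> pi \<Longrightarrow> w x = 0" and wb: "w (-b) = w b" for b
  proof -
    have AC: "AC2 (-b) b w h" using H1d_AC2[OF w] by (rule AC2_subinterval) (use b in auto)
    have "integral {-b..b} w = 0"
      using integral_split3_zero[of w b] w0 b w_mass int[OF wc] by simp
    then have "(pi / b)\<^sup>2 * integral {-b..b} (\<lambda>x. (w x)\<^sup>2) \<le> integral {-b..b} (\<lambda>x. (h x)\<^sup>2)"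
      using wirtinger[OF AC b(1) wb] by simp
    also have "integral {-b..b} (\<lambda>x. (h x)\<^sup>2) \<le> integral {-pi..pi} (\<lambda>x. (h x)\<^sup>2)"
      using b by (intro integral_subset_le sqint_integrable_sq AC2_sqint[OF AC] H1d_sqint[OF w]) auto
    also have "integral {-b..b} (\<lambda>x. (w x)\<^sup>2) = integral {-pi..pi} (\<lambda>x. (w x)\<^sup>2)"
      using w0 b by (intro integral_split3_zero[symmetric] int continuous_intros wc) auto
    finally show ?thesis .
  qed
  have Q0: "0 \<le> Q"
  proof (cases "\<alpha> \<le> 1")
    case True
    then have "\<alpha>\<^sup>2 \<le> 1" using \<alpha> by (simp add: power_le_one)
    then have "\<alpha>\<^sup>2 * integral {-pi..pi} (\<lambda>x. (w x)\<^sup>2) \<le> 1 * integral {-pi..pi} (\<lambda>x. (w x)\<^sup>2)"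
      by (intro mult_right_mono integral_nonneg int continuous_intros wc) auto
    then show ?thesis using wirt[of pi] w_per by (simp add: Q_def)
  next
    case False
    then have a: "1 < \<alpha>" by simp
    \<comment> \<open>On this arc the Wirtinger constant is exactly \<open>\<alpha>^2\<close>; both
      the competitor and the droplet vanish at its ends.\<close>
    let ?b = "pi / \<alpha>"
    have b: "0 < ?b" "?b < pi" "\<tau> < ?b" "pi / ?b = \<alpha>" using a \<tau>0 by (auto simp: field_simps)
    have w0: "w x = 0" if "?b \<le> \<bar>x\<bar>" "\<bar>x\<bar> \<le> pi" for x
      using supp[OF a that] u_off[of x] that b by (simp add: w_def)
    have "\<bar>\<alpha>\<bar> = \<alpha>" using a by simp
    then have "w ?b = 0" "w (- ?b) = 0" using w0[of ?b] w0[of "- ?b"] b by auto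
    then have "\<alpha>\<^sup>2 * integral {-pi..pi} (\<lambda>x. (w x)\<^sup>2) \<le> integral {-pi..pi} (\<lambda>x. (h x)\<^sup>2)"
      using wirt[of ?b] w0 b by simp
    then show ?thesis by (simp add: Q_def)
  qed
  show "energy \<alpha> (drop_fun \<alpha> \<tau> c) \<le> energy \<alpha> v" using E X0 Q0 by (simp add: u_def)
  show "v = drop_fun \<alpha> \<tau> c" if le: "energy \<alpha> v \<le> energy \<alpha> (drop_fun \<alpha> \<tau> c)"
  proof -
    have "X = 0" "Q = 0" using le E X0 Q0 by (simp_all add: u_def)
    \<comment> \<open>Equality makes the first variation vanish, and the strict sign of
      \<open>cos + \<mu>\<close> where the droplet vanishes forces the competitor to vanish there
      too.\<close>
    have w0: "w x = 0" if x: "\<tau> < pi" "\<tau> \<le> \<bar>x\<bar>" "\<bar>x\<bar> \<le> pi" for x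
    proof -
      have z: "integral {-pi..-\<tau>} (\<lambda>x. - F x) = 0" "integral {\<tau>..pi} (\<lambda>x. - F x) = 0"
        using \<open>X = 0\<close> outer by (simp_all add: X_def)
      have "\<forall>x\<in>{-pi..-\<tau>}. - F x = 0"
        using integral_eq_0_iff[of "-pi" "-\<tau>" "\<lambda>x. - F x"] z(1) F_neg x(1) continuous_on_subset[OF Fc] \<tau>0
        by (auto intro!: continuous_intros)
      moreover have "\<forall>x\<in>{\<tau>..pi}. - F x = 0"
        using integral_eq_0_iff[of "\<tau>" "pi" "\<lambda>x. - F x"] z(2) F_neg x(1) continuous_on_subset[OF Fc] \<tau>0
        by (auto intro!: continuous_intros)
      ultimately have "F x = 0" using x by (cases "0 \<le> x") auto
      then have "v x = 0" using F_off[OF x] lagrange_less[OF \<alpha> \<tau> x(2,3)] by (simp add: \<mu>_def)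
      then show ?thesis using u_off[OF x] by (simp add: w_def)
    qed
    \<comment> \<open>Now the difference lives on the arc of half-length \<open>\<tau>\<close>,
      whose constant exceeds \<open>\<alpha>^2\<close> strictly; vanishing of the second variation
      then leaves only \<open>w = 0\<close>.\<close>
    have "(pi / \<tau>)\<^sup>2 * integral {-pi..pi} (\<lambda>x. (w x)\<^sup>2) \<le> integral {-pi..pi} (\<lambda>x. (h x)\<^sup>2)"
    proof (rule wirt[OF \<tau>0(1,2)])
      show "w x = 0" if "\<tau> < \<bar>x\<bar>" "\<bar>x\<bar> \<le> pi" for x using w0[of x] that by simp
      show "w (- \<tau>) = w \<tau>" using w0[of \<tau>] w0[of "-\<tau>"] \<tau>0 w_per by (cases "\<tau> < pi") auto
    qed
    also have "\<dots> = \<alpha>\<^sup>2 * integral {-pi..pi} (\<lambda>x. (w x)\<^sup>2)" using \<open>Q = 0\<close> by (simp add: Q_def)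
    finally have "((pi / \<tau>)\<^sup>2 - \<alpha>\<^sup>2) * integral {-pi..pi} (\<lambda>x. (w x)\<^sup>2) \<le> 0" by (simp add: algebra_simps)
    moreover have "\<alpha>\<^sup>2 < (pi / \<tau>)\<^sup>2" using \<tau>0 \<alpha> by (intro power_strict_mono) (auto simp: field_simps)
    ultimately have "integral {-pi..pi} (\<lambda>x. (w x)\<^sup>2) \<le> 0" by (simp add: mult_le_0_iff)
    moreover have "0 \<le> integral {-pi..pi} (\<lambda>x. (w x)\<^sup>2)"
      by (intro integral_nonneg int continuous_intros wc) auto
    ultimately have "integral {-pi..pi} (\<lambda>x. (w x)\<^sup>2) = 0" by simp
    then have "\<forall>x\<in>{-pi..pi}. (w x)\<^sup>2 = 0"
      using integral_eq_0_iff[of "-pi" pi "\<lambda>x. (w x)\<^sup>2"] wc by (auto intro!: continuous_intros)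
    then have "w (wrap x) = 0" for x using wrap_bounds[of x] by simp
    then have "w x = 0" for x using wrap_of_periodic[of w x] w by (simp add: H1d_def)
    then show ?thesis by (simp add: w_def u_def fun_eq_iff)
  qed
qed

section \<open>Mass and uniqueness\<close>

definition droplet_mass :: "real \<Rightarrow> real \<Rightarrow> real" where
  "droplet_mass \<alpha> \<tau> = integral {-pi..pi} (drop_fun \<alpha> \<tau> 0)"

lemma drop_fun_continuous: "0 \<le> \<alpha> \<Longrightarrow> \<tau> \<in> radii \<alpha> \<Longrightarrow> continuous_on A (drop_fun \<alpha> \<tau> c)"
  using H1d_continuous[OF drop_fun_H1d] by (auto intro: continuous_on_subset)

lemma drop_fun_integrable: "0 \<le> \<alpha> \<Longrightarrow> \<tau> \<in> radii \<alpha> \<Longrightarrow> drop_fun \<alpha> \<tau> c integrable_on {a..b}"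
  by (intro integrable_continuous_real drop_fun_continuous)

lemma drop_fun_add_const: "drop_fun \<alpha> \<tau> c x = c + drop_fun \<alpha> \<tau> 0 x"
  by (simp add: drop_fun_def)

lemma integral_drop_fun:
  assumes "0 \<le> \<alpha>" "\<tau> \<in> radii \<alpha>"
  shows "integral {-pi..pi} (drop_fun \<alpha> \<tau> c) = 2 * pi * c + droplet_mass \<alpha> \<tau>"
proof -
  have "integral {-pi..pi} (drop_fun \<alpha> \<tau> c) = integral {-pi..pi} (\<lambda>x. c + drop_fun \<alpha> \<tau> 0 x)"
    using drop_fun_add_const by (intro integral_cong) metis
  also have "\<dots> = integral {-pi..pi} (\<lambda>x. c) + integral {-pi..pi} (drop_fun \<alpha> \<tau> 0)"
    by (intro integral_add drop_fun_integrable assms) auto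
  finally show ?thesis by (simp add: droplet_mass_def content_real)
qed

text \<open>Where the smaller droplet is positive the profiles are ordered; elsewhere it is zero and
  the larger one nonnegative.\<close>

lemma drop_fun_less_radius:
  assumes \<alpha>: "0 \<le> \<alpha>" and \<tau>: "\<tau>2 \<in> radii \<alpha>" "0 < \<tau>1" "\<tau>1 < \<tau>2"
  shows "drop_fun \<alpha> \<tau>1 0 x \<le> drop_fun \<alpha> \<tau>2 0 x"
    and "arccos (cos x) \<le> \<tau>1 \<Longrightarrow> drop_fun \<alpha> \<tau>1 0 x < drop_fun \<alpha> \<tau>2 0 x"
proof -
  show less: "drop_fun \<alpha> \<tau>1 0 x < drop_fun \<alpha> \<tau>2 0 x" if "arccos (cos x) \<le> \<tau>1"
  proof -
    have "min \<tau>1 (arccos (cos x)) = arccos (cos x)" "min \<tau>2 (arccos (cos x)) = arccos (cos x)"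
      using that \<tau> by auto
    then show ?thesis
      using profile_less_radius[OF \<alpha> \<tau> arccos_cos_bounds(1) that] by (simp add: drop_fun_def)
  qed
  show "drop_fun \<alpha> \<tau>1 0 x \<le> drop_fun \<alpha> \<tau>2 0 x"
    using less drop_fun_ge[OF \<alpha> \<tau>(1), of 0 x] by (cases "arccos (cos x) \<le> \<tau>1") (auto simp: drop_fun_def min_def)
qed

lemma mass_less:
  assumes \<alpha>: "0 \<le> \<alpha>" and \<tau>: "\<tau>2 \<in> radii \<alpha>" "0 < \<tau>1" "\<tau>1 < \<tau>2"
  shows "droplet_mass \<alpha> \<tau>1 < droplet_mass \<alpha> \<tau>2"
proof -
  have \<tau>1: "\<tau>1 \<in> radii \<alpha>" using radii_le[OF \<tau>(1) \<alpha>] \<tau> by simp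
  define d where "d x = drop_fun \<alpha> \<tau>2 0 x - drop_fun \<alpha> \<tau>1 0 x" for x
  have c: "continuous_on {-pi..pi} d" unfolding d_def by (intro continuous_intros drop_fun_continuous \<alpha> \<tau> \<tau>1)
  have "0 \<le> d x" for x using drop_fun_less_radius(1)[OF \<alpha> \<tau>] by (simp add: d_def)
  moreover have "0 < d 0" using drop_fun_less_radius(2)[OF \<alpha> \<tau>, of 0] \<tau> by (simp add: d_def)
  ultimately have "integral {-pi..pi} d \<noteq> 0" "0 \<le> integral {-pi..pi} d"
    using integral_eq_0_iff[OF c] c by (force, intro integral_nonneg integrable_continuous_real) auto
  moreover have "integral {-pi..pi} d = droplet_mass \<alpha> \<tau>2 - droplet_mass \<alpha> \<tau>1"
    unfolding d_def droplet_mass_def by (intro integral_diff drop_fun_integrable \<alpha> \<tau> \<tau>1)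
  ultimately show ?thesis by simp
qed

text \<open>Away from radius zero \<open>homog\<close> has no zero, so the droplet is jointly
  continuous in radius and angle.\<close>

lemma mass_continuous:
  assumes \<alpha>: "0 \<le> \<alpha>" and ab: "0 < a" "b \<in> radii \<alpha>"
  shows "continuous_on {a..b} (droplet_mass \<alpha>)"
proof -
  have homog0: "homog \<alpha> t \<noteq> 0" if "t \<in> {a..b}" for t
    using homog_radii_pos[OF radii_le[OF ab(2) \<alpha>] \<alpha>, of t] that ab by force
  have "continuous_on ({a..b} \<times> cbox (-pi) pi) (\<lambda>(\<tau>, x). drop_fun \<alpha> \<tau> 0 x)"
    unfolding drop_fun_def profile_def ratio_def split_beta
    by (intro continuous_intros continuous_on_arccos) (use homog0 in auto)
  from integral_continuous_on_param[OF this] show ?thesis by (simp add: droplet_mass_def[abs_def])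
qed

lemma radii_nonempty:
  assumes "0 \<le> \<alpha>"
  shows "pi / (2 * max 1 \<alpha>) \<in> radii \<alpha>"
  using assms by (auto simp: radii_def field_simps max_def)

lemma ihomog_less:
  assumes \<alpha>: "0 \<le> \<alpha>" and t: "0 \<le> s" "s < t" "t \<in> radii \<alpha>"
  shows "ihomog \<alpha> t < ihomog \<alpha> s"
proof (rule DERIV_neg_imp_decreasing_open[OF t(2), where f="ihomog \<alpha>"])
  show "\<exists>y. (ihomog \<alpha> has_real_derivative y) (at x) \<and> y < 0" if "s < x" "x < t" for x
    using DERIV_ihomog[of \<alpha> x] homog_radii_pos[OF radii_le[OF t(3) \<alpha>] \<alpha>, of x] that t by force
qed (intro continuous_intros)

text \<open>The peak of the profile is bounded by \<open>G\<close>, in which the coefficient is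
  replaced by its size at a fixed radius \<open>t0\<close>; this is legitimate as
  \<open>ratio\<close> increases. Then \<open>G\<close> tends to zero with the radius.\<close>

lemma mass_small:
  assumes \<alpha>: "0 \<le> \<alpha>" and M: "0 < M"
  shows "\<exists>\<tau>\<in>radii \<alpha>. droplet_mass \<alpha> \<tau> < M"
proof -
  obtain t0 where t0: "t0 \<in> radii \<alpha>" using radii_nonempty[OF \<alpha>] by blast
  define G where "G t = ipartic \<alpha> 0 - ipartic \<alpha> t + \<bar>ratio \<alpha> t0\<bar> * (ihomog \<alpha> 0 - ihomog \<alpha> t)" for t
  have "isCont G 0" unfolding G_def by (intro continuous_intros isCont_ipartic isCont_ihomog)
  then have "(G \<longlongrightarrow> 0) (at_right 0)" by (auto simp: isCont_def G_def intro: filterlim_at_split[THEN iffD1, THEN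
      conjunct2])
  then have "\<forall>\<^sub>F t in at_right 0. G t < M / (2 * pi)" using M by (intro order_tendstoD(2)[of G 0]) auto
  moreover have "\<forall>\<^sub>F t in at_right 0. t \<in> {0<..<t0}" using t0
      by (intro eventually_at_right_real) (auto simp: radii_def)
  ultimately have "\<forall>\<^sub>F t in at_right 0. G t < M / (2 * pi) \<and> t \<in> {0<..<t0}" by (rule eventually_conj)
  then obtain \<tau> where \<tau>: "G \<tau> < M / (2 * pi)" "0 < \<tau>" "\<tau> < t0"
    using eventually_happens'[of "at_right (0::real)"] by auto
  have \<tau>r: "\<tau> \<in> radii \<alpha>" using radii_le[OF t0 \<alpha>] \<tau> by simp
  have "profile \<alpha> \<tau> 0 \<le> G \<tau>"
  proof -
    have "ratio \<alpha> \<tau> \<le> \<bar>ratio \<alpha> t0\<bar>" using ratio_less[OF \<alpha> \<tau>(2,3) t0] by simp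
    moreover have "0 \<le> ihomog \<alpha> 0 - ihomog \<alpha> \<tau>" using ihomog_less[OF \<alpha> _ \<tau>(2) \<tau>r] by simp
    ultimately show ?thesis by (simp add: profile_def G_def mult_right_mono)
  qed
  moreover have "drop_fun \<alpha> \<tau> 0 x \<le> profile \<alpha> \<tau> 0" for x
    using profile_strict_decr[OF \<alpha> \<tau>r, of 0 "min \<tau> (arccos (cos x))"] arccos_cos_bounds(1)[of x] \<tau>(2)
    by (cases "arccos (cos x) = 0") (auto simp: drop_fun_def)
  ultimately have "drop_fun \<alpha> \<tau> 0 x \<le> G \<tau>" for x by (meson order_trans)
  then have "droplet_mass \<alpha> \<tau> \<le> integral {-pi..pi} (\<lambda>_. G \<tau>)"
    unfolding droplet_mass_def by (intro integral_le drop_fun_integrable \<alpha> \<tau>r) auto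
  also have "\<dots> = 2 * pi * G \<tau>" by (simp add: content_real)
  also have "\<dots> < M" using \<tau>(1) by (simp add: field_simps)
  finally show ?thesis using \<tau>r by blast
qed

lemma mass_pi:
  assumes "0 \<le> \<alpha>" "\<alpha> < 1"
  shows "droplet_mass \<alpha> pi = 2 * pi / (1 - \<alpha>\<^sup>2)"
proof -
  have "((\<lambda>x. (1 + cos x) / (1 - \<alpha>\<^sup>2)) has_integral (pi + sin pi) / (1 - \<alpha>\<^sup>2) - (- pi + sin (- pi)) / (1
      - \<alpha>\<^sup>2)) {-pi..pi}"
  proof (rule fundamental_theorem_of_calculus)
    fix x assume "x \<in> {-pi..pi}"
    have "((\<lambda>x. (x + sin x) / (1 - \<alpha>\<^sup>2)) has_real_derivative (1 + cos x) / (1 - \<alpha>\<^sup>2)) (at x within {-pi..pi})"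
      by (rule DERIV_cdivide) (auto intro!: derivative_eq_intros)
    then show "((\<lambda>x. (x + sin x) / (1 - \<alpha>\<^sup>2)) has_vector_derivative (1 + cos x) / (1
        - \<alpha>\<^sup>2)) (at x within {-pi..pi})"
      by (simp add: has_real_derivative_iff_has_vector_derivative)
  qed simp
  moreover have "droplet_mass \<alpha> pi = integral {-pi..pi} (\<lambda>x. (1 + cos x) / (1 - \<alpha>\<^sup>2))"
    unfolding droplet_mass_def using arccos_cos_bounds(2) ratio_at_pi(2)[OF assms]
    by (intro integral_cong) (simp add: drop_fun_def min.absorb2)
  ultimately show ?thesis by (simp only: integral_unique) (simp flip: diff_divide_distrib)
qed

text \<open>The drop of the profile between \<open>t0 / 2\<close> and \<open>t0\<close> is affine in
  \<open>ratio\<close> with positive coefficient \<open>B\<close>. It bounds the droplet from below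
  on an interval of length \<open>t0\<close>, and \<open>ratio\<close> is unbounded.\<close>

lemma mass_large:
  assumes \<alpha>: "1 \<le> \<alpha>"
  shows "\<exists>\<tau>\<in>radii \<alpha>. M \<le> droplet_mass \<alpha> \<tau>"
proof -
  have \<alpha>0: "0 \<le> \<alpha>" using \<alpha> by simp
  obtain t0 where t0: "t0 \<in> radii \<alpha>" using radii_nonempty[OF \<alpha>0] by blast
  have t0': "0 < t0" "t0 \<le> pi" using t0 by (auto simp: radii_def)
  define A B where "A = ipartic \<alpha> (t0 / 2) - ipartic \<alpha> t0" and "B = ihomog \<alpha> (t0 / 2) - ihomog \<alpha> t0"
  have B: "0 < B" unfolding B_def using ihomog_less[OF \<alpha>0, of "t0 / 2" t0] t0 t0' by simp
  have "t0 < pi / \<alpha>" using t0 \<alpha> by (simp add: radii_def field_simps)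
  then obtain \<tau> where \<tau>: "\<tau> \<in> radii \<alpha>" "t0 < \<tau>" "(M / t0 - A) / B < ratio \<alpha> \<tau>"
    using ratio_unbounded[OF \<alpha>] by blast
  have "M / t0 - A < ratio \<alpha> \<tau> * B" using \<tau>(3) B by (simp add: pos_divide_less_eq)
  then have M: "M \<le> t0 * (A + ratio \<alpha> \<tau> * B)" using t0'(1) by (simp add: field_simps)
  have low: "A + ratio \<alpha> \<tau> * B \<le> drop_fun \<alpha> \<tau> 0 x" if "\<bar>x\<bar> \<le> t0 / 2" for x
  proof -
    have "A + ratio \<alpha> \<tau> * B = profile \<alpha> \<tau> (t0 / 2) - profile \<alpha> \<tau> t0"
      by (simp add: A_def B_def profile_def algebra_simps)
    also have "\<dots> \<le> profile \<alpha> \<tau> (t0 / 2)" using profile_nonneg[OF \<alpha>0 \<tau>(1), of t0] t0' \<tau> by simp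
    also have "\<dots> \<le> profile \<alpha> \<tau> \<bar>x\<bar>"
      using profile_strict_decr[OF \<alpha>0 \<tau>(1), of "\<bar>x\<bar>" "t0 / 2"] that t0' \<tau> by (cases "\<bar>x\<bar> = t0 / 2") auto
    also have "\<dots> = drop_fun \<alpha> \<tau> 0 x"
      using that t0' \<tau> by (simp add: drop_fun_def arccos_cos_abs)
    finally show ?thesis .
  qed
  have "M \<le> integral {-(t0/2)..t0/2} (\<lambda>_. A + ratio \<alpha> \<tau> * B)" using M t0' by (simp add: content_real)
  also have "\<dots> \<le> integral {-(t0/2)..t0/2} (drop_fun \<alpha> \<tau> 0)"
    using low by (intro integral_le drop_fun_integrable \<alpha>0 \<tau>) (auto simp: abs_le_iff)
  also have "\<dots> \<le> droplet_mass \<alpha> \<tau>"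
    unfolding droplet_mass_def using t0' drop_fun_ge[OF \<alpha>0 \<tau>(1), of 0]
    by (intro integral_subset_le drop_fun_integrable \<alpha>0 \<tau>) auto
  finally show ?thesis using \<tau>(1) by blast
qed

text \<open>Intermediate values between a small droplet and a large one. For
  \<open>\<alpha> < 1\<close> the upper end is the droplet of radius \<open>pi\<close>, whose mass
  is the threshold.\<close>

lemma mass_surj:
  assumes \<alpha>: "0 \<le> \<alpha>" and M: "0 < M" "M * (1 - \<alpha>\<^sup>2) \<le> 2 * pi"
  shows "\<exists>\<tau>\<in>radii \<alpha>. droplet_mass \<alpha> \<tau> = M"
proof -
  obtain a where a: "a \<in> radii \<alpha>" "droplet_mass \<alpha> a < M" using mass_small[OF \<alpha> M(1)] by blast
  obtain b where b: "b \<in> radii \<alpha>" "M \<le> droplet_mass \<alpha> b"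
  proof (cases "\<alpha> < 1")
    case True
    then have "0 < 1 - \<alpha>\<^sup>2" using \<alpha> by (simp add: power_less_one_iff abs_square_less_1)
    then have "M \<le> droplet_mass \<alpha> pi" using M(2) mass_pi[OF \<alpha> True] by (simp add: pos_le_divide_eq)
    then show ?thesis using that True pi_in_radii[OF \<alpha>] by blast
  next
    case False
    then show ?thesis using that mass_large[of \<alpha> M] by auto
  qed
  have a0: "0 < a" "0 < b" using a b by (auto simp: radii_def)
  have "a < b"
  proof (rule ccontr)
    assume "\<not> a < b"
    then have "droplet_mass \<alpha> b \<le> droplet_mass \<alpha> a" using mass_less[OF \<alpha> a(1) a0(2)] by (cases "a = b") auto
    then show False using a b by simp
  qed
  then obtain \<tau> where "a \<le> \<tau>" "\<tau> \<le> b" "droplet_mass \<alpha> \<tau> = M"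
    using IVT'[of "droplet_mass \<alpha>" a M b] mass_continuous[OF \<alpha> a0(1) b(1)] a b by auto
  then show ?thesis using radii_le[OF b(1) \<alpha>, of \<tau>] a0 by auto
qed

text \<open>If a minimizer were positive at \<open>\<plusminus>\<pi>/\<alpha>\<close>, then adding a small multiple of one period of
  \<open>sin (\<alpha> x)\<close>, a direction in which the energy is affine, would produce a minimizer that is not even.\<close>

lemma minimizer_vanishes:
  assumes \<alpha>: "1 < \<alpha>" and min: "minimizer \<alpha> M v" and x: "pi / \<alpha> \<le> \<bar>x\<bar>" "\<bar>x\<bar> \<le> pi"
  shows "v x = 0"
proof -
  define b where "b = pi / \<alpha>"
  have b: "0 < b" "b < pi" "\<alpha> * b = pi" using \<alpha> by (auto simp: b_def field_simps)
  obtain g where v: "H1d v g" and v_nonneg: "\<And>x. 0 \<le> v x" and v_mass: "integral {-pi..pi} v = M"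
    using min by (auto simp: minimizer_iff admissible_iff)
  have even: "v \<bar>x\<bar> = v x" for x using minimizer_symm_decr(1)[OF min, of x] by (simp add: abs_if)
  have "v b = 0"
  proof (rule ccontr)
    \<comment> \<open>The minimizer is at least \<open>\<delta>\<close> on the arc, so perturbations
      of size \<open>\<delta>\<close> there keep it nonnegative.\<close>
    define \<delta> where "\<delta> = v b"
    assume "v b \<noteq> 0"
    then have \<delta>: "0 < \<delta>" using v_nonneg[of b] by (simp add: \<delta>_def)
    have v_ge: "\<delta> \<le> v x" if "x \<in> {-b..b}" for x
      using minimizer_symm_decr(2)[OF min, of "\<bar>x\<bar>" b] that b even[of x] by (auto simp: \<delta>_def)
    define d e where "d = (\<lambda>x. if x \<in> {-b..b} then sin (\<alpha> * x) else 0)"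
      and "e = (\<lambda>x. if x \<in> {-b<..<b} then \<alpha> * cos (\<alpha> * x) else 0)"
    define \<phi> \<psi> where "\<phi> x = d (wrap x)" and "\<psi> x = e (wrap x)" for x
    have AC: "AC2 (-b) b (\<lambda>x. sin (\<alpha> * x)) (\<lambda>x. \<alpha> * cos (\<alpha> * x))"
      by (rule AC2_C1) (auto intro!: derivative_eq_intros continuous_intros)
    have em: "(\<lambda>x. \<alpha> * cos (\<alpha> * x)) \<in> borel_measurable borel" by measurable
    have cut: "H1d \<phi> \<psi>" "\<And>x. x \<in> {-pi..pi} \<Longrightarrow> \<phi> x = d x" "\<And>x. x \<in> {-pi..pi} \<Longrightarrow> \<psi> x = e x"
      unfolding \<phi>_def[abs_def] \<psi>_def[abs_def] d_def e_def using H1d_cutoff[OF AC em] b by simp_all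
    define l where "l = integral {-pi..pi} (\<lambda>x. g x * \<psi> x) - \<alpha>\<^sup>2 * integral {-pi..pi} (\<lambda>x. v x * \<phi> x)
        - integral {-pi..pi} (\<lambda>x. \<phi> x * cos x)"
    \<comment> \<open>The sign is chosen such that the first-order term does not raise the
      energy.\<close>
    define t where "t = (if l \<le> 0 then \<delta> else - \<delta>)"
    have t: "t * l \<le> 0" "\<bar>t\<bar> = \<delta>" using \<delta> by (auto simp: t_def mult_nonneg_nonpos)
    note t\<phi> = H1d_cmult[OF cut(1), of t]
    \<comment> \<open>Over a full period the squares of sine and cosine have the same integral,
      which is why the second variation vanishes.\<close>
    have sq: "integral {-pi..pi} (\<lambda>x. (\<psi> x)\<^sup>2) = \<alpha>\<^sup>2 * integral {-pi..pi} (\<lambda>x. (\<phi> x)\<^sup>2)"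
    proof -
      have "integral {-pi..pi} (\<lambda>x. (\<psi> x)\<^sup>2) = integral {-b..b} (\<lambda>x. (\<psi> x)\<^sup>2)"
        using b cut(3) by (intro integral_split3_zero sqint_integrable_sq H1d_sqint[OF cut(1)]) (auto simp:
            e_def abs_if split: if_splits)
      also have "\<dots> = integral {-b..b} (\<lambda>x. \<alpha>\<^sup>2 * (cos (\<alpha> * x))\<^sup>2)"
        by (rule integral_spike[of "{-b,b}"]) (use b cut(3) in \<open>auto simp: e_def power_mult_distrib\<close>)
      also have "\<dots> = \<alpha>\<^sup>2 * integral {-b..b} (\<lambda>x. (sin (\<alpha> * x))\<^sup>2)"
      proof -
        have I: "((\<lambda>x. (cos (\<alpha> * x))\<^sup>2 - (sin (\<alpha> * x))\<^sup>2) has_integral (sin (\<alpha> * b) * cos (\<alpha> * b) / \<alpha>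
            - sin (\<alpha> * (-b)) * cos (\<alpha> * (-b)) / \<alpha>)) {-b..b}"
        proof (rule fundamental_theorem_of_calculus)
          fix x assume "x \<in> {-b..b}"
          have "((\<lambda>x. sin (\<alpha> * x) * cos (\<alpha> * x) / \<alpha>) has_real_derivative ((cos (\<alpha> * x))\<^sup>2
              - (sin (\<alpha> * x))\<^sup>2)) (at x within {-b..b})"
            using \<alpha> by (auto intro!: derivative_eq_intros simp: power2_eq_square field_simps)
          then show "((\<lambda>x. sin (\<alpha> * x) * cos (\<alpha> * x) / \<alpha>) has_vector_derivative ((cos (\<alpha> * x))\<^sup>2
              - (sin (\<alpha> * x))\<^sup>2)) (at x within {-b..b})"
            by (simp add: has_real_derivative_iff_has_vector_derivative)
        qed (use b in simp)
        have "integral {-b..b} (\<lambda>x. (cos (\<alpha> * x))\<^sup>2) - integral {-b..b} (\<lambda>x. (sin (\<alpha> * x))\<^sup>2)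
            = integral {-b..b} (\<lambda>x. (cos (\<alpha> * x))\<^sup>2 - (sin (\<alpha> * x))\<^sup>2)"
          by (intro integral_diff[symmetric] integrable_continuous_real continuous_intros)
        also have "\<dots> = 0" using integral_unique[OF I] b by simp
        finally show ?thesis by simp
      qed
      also have "integral {-b..b} (\<lambda>x. (sin (\<alpha> * x))\<^sup>2) = integral {-b..b} (\<lambda>x. (\<phi> x)\<^sup>2)"
        by (rule integral_cong) (use b cut(2) in \<open>auto simp: d_def\<close>)
      also have "\<dots> = integral {-pi..pi} (\<lambda>x. (\<phi> x)\<^sup>2)"
        using b cut(2)
        by (intro integral_split3_zero[symmetric] sqint_integrable_sq H1d_sqint_fun[OF cut(1)]) (auto simp:
            d_def abs_if split: if_splits)
      finally show ?thesis .
    qed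
    have "energy \<alpha> (\<lambda>x. v x + t * \<phi> x) = energy \<alpha> v + t * l"
    proof -
      have "integral {-pi..pi} (\<lambda>x. g x * (t * \<psi> x)) = t * integral {-pi..pi} (\<lambda>x. g x * \<psi> x)"
           "integral {-pi..pi} (\<lambda>x. v x * (t * \<phi> x)) = t * integral {-pi..pi} (\<lambda>x. v x * \<phi> x)"
           "integral {-pi..pi} (\<lambda>x. t * \<phi> x * cos x) = t * integral {-pi..pi} (\<lambda>x. \<phi> x * cos x)"
        by (simp_all only: mult.left_commute[of _ t] mult.assoc integral_mult_right)
      then show ?thesis
        unfolding energy_add[OF v t\<phi>] l_def by (simp add: power_mult_distrib sq algebra_simps)
    qed
    moreover have adm: "(\<lambda>x. v x + t * \<phi> x) \<in> admissible M"
      unfolding admissible_iff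
    proof (intro conjI allI exI)
      show "H1d (\<lambda>x. v x + t * \<phi> x) (\<lambda>x. g x + t * \<psi> x)" by (rule H1d_add[OF v t\<phi>])
      show "0 \<le> v x + t * \<phi> x" for x
      proof -
        have "0 \<le> v y + t * d y" for y
        proof (cases "y \<in> {-b..b}")
          case True
          have "\<bar>t * d y\<bar> \<le> \<delta> * 1" unfolding abs_mult t(2) using \<delta> by (intro mult_left_mono) (auto simp: d_def)
          then show ?thesis using v_ge[OF True] by linarith
        next
          case False
          then have "d y = 0" by (auto simp: d_def)
          then show ?thesis by (simp add: v_nonneg)
        qed
        from this[of "wrap x"] show ?thesis using v wrap_of_periodic[of v x] by (simp add: \<phi>_def H1d_def)
      qed
      have "integral {-pi..pi} \<phi> = 0"
        by (rule integral_odd_zero) (use cut(2) in \<open>auto simp: d_def\<close>)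
      then show "integral {-pi..pi} (\<lambda>x. v x + t * \<phi> x) = M"
        using v_mass by (subst integral_add) (auto intro: sqint_integrable H1d_sqint_fun[OF v]
            H1d_sqint_fun[OF t\<phi>])
    qed
    ultimately have "minimizer \<alpha> M (\<lambda>x. v x + t * \<phi> x)"
      using min t(1) unfolding minimizer_iff
          by (metis add_mono_thms_linordered_field(1) add.right_neutral add_left_mono order_trans)
    \<comment> \<open>The angles \<open>b / 2\<close> and \<open>- (b / 2)\<close> are the extremal
      points of the sine, where the oddness of the perturbation is most visible.\<close>
    from minimizer_symm_decr(1)[OF this, of "b / 2"]
    have "v (- (b / 2)) + t * \<phi> (- (b / 2)) = v (b / 2) + t * \<phi> (b / 2)" .
    moreover have "\<phi> (b / 2) = 1" "\<phi> (- (b / 2)) = - 1"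
      using cut(2)[of "b / 2"] cut(2)[of "- (b / 2)"] b by (auto simp: d_def)
    ultimately have "t = 0" using minimizer_symm_decr(1)[OF min, of "b / 2"] by simp
    then show False using t \<delta> by simp
  qed
  then have "v \<bar>x\<bar> \<le> 0" using minimizer_symm_decr(2)[OF min, of b "\<bar>x\<bar>"] x b by (simp add: b_def)
  then show ?thesis using v_nonneg[of x] even[of x] by simp
qed

text \<open>Joins the two regimes: a contact angle with \<open>c = 0\<close>, or radius
  \<open>pi\<close> with the excess mass spread evenly as \<open>c\<close>. They meet at radius
  \<open>pi\<close> with \<open>c = 0\<close>.\<close>

definition is_droplet :: "real \<Rightarrow> real \<Rightarrow> real \<Rightarrow> real \<Rightarrow> bool" where
  "is_droplet \<alpha> M \<tau> c \<longleftrightarrow> \<tau> \<in> radii \<alpha> \<and> 0 \<le> c \<and> (\<tau> < pi \<longrightarrow> c = 0) \<and> 2 * pi * c + droplet_mass \<alpha> \<tau> = M"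

text \<open>The comparison applies to minimizers, and for \<open>\<alpha> > 1\<close> not to all
  competitors. That the droplet itself minimizes is thus concluded indirectly: some minimizer exists
  and must equal it.\<close>

lemma minimizer_iff_droplet:
  assumes \<alpha>: "0 \<le> \<alpha>" and M: "0 < M" and d: "is_droplet \<alpha> M \<tau> c"
  shows "minimizer \<alpha> M v \<longleftrightarrow> v = drop_fun \<alpha> \<tau> c"
proof -
  have \<tau>: "\<tau> \<in> radii \<alpha>" and c: "0 \<le> c" "\<tau> < pi \<Longrightarrow> c = 0" and m: "integral {-pi..pi} (drop_fun \<alpha> \<tau> c) = M"
    using d integral_drop_fun[OF \<alpha>] by (auto simp: is_droplet_def)
  have adm: "drop_fun \<alpha> \<tau> c \<in> admissible M"
    unfolding admissible_iff using drop_fun_H1d[OF \<alpha> \<tau>] drop_fun_ge[OF \<alpha> \<tau>, of c] c m by (meson order_trans)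
  have comp: "energy \<alpha> (drop_fun \<alpha> \<tau> c) \<le> energy \<alpha> v \<and> (energy \<alpha> v \<le> energy \<alpha> (drop_fun \<alpha> \<tau> c) \<longrightarrow> v
      = drop_fun \<alpha> \<tau> c)"
    if v: "v \<in> admissible M" "\<And>x. 1 < \<alpha> \<Longrightarrow> pi / \<alpha> \<le> \<bar>x\<bar> \<Longrightarrow> \<bar>x\<bar> \<le> pi \<Longrightarrow> v x = 0" for v
  proof -
    obtain g where g: "H1d v g" "\<And>x. 0 \<le> v x" "integral {-pi..pi} v = M" using v(1) by (auto simp: admissible_iff)
    show ?thesis using droplet_comparison[OF \<alpha> \<tau> c(2) g(1,2) _ v(2)] g(3) m by simp
  qed
  have to: "v = drop_fun \<alpha> \<tau> c" if "minimizer \<alpha> M v" for v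
    using comp[of v] minimizer_vanishes[OF _ that] that adm by (auto simp: minimizer_iff)
  moreover obtain v0 where "minimizer \<alpha> M v0" using minimizer_exists[OF M] by blast
  ultimately show ?thesis by metis
qed

lemma is_droplet_exists:
  assumes \<alpha>: "0 \<le> \<alpha>" and M: "0 < M"
  shows "M * (1 - \<alpha>\<^sup>2) < 2 * pi \<Longrightarrow> \<exists>\<tau><pi. is_droplet \<alpha> M \<tau> 0"
    and "2 * pi \<le> M * (1 - \<alpha>\<^sup>2) \<Longrightarrow> \<alpha> < 1 \<and> is_droplet \<alpha> M pi (M / (2 * pi) - 1 / (1 - \<alpha>\<^sup>2))"
proof -
  have sq: "0 < 1 - \<alpha>\<^sup>2 \<longleftrightarrow> \<alpha> < 1" using \<alpha> by (simp add: abs_square_less_1)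
  show "\<exists>\<tau><pi. is_droplet \<alpha> M \<tau> 0" if lt: "M * (1 - \<alpha>\<^sup>2) < 2 * pi"
  proof -
    obtain \<tau> where \<tau>: "\<tau> \<in> radii \<alpha>" "droplet_mass \<alpha> \<tau> = M" using mass_surj[OF \<alpha> M] lt by auto
    \<comment> \<open>The droplet of radius \<open>pi\<close> has exactly the threshold
      mass.\<close>
    have "\<tau> \<noteq> pi"
    proof
      assume "\<tau> = pi"
      then have "\<alpha> < 1" using \<tau> pi_in_radii[OF \<alpha>] by simp
      then have "M * (1 - \<alpha>\<^sup>2) = 2 * pi" using \<tau> mass_pi[OF \<alpha>] sq \<open>\<tau> = pi\<close> by (simp add: field_simps)
      then show False using lt by simp
    qed
    then have "\<tau> < pi" using \<tau> by (simp add: radii_def)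
    then show ?thesis using \<tau> by (auto simp: is_droplet_def)
  qed
  show "\<alpha> < 1 \<and> is_droplet \<alpha> M pi (M / (2 * pi) - 1 / (1 - \<alpha>\<^sup>2))" if ge: "2 * pi \<le> M * (1 - \<alpha>\<^sup>2)"
  proof -
    have "0 < M * (1 - \<alpha>\<^sup>2)" using ge pi_gt_zero by linarith
    then have s: "0 < 1 - \<alpha>\<^sup>2" using M by (simp add: zero_less_mult_iff)
    then have a: "\<alpha> < 1" using sq by simp
    have "1 / (1 - \<alpha>\<^sup>2) \<le> M / (2 * pi)" using ge s by (simp add: field_simps)
    moreover have "2 * pi * (M / (2 * pi) - 1 / (1 - \<alpha>\<^sup>2)) + droplet_mass \<alpha> pi = M"
      using mass_pi[OF \<alpha> a] by (simp add: right_diff_distrib)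
    ultimately show ?thesis using a pi_in_radii[OF \<alpha>] by (auto simp: is_droplet_def)
  qed
qed

section \<open>Dependence on the mass\<close>

lemma deriv_drop_fun: "0 \<le> \<alpha> \<Longrightarrow> \<tau> \<in> radii \<alpha> \<Longrightarrow> deriv (drop_fun \<alpha> \<tau> c) = drop_deriv \<alpha> \<tau>"
  by (intro ext DERIV_imp_deriv H1d_DERIV[OF drop_fun_H1d drop_deriv_continuous])

text \<open>The segment between two points is covered by finitely many closed periods, each carrying
  the constant \<open>L\<close>, and Lipschitz bounds add up along a segment.\<close>

lemma periodic_lipschitz:
  assumes p: "periodic P" and L: "L-lipschitz_on {-pi..pi} P"
  shows "L-lipschitz_on UNIV P"
proof (rule lipschitz_onI)
  show L0: "0 \<le> L" using L by (rule lipschitz_on_nonneg)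
  fix x y :: real
  define i where "i z = \<lfloor>(z + pi) / (2 * pi)\<rfloor>" for z
  define U where "U k = {- pi + 2 * pi * of_int k..pi + 2 * pi * of_int k}" for k
  have "L-lipschitz_on {min x y..max x y} P"
  proof (rule lipschitz_on_closed_Union[of "{i (min x y)..i (max x y)}" _ U])
    fix k
    show "L-lipschitz_on (U k) P"
    proof (rule lipschitz_onI[OF _ L0])
      fix s t assume "s \<in> U k" "t \<in> U k"
      then have "s - 2 * pi * of_int k \<in> {-pi..pi}" "t - 2 * pi * of_int k \<in> {-pi..pi}" by (auto simp: U_def)
      from lipschitz_onD[OF L this] show "dist (P s) (P t) \<le> L * dist s t"
        by (simp add: periodic_diff_int[OF p] dist_norm)
    qed
    show "closed (U k)" by (simp add: U_def)
  next
    show "{min x y..max x y} \<subseteq> (\<Union>k\<in>{i (min x y)..i (max x y)}. U k)"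
    proof
      fix z assume z: "z \<in> {min x y..max x y}"
      have "i (min x y) \<le> i z" "i z \<le> i (max x y)"
        unfolding i_def using z by (intro floor_mono divide_right_mono; simp)+
      moreover have "z \<in> U (i z)" using wrap_bounds[of z] by (simp add: U_def i_def wrap_def)
      ultimately show "z \<in> (\<Union>k\<in>{i (min x y)..i (max x y)}. U k)" by auto
    qed
  qed (use L0 in auto)
  then have "dist (P (min x y)) (P (max x y)) \<le> L * dist (min x y) (max x y)"
    by (rule lipschitz_onD) auto
  then show "dist (P x) (P y) \<le> L * dist x y" by (cases "x \<le> y") (auto simp: min_def max_def dist_commute)
qed

lemma homog_lipschitz: "\<bar>homog \<alpha> x - homog \<alpha> y\<bar> \<le> \<bar>x - y\<bar>"
  using field_differentiable_bound[of UNIV "homog \<alpha>" "\<lambda>x. cos (\<alpha> * x)" 1 x y] DERIV_homog by simp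

lemma truncate_at_lipschitz: "\<bar>truncate_at \<tau> x - truncate_at \<tau> y\<bar> \<le> \<bar>x - y\<bar>"
  by (auto simp: truncate_at_def min_def max_def)

lemma truncate_at_diff: "\<bar>truncate_at \<tau> x - truncate_at \<sigma> x\<bar> \<le> \<bar>\<tau> - \<sigma>\<bar>"
  by (auto simp: truncate_at_def min_def max_def)

lemma truncate_at_bound: "\<tau> \<in> radii \<alpha> \<Longrightarrow> \<bar>truncate_at \<tau> x\<bar> \<le> pi"
  by (auto simp: truncate_at_def radii_def min_def max_def)

lemma dpartic_bounded:
  assumes "0 \<le> \<alpha>"
  obtains B where "0 \<le> B" "\<And>t. \<bar>t\<bar> \<le> pi \<Longrightarrow> \<bar>dpartic \<alpha> t\<bar> \<le> B"
proof -
  have "continuous_on {-pi..pi} (dpartic \<alpha>)"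
    using DERIV_dpartic[OF assms] by (meson DERIV_isCont continuous_at_imp_continuous_on)
  then have "bounded (dpartic \<alpha> ` {-pi..pi})" by (intro compact_imp_bounded compact_continuous_image) auto
  then obtain B where B: "\<forall>t\<in>{-pi..pi}. \<bar>dpartic \<alpha> t\<bar> \<le> B" by (auto simp: bounded_iff)
  have "\<bar>dpartic \<alpha> t\<bar> \<le> max 0 B" if "\<bar>t\<bar> \<le> pi" for t
  proof -
    have "t \<in> {-pi..pi}" using that by auto
    then show ?thesis using B by (simp add: le_max_iff_disj)
  qed
  then show ?thesis using that[of "max 0 B"] by simp
qed

lemma slope_lipschitz:
  assumes B: "\<And>t. \<bar>t\<bar> \<le> pi \<Longrightarrow> \<bar>dpartic \<alpha> t\<bar> \<le> B" and xy: "\<bar>x\<bar> \<le> pi" "\<bar>y\<bar> \<le> pi"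
  shows "\<bar>slope \<alpha> \<tau> x - slope \<alpha> \<tau> y\<bar> \<le> (B + \<bar>ratio \<alpha> \<tau>\<bar>) * \<bar>x - y\<bar>"
proof -
  have "\<bar>dpartic \<alpha> t - ratio \<alpha> \<tau> * cos (\<alpha> * t)\<bar> \<le> B + \<bar>ratio \<alpha> \<tau>\<bar>" if "t \<in> {-pi..pi}" for t
  proof -
    have "\<bar>ratio \<alpha> \<tau> * cos (\<alpha> * t)\<bar> \<le> \<bar>ratio \<alpha> \<tau>\<bar> * 1" unfolding abs_mult by (intro mult_left_mono) auto
    then show ?thesis using B[of t] that by (auto simp: abs_le_iff)
  qed
  then show ?thesis
    using field_differentiable_bound[of "{-pi..pi}" "slope \<alpha> \<tau>" "\<lambda>t. dpartic \<alpha> t - ratio \<alpha> \<tau> * cos (\<alpha> * t)"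
      "B + \<bar>ratio \<alpha> \<tau>\<bar>" x y] has_field_derivative_at_within[OF DERIV_slope] xy by (auto simp: abs_le_iff)
qed

lemma drop_deriv_lipschitz:
  assumes \<alpha>: "0 \<le> \<alpha>" and \<tau>: "\<tau> \<in> radii \<alpha>" and B: "0 \<le> B" "\<And>t. \<bar>t\<bar> \<le> pi \<Longrightarrow> \<bar>dpartic \<alpha> t\<bar> \<le> B"
  shows "(B + \<bar>ratio \<alpha> \<tau>\<bar>)-lipschitz_on UNIV (drop_deriv \<alpha> \<tau>)"
proof (rule periodic_lipschitz[OF drop_fun_periodic(2)], rule lipschitz_onI)
  fix x y assume xy: "x \<in> {-pi..pi}" "y \<in> {-pi..pi}"
  have "\<bar>slope \<alpha> \<tau> (truncate_at \<tau> x) - slope \<alpha> \<tau> (truncate_at \<tau> y)\<bar>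
      \<le> (B + \<bar>ratio \<alpha> \<tau>\<bar>) * \<bar>truncate_at \<tau> x - truncate_at \<tau> y\<bar>"
    by (intro slope_lipschitz B(2) truncate_at_bound[OF \<tau>])
  also have "\<dots> \<le> (B + \<bar>ratio \<alpha> \<tau>\<bar>) * \<bar>x - y\<bar>" using B(1) by (intro mult_left_mono truncate_at_lipschitz) auto
  finally show "dist (drop_deriv \<alpha> \<tau> x) (drop_deriv \<alpha> \<tau> y) \<le> (B + \<bar>ratio \<alpha> \<tau>\<bar>) * dist x y"
    using xy by (simp add: drop_deriv_truncate_at[OF \<alpha> \<tau>] dist_norm abs_le_iff)
qed (use B(1) in simp)

lemma drop_fun_C11_per:
  assumes \<alpha>: "0 \<le> \<alpha>" and \<tau>: "\<tau> \<in> radii \<alpha>"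
  shows "C11_per (drop_fun \<alpha> \<tau> c)"
proof -
  obtain B where B: "0 \<le> B" "\<And>t. \<bar>t\<bar> \<le> pi \<Longrightarrow> \<bar>dpartic \<alpha> t\<bar> \<le> B" using dpartic_bounded[OF \<alpha>] by blast
  show ?thesis
    unfolding C11_per_def deriv_drop_fun[OF \<alpha> \<tau>]
    using C1_per_I(1)[OF drop_fun_periodic(1) H1d_DERIV[OF drop_fun_H1d[OF \<alpha> \<tau>] drop_deriv_continuous[OF \<alpha> \<tau>]]
        drop_deriv_continuous[OF \<alpha> \<tau>]]
      drop_deriv_lipschitz[OF \<alpha> \<tau> B] by blast
qed

section \<open>Monotonicity in the angle and in the mass\<close>

lemma supp_drop_fun:
  assumes d: "is_droplet \<alpha> M \<tau> c" and x: "x \<in> supp (drop_fun \<alpha> \<tau> c)"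
  shows "arccos (cos x) \<le> \<tau>"
proof -
  have "drop_fun \<alpha> \<tau> c y = 0" if "\<tau> < arccos (cos y)" for y
    using d that arccos_cos_bounds(2)[of y] by (auto simp: is_droplet_def drop_fun_def min_def)
  then have "{y. drop_fun \<alpha> \<tau> c y \<noteq> 0} \<subseteq> {y. arccos (cos y) \<le> \<tau>}" by force
  moreover have "closed {y. arccos (cos y) \<le> \<tau>}"
    by (intro closed_Collect_le continuous_on_arccos_cos continuous_intros)
  ultimately show ?thesis using x closure_minimal unfolding supp_def by blast
qed

lemma drop_fun_strictly_decr:
  assumes \<alpha>: "0 \<le> \<alpha>" and d: "is_droplet \<alpha> M \<tau> c"
  shows "strictly_symm_decr_on_supp (drop_fun \<alpha> \<tau> c)"
  unfolding strictly_symm_decr_on_supp_def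
proof (intro conjI allI ballI impI drop_fun_even)
  fix x y assume x: "x \<in> supp (drop_fun \<alpha> \<tau> c) \<inter> {-pi..pi}" and y: "y \<in> supp (drop_fun \<alpha> \<tau> c) \<inter> {-pi..pi}"
    and xy: "\<bar>x\<bar> < \<bar>y\<bar>"
  have \<tau>: "\<tau> \<in> radii \<alpha>" using d by (simp add: is_droplet_def)
  have "\<bar>x\<bar> \<le> pi" "\<bar>y\<bar> \<le> pi" using x y by auto
  then have "\<bar>y\<bar> \<le> \<tau>" using supp_drop_fun[OF d, of y] y by (simp add: arccos_cos_abs)
  then show "drop_fun \<alpha> \<tau> c y < drop_fun \<alpha> \<tau> c x"
    using profile_strict_decr[OF \<alpha> \<tau>, of "\<bar>x\<bar>" "\<bar>y\<bar>"] xy \<open>\<bar>x\<bar> \<le> pi\<close> \<open>\<bar>y\<bar> \<le> pi\<close>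
    by (simp add: drop_fun_def arccos_cos_abs)
qed

text \<open>The mass orders the pairs of radius and constant: the radius grows first with
  \<open>c = 0\<close>, and \<open>c\<close> grows only after radius \<open>pi\<close> is
  reached.\<close>

lemma drop_fun_mono_mass:
  assumes \<alpha>: "0 \<le> \<alpha>" and d1: "is_droplet \<alpha> M1 \<tau>1 c1" and d2: "is_droplet \<alpha> M2 \<tau>2 c2" and M: "M1 < M2"
    and x: "arccos (cos x) \<le> \<tau>1"
  shows "drop_fun \<alpha> \<tau>1 c1 x < drop_fun \<alpha> \<tau>2 c2 x"
proof -
  have \<tau>: "\<tau>1 \<in> radii \<alpha>" "\<tau>2 \<in> radii \<alpha>" and c: "0 \<le> c1" "0 \<le> c2" "\<tau>1 < pi \<Longrightarrow> c1 = 0" "\<tau>2 < pi \<Longrightarrow> c2 = 0"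
    and m: "2 * pi * c1 + droplet_mass \<alpha> \<tau>1 = M1" "2 * pi * c2 + droplet_mass \<alpha> \<tau>2 = M2"
    using d1 d2 by (auto simp: is_droplet_def)
  have pos: "0 < \<tau>1" "\<tau>1 \<le> pi" "0 < \<tau>2" "\<tau>2 \<le> pi" using \<tau> by (auto simp: radii_def)
  consider "\<tau>1 = \<tau>2" | "\<tau>1 < \<tau>2" | "\<tau>2 < \<tau>1" by linarith
  then show ?thesis
  proof cases
    case 1
    have "2 * pi * c1 < 2 * pi * c2" using m M unfolding 1 by linarith
    then have "c1 < c2" by simp
    then show ?thesis using 1 by (simp add: drop_fun_def)
  next
    case 2
    then have "c1 = 0" using c pos by simp
    then show ?thesis
      using drop_fun_less_radius(2)[OF \<alpha> \<tau>(2) pos(1) 2 x] c(2) drop_fun_add_const[of \<alpha> \<tau>2 c2 x] by simp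
  next
    case 3
    then have "droplet_mass \<alpha> \<tau>2 < droplet_mass \<alpha> \<tau>1" using mass_less[OF \<alpha> \<tau>(1) pos(3) 3] by simp
    moreover have "c2 = 0" using 3 pos c by simp
    moreover have "0 \<le> 2 * pi * c1" using c by simp
    ultimately show ?thesis using m M by simp
  qed
qed

section \<open>Continuity in the mass\<close>

lemma larger_radius:
  assumes \<alpha>: "0 \<le> \<alpha>" and \<tau>: "\<tau> \<in> radii \<alpha>" "\<tau> < pi" and b: "\<tau> < b"
  obtains b' where "b' \<in> radii \<alpha>" "\<tau> < b'" "b' \<le> b" "b' < pi"
proof -
  have "\<forall>\<^sub>F t in at_right \<tau>. t < b" "\<forall>\<^sub>F t in at_right \<tau>. t < pi" "\<forall>\<^sub>F t in at_right \<tau>. \<tau> < t"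
    using b \<tau>(2) by (auto intro!: order_tendstoD(2)[OF tendsto_ident_at] simp: eventually_at_right_less)
  moreover have "((\<lambda>t. \<alpha> * t) \<longlongrightarrow> \<alpha> * \<tau>) (at_right \<tau>)" by (intro tendsto_intros)
  then have "\<forall>\<^sub>F t in at_right \<tau>. \<alpha> * t < pi" 
    by (rule order_tendstoD(2)) (use \<tau> in \<open>simp add: radii_def\<close>)
  ultimately have "\<forall>\<^sub>F t in at_right \<tau>. t < b \<and> t < pi \<and> \<tau> < t \<and> \<alpha> * t < pi" by eventually_elim simp
  then obtain t where t: "t < b" "t < pi" "\<tau> < t" "\<alpha> * t < pi"
    using eventually_happens'[of "at_right \<tau>"] by auto
  have "0 < t" using t \<tau> by (auto simp: radii_def)
  then show ?thesis using that[of t] t by (auto simp: radii_def)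
qed

text \<open>The radius inverts the strictly increasing mass, so comparison with the masses of
  slightly smaller and larger radii traps it.\<close>

lemma droplet_radius_tendsto:
  assumes \<alpha>: "0 \<le> \<alpha>" and d: "\<And>M. 0 < M \<Longrightarrow> is_droplet \<alpha> M (T M) (C M)" and M0: "0 < M0"
  shows "(T \<longlongrightarrow> T M0) (at M0)" and "(C \<longlongrightarrow> C M0) (at M0)"
proof -
  have T: "T M \<in> radii \<alpha>" "0 < T M" "T M \<le> pi" and C: "0 \<le> C M" "T M < pi \<Longrightarrow> C M = 0"
    and m: "2 * pi * C M + droplet_mass \<alpha> (T M) = M" if "0 < M" for M
    using d[OF that] by (auto simp: is_droplet_def radii_def)
  have ge: "droplet_mass \<alpha> (T M) \<le> M" if "0 < M" for M
  proof -
    have "0 \<le> 2 * pi * C M" using C[OF that] by simp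
    then show ?thesis using m[OF that] by linarith
  qed
  have eq: "droplet_mass \<alpha> (T M) = M" if "0 < M" "T M < pi" for M using C[OF that(1)] m[OF that(1)] that by simp
  have mono: "droplet_mass \<alpha> s \<le> droplet_mass \<alpha> t" if "0 < s" "s \<le> t" "t \<in> radii \<alpha>" for s t
    using mass_less[OF \<alpha> that(3,1)] that(2) by (cases "s = t") auto
  have Mpos: "\<forall>\<^sub>F M in at M0. 0 < M" using M0 by (intro order_tendstoD(1)[OF tendsto_ident_at])
  have low: "\<forall>\<^sub>F M in at M0. a < T M" if a: "a < T M0" for a
  proof (cases "0 < a")
    case True
    have "droplet_mass \<alpha> a < M0" using mass_less[OF \<alpha> T(1)[OF M0] True a] ge[OF M0] by simp
    then have "\<forall>\<^sub>F M in at M0. droplet_mass \<alpha> a < M" by (intro order_tendstoD(1)[OF tendsto_ident_at])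
    with Mpos show ?thesis
    proof eventually_elim
      case (elim M)
      show ?case
      proof (rule ccontr)
        assume "\<not> a < T M"
        then have le: "T M \<le> a" by simp
        moreover have "a \<in> radii \<alpha>" using radii_le[OF T(1)[OF M0] \<alpha> True] a by simp
        moreover have "T M < pi" using le a T(3)[OF M0] by simp
        ultimately show False using mono[OF T(2)[OF elim(1)], of a] eq[OF elim(1)] elim(2) by simp
      qed
    qed
  next
    case False
    from Mpos show ?thesis by eventually_elim (use T(2) False in force)
  qed
  have up: "\<forall>\<^sub>F M in at M0. T M < b" if b: "T M0 < b" for b
  proof (cases "T M0 < pi")
    case True
    obtain b' where b': "b' \<in> radii \<alpha>" "T M0 < b'" "b' \<le> b" "b' < pi"
        using larger_radius[OF \<alpha> T(1)[OF M0] True b] by blast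
    have "M0 < droplet_mass \<alpha> b'" using mass_less[OF \<alpha> b'(1) T(2)[OF M0] b'(2)] eq[OF M0 True] by simp
    then have "\<forall>\<^sub>F M in at M0. M < droplet_mass \<alpha> b'" by (intro order_tendstoD(2)[OF tendsto_ident_at])
    with Mpos show ?thesis
    proof eventually_elim
      case (elim M)
      show ?case
      proof (rule ccontr)
        assume "\<not> T M < b"
        then have "b' \<le> T M" using b' by simp
        then have "droplet_mass \<alpha> b' \<le> droplet_mass \<alpha> (T M)" using mono[OF _ _ T(1)[OF elim(1)]] b'(1)
            by (simp add: radii_def)
        then show False using ge[OF elim(1)] elim(2) by simp
      qed
    qed
  next
    case False
    then have "pi < b" using T(3)[OF M0] b by simp
    from Mpos show ?thesis by eventually_elim (use T(3) \<open>pi < b\<close> in force)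
  qed
  show "(T \<longlongrightarrow> T M0) (at M0)" by (rule order_tendstoI) (use low up in auto)
  show "(C \<longlongrightarrow> C M0) (at M0)"
  proof (cases "T M0 < pi")
    case True
    have "\<forall>\<^sub>F M in at M0. C M = C M0" using up[OF True] Mpos by eventually_elim (use C M0 True in simp)
    then show ?thesis by (rule tendsto_eventually)
  next
    case False
    then have pi: "T M0 = pi" using T(3)[OF M0] by simp
    \<comment> \<open>The constant is the mass in excess of the full droplet, spread over the
      circle. One formula serves both sides of the threshold.\<close>
    have CM: "C M = max 0 ((M - droplet_mass \<alpha> pi) / (2 * pi))" if M: "0 < M" for M
    proof (cases "T M < pi")
      case True
      have "M \<le> droplet_mass \<alpha> pi" using mono[OF T(2)[OF M] T(3)[OF M]] T(1)[OF M0] pi eq[OF M True] by simp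
      then have "(M - droplet_mass \<alpha> pi) / (2 * pi) \<le> 0" by (simp add: divide_nonpos_pos)
      then show ?thesis using C[OF M] True by simp
    next
      case False
      then have "C M = (M - droplet_mass \<alpha> pi) / (2 * pi)" using m[OF M] T(3)[OF M] by (simp add: field_simps)
      then show ?thesis using C[OF M] by simp
    qed
    have "((\<lambda>M. max 0 ((M - droplet_mass \<alpha> pi) / (2 * pi))) \<longlongrightarrow> max 0 ((M0 - droplet_mass \<alpha> pi) / (2 * pi))) (at M0)"
      by (intro tendsto_intros) auto
    then have "((\<lambda>M. max 0 ((M - droplet_mass \<alpha> pi) / (2 * pi))) \<longlongrightarrow> C M0) (at M0)" using CM[OF M0] by simp
    then show ?thesis
      by (rule Lim_transform_eventually) (use Mpos CM in \<open>auto elim!: eventually_mono\<close>)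
  qed
qed

text \<open>An interval that avoids the free boundary therefore contains no contact angle; this is
  the only inclusion that the convergence proof needs.\<close>

lemma frontier_drop_fun:
  assumes \<alpha>: "0 \<le> \<alpha>" and \<tau>: "\<tau> \<in> radii \<alpha>" and x: "arccos (cos x) = \<tau>"
  shows "x \<in> frontier {x. drop_fun \<alpha> \<tau> 0 x \<noteq> 0}"
proof -
  have \<tau>0: "0 < \<tau>" "\<tau> \<le> pi" using \<tau> by (auto simp: radii_def)
  have p: "periodic (\<lambda>x. arccos (cos x))" by (simp add: periodic_def)
  have w: "\<bar>wrap x\<bar> \<le> pi" using wrap_bounds[of x] by (auto simp: abs_le_iff)
  have wx: "\<bar>wrap x\<bar> = \<tau>" using arccos_cos_abs[OF w] wrap_of_periodic[OF p, of x] x by simp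
  have "x \<in> closure {x. drop_fun \<alpha> \<tau> 0 x \<noteq> 0}"
    unfolding closure_approachable
  proof (intro allI impI)
    fix e :: real assume e: "0 < e"
    define t where "t = min (e / 2) (\<tau> / 2)"
    have t: "0 < t" "t < e" "t < \<tau>" using e \<tau>0 by (auto simp: t_def min_def)
    \<comment> \<open>A small step from the contact point towards the centre of the droplet.\<close>
    define y where "y = x - t * sgn (wrap x)"
    have "\<bar>wrap x - t * sgn (wrap x)\<bar> = \<tau> - t" using wx t \<tau>0 by (auto simp: abs_if sgn_if split: if_splits)
    moreover have "arccos (cos y) = arccos (cos (wrap x - t * sgn (wrap x)))"
      using periodic_diff_int[OF p, of y "\<lfloor>(x + pi) / (2 * pi)\<rfloor>"] by (simp add: y_def wrap_def algebra_simps)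
    ultimately have "arccos (cos y) = \<tau> - t" using arccos_cos_abs[of "wrap x - t * sgn (wrap x)"] t \<tau>0 by simp
    then have "drop_fun \<alpha> \<tau> 0 y = profile \<alpha> \<tau> (\<tau> - t)" using t by (simp add: drop_fun_def min_def)
    moreover have "\<dots> > 0" using profile_pos[OF \<alpha> \<tau>, of "\<tau> - t"] t by simp
    moreover have "dist y x < e" using t by (auto simp: y_def dist_norm abs_mult sgn_if)
    ultimately show "\<exists>y\<in>{x. drop_fun \<alpha> \<tau> 0 x \<noteq> 0}. dist y x < e" by force
  qed
  moreover have "x \<notin> interior {x. drop_fun \<alpha> \<tau> 0 x \<noteq> 0}"
    using interior_subset[of "{x. drop_fun \<alpha> \<tau> 0 x \<noteq> 0}"] x by (auto simp: drop_fun_def)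
  ultimately show ?thesis by (simp add: frontier_def)
qed

text \<open>A change of mass acts on the derivative through \<open>ratio\<close> and through the
  clamp at the radius. The first effect is small in C^{1,1}, the second only uniformly; away from
  the free boundary the second one is absent.\<close>

lemma drop_fun_C11_tendsto:
  assumes \<alpha>: "0 \<le> \<alpha>" and d: "\<And>M. 0 < M \<Longrightarrow> is_droplet \<alpha> M (T M) (C M)" and M0: "0 < M0"
    and U: "\<And>M. 0 < M \<Longrightarrow> U M = drop_fun \<alpha> (T M) (C M)"
  shows "C11_tendsto U (U M0) (at M0)"
proof -
  have T: "T M \<in> radii \<alpha>" "0 < T M" "T M \<le> pi" and C: "0 \<le> C M" "T M < pi \<Longrightarrow> C M = 0" if "0 < M" for M
    using d[OF that] by (auto simp: is_droplet_def radii_def)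
  have dU: "deriv (U M) = drop_deriv \<alpha> (T M)" if "0 < M" for M
    using deriv_drop_fun[OF \<alpha> T(1)[OF that]] U[OF that] by simp
  note lim = droplet_radius_tendsto[OF \<alpha> d M0]
  have Mpos: "\<forall>\<^sub>F M in at M0. 0 < M" using M0 by (intro order_tendstoD(1)[OF tendsto_ident_at])
  have "isCont (ratio \<alpha>) (T M0)" using DERIV_ratio[OF \<alpha> T(1)[OF M0]] by (rule DERIV_isCont)
  then have rlim: "((\<lambda>M. ratio \<alpha> (T M)) \<longlongrightarrow> ratio \<alpha> (T M0)) (at M0)" using lim(1) by (rule isCont_tendsto_compose)
  obtain B where B: "0 \<le> B" "\<And>t. \<bar>t\<bar> \<le> pi \<Longrightarrow> \<bar>dpartic \<alpha> t\<bar> \<le> B" using dpartic_bounded[OF \<alpha>] by blast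
  \<comment> \<open>The first summand bounds the change of the coefficient, the second the
    displacement of the contact angle through the Lipschitz constant of the slope.\<close>
  define e where "e M = \<bar>ratio \<alpha> (T M) - ratio \<alpha> (T M0)\<bar> * pi + (B + \<bar>ratio \<alpha> (T M0)\<bar>) * \<bar>T M - T M0\<bar>" for M
  have "(e \<longlongrightarrow> \<bar>ratio \<alpha> (T M0) - ratio \<alpha> (T M0)\<bar> * pi + (B + \<bar>ratio \<alpha> (T M0)\<bar>) * \<bar>T M0 - T M0\<bar>) (at M0)"
    unfolding e_def by (intro tendsto_intros rlim lim)
  then have e_lim: "(e \<longlongrightarrow> 0) (at M0)" by simp
  have e_bound: "\<bar>drop_deriv \<alpha> (T M) x - drop_deriv \<alpha> (T M0) x\<bar> \<le> e M" if M: "0 < M" for M x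
  proof -
    have w: "\<bar>wrap x\<bar> \<le> pi" using wrap_bounds[of x] by (auto simp: abs_le_iff)
    let ?y = "truncate_at (T M) (wrap x)" and ?z = "truncate_at (T M0) (wrap x)"
    have y: "\<bar>?y\<bar> \<le> pi" "\<bar>?z\<bar> \<le> pi" using truncate_at_bound T(1) M M0 by blast+
    have "\<bar>slope \<alpha> (T M) ?y - slope \<alpha> (T M0) ?y\<bar> = \<bar>ratio \<alpha> (T M) - ratio \<alpha> (T M0)\<bar> * \<bar>homog \<alpha> ?y\<bar>"
      by (simp add: slope_def abs_mult[symmetric] abs_minus_commute algebra_simps)
    also have "\<dots> \<le> \<bar>ratio \<alpha> (T M) - ratio \<alpha> (T M0)\<bar> * pi"
      using homog_lipschitz[of \<alpha> ?y 0] y by (intro mult_left_mono) auto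
    finally have 1: "\<bar>slope \<alpha> (T M) ?y - slope \<alpha> (T M0) ?y\<bar> \<le> \<bar>ratio \<alpha> (T M) - ratio \<alpha> (T M0)\<bar> * pi" .
    have "\<bar>slope \<alpha> (T M0) ?y - slope \<alpha> (T M0) ?z\<bar> \<le> (B + \<bar>ratio \<alpha> (T M0)\<bar>) * \<bar>?y - ?z\<bar>"
      by (intro slope_lipschitz B(2) y)
    also have "\<dots> \<le> (B + \<bar>ratio \<alpha> (T M0)\<bar>) * \<bar>T M - T M0\<bar>" using B(1)
        by (intro mult_left_mono truncate_at_diff) auto
    finally have "\<bar>slope \<alpha> (T M) ?y - slope \<alpha> (T M0) ?z\<bar> \<le> e M" using 1 unfolding e_def by linarith
    moreover have "drop_deriv \<alpha> t x = slope \<alpha> t (truncate_at t (wrap x))" if "t \<in> radii \<alpha>" for t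
      using drop_deriv_truncate_at[OF \<alpha> that w] wrap_of_periodic[OF drop_fun_periodic(2), of \<alpha> t x] by simp
    ultimately show ?thesis using T(1) M M0 by simp
  qed
  have e_fun: "\<bar>drop_fun \<alpha> (T M) (C M) x - drop_fun \<alpha> (T M0) (C M0) x\<bar> \<le> \<bar>C M - C M0\<bar> + 2 * pi * e M"
    if M: "0 < M" for M x
  proof -
    define \<Delta> where "\<Delta> x = drop_fun \<alpha> (T M) (C M) x - drop_fun \<alpha> (T M0) (C M0) x" for x
    have D: "(\<Delta> has_real_derivative (drop_deriv \<alpha> (T M) x - drop_deriv \<alpha> (T M0) x)) (at x)" for x
      unfolding \<Delta>_def
      by (intro DERIV_diff H1d_DERIV[OF drop_fun_H1d drop_deriv_continuous] \<alpha> T(1) M M0)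
    have e0: "0 \<le> e M" using e_bound[OF M, of 0] abs_ge_zero order_trans by blast
    have "\<bar>\<Delta> (wrap x) - \<Delta> (-pi)\<bar> \<le> e M * \<bar>wrap x - (-pi)\<bar>"
      using field_differentiable_bound[of UNIV \<Delta> "\<lambda>x. drop_deriv \<alpha> (T M) x
          - drop_deriv \<alpha> (T M0) x" "e M" "wrap x" "-pi"] D e_bound[OF M] by simp
    also have "\<dots> \<le> e M * (2 * pi)" using wrap_bounds[of x] e0 by (intro mult_left_mono) auto
    finally have "\<bar>\<Delta> (wrap x) - \<Delta> (-pi)\<bar> \<le> 2 * pi * e M" by (simp add: algebra_simps)
    moreover have "\<Delta> (-pi) = C M - C M0"
      unfolding \<Delta>_def using drop_fun_off[OF T(1)[OF M], of "-pi"] drop_fun_off[OF T(1)[OF M0],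
          of "-pi"] T(3) M M0 by simp
    moreover have "\<Delta> (wrap x) = \<Delta> x"
      unfolding \<Delta>_def by (simp add: wrap_of_periodic[OF drop_fun_periodic(1)])
    ultimately show ?thesis unfolding \<Delta>_def by linarith
  qed
  show ?thesis unfolding C11_tendsto_def
  proof (intro conjI allI impI)
    show "uniform_limit UNIV U (U M0) (at M0)"
    proof (rule uniform_limitI)
      fix \<epsilon> :: real assume \<epsilon>: "0 < \<epsilon>"
      have "((\<lambda>M. \<bar>C M - C M0\<bar> + 2 * pi * e M) \<longlongrightarrow> \<bar>C M0 - C M0\<bar> + 2 * pi * 0) (at M0)"
        by (intro tendsto_intros lim e_lim)
      then have "\<forall>\<^sub>F M in at M0. \<bar>C M - C M0\<bar> + 2 * pi * e M < \<epsilon>" using \<epsilon> by (intro order_tendstoD(2)) auto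
      with Mpos show "\<forall>\<^sub>F M in at M0. \<forall>x\<in>UNIV. dist (U M x) (U M0 x) < \<epsilon>"
      proof eventually_elim
        case (elim M)
        show ?case
          unfolding U[OF elim(1)] U[OF M0] dist_norm real_norm_def
          using order_le_less_trans[OF e_fun[OF elim(1)] elim(2)] by blast
      qed
    qed
    show "uniform_limit UNIV (\<lambda>M. deriv (U M)) (deriv (U M0)) (at M0)"
    proof (rule uniform_limitI)
      fix \<epsilon> :: real assume \<epsilon>: "0 < \<epsilon>"
      have "\<forall>\<^sub>F M in at M0. e M < \<epsilon>" using \<epsilon> e_lim by (intro order_tendstoD(2))
      with Mpos show "\<forall>\<^sub>F M in at M0. \<forall>x\<in>UNIV. dist (deriv (U M) x) (deriv (U M0) x) < \<epsilon>"
      proof eventually_elim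
        case (elim M)
        show ?case
          unfolding dU[OF elim(1)] dU[OF M0] dist_norm real_norm_def
          using order_le_less_trans[OF e_bound[OF elim(1)] elim(2)] by blast
      qed
    qed
    show "\<exists>L. \<forall>\<^sub>F M in at M0. L-lipschitz_on UNIV (deriv (U M))"
    proof (intro exI)
      have "\<forall>\<^sub>F M in at M0. \<bar>ratio \<alpha> (T M)\<bar> < \<bar>ratio \<alpha> (T M0)\<bar> + 1"
        by (intro order_tendstoD(2)[OF tendsto_rabs[OF rlim]]) simp
      with Mpos show "\<forall>\<^sub>F M in at M0. (B + (\<bar>ratio \<alpha> (T M0)\<bar> + 1))-lipschitz_on UNIV (deriv (U M))"
      proof eventually_elim
        case (elim M)
        have "(B + \<bar>ratio \<alpha> (T M)\<bar>)-lipschitz_on UNIV (deriv (U M))"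
          unfolding dU[OF elim(1)] by (rule drop_deriv_lipschitz[OF \<alpha> T(1)[OF elim(1)] B])
        then show ?case by (rule lipschitz_on_mono) (use elim in auto)
      qed
    qed
    fix a b \<epsilon> :: real assume fr: "{a..b} \<inter> frontier {\<theta>. U M0 \<theta> \<noteq> 0} = {}" and \<epsilon>: "0 < \<epsilon>"
    have zero: "\<epsilon>-lipschitz_on {a..b} (\<lambda>\<theta>. deriv (U M) \<theta> - deriv (U M0) \<theta>)"
      if "\<And>x. x \<in> {a..b} \<Longrightarrow> deriv (U M) x = deriv (U M0) x" for M
      using that \<epsilon> by (intro lipschitz_onI) auto
    show "\<forall>\<^sub>F M in at M0. \<epsilon>-lipschitz_on {a..b} (\<lambda>\<theta>. deriv (U M) \<theta> - deriv (U M0) \<theta>)"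
    \<comment> \<open>Above the threshold nearby minimizers differ by a constant only, so their
      derivatives coincide.\<close>
    proof (cases "0 < C M0")
      case True
      then have "\<forall>\<^sub>F M in at M0. 0 < C M" by (intro order_tendstoD(1)[OF lim(2)])
      with Mpos show ?thesis
      proof eventually_elim
        case (elim M)
        have "T M = pi" "T M0 = pi" using C(2)[OF elim(1)] C(2)[OF M0] T(3)[OF elim(1)] T(3)[OF M0] elim(2)
            True by force+
        then show ?case using dU[OF elim(1)] dU[OF M0] by (intro zero) simp
      qed
    next
      case False
      then have C0: "C M0 = 0" using C(1)[OF M0] by simp
      let ?s = "\<lambda>x. arccos (cos x)" and ?t = "T M0"
      have p: "periodic ?s" by (simp add: periodic_def)
      have avoid: "?s x \<noteq> ?t" if "x \<in> {a..b}" for x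
        using frontier_drop_fun[OF \<alpha> T(1)[OF M0], of x] fr that U[OF M0] C0 by auto
      have ivt: "\<exists>z. min x y \<le> z \<and> z \<le> max x y \<and> ?s z = ?t" if "?s x \<le> ?t" "?t \<le> ?s y" for x y
      proof (cases "x \<le> y")
        case True
        then show ?thesis using IVT'[of ?s x ?t y] that continuous_on_arccos_cos by (auto simp: min_def max_def)
      next
        case False
        then show ?thesis using IVT2'[of ?s x ?t y] that continuous_on_arccos_cos by (auto simp: min_def max_def)
      qed
      show ?thesis
      proof (cases "a \<le> b")
        case ab: True
        have side: "?s x < ?t \<longleftrightarrow> ?s y < ?t" if xy: "x \<in> {a..b}" "y \<in> {a..b}" for x y
        proof -
          have "?s y < ?t" if s: "?s x < ?t" "x \<in> {a..b}" "y \<in> {a..b}" for x y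
          proof (rule ccontr)
            assume "\<not> ?s y < ?t"
            then obtain z where "min x y \<le> z" "z \<le> max x y" "?s z = ?t" using ivt[of x y] s by auto
            then show False using avoid[of z] s by (auto simp: min_def max_def split: if_splits)
          qed
          then show ?thesis using xy by blast
        qed
        \<comment> \<open>The extreme distances over the compact interval provide the margin that
          keeps it on one side of the contact angle for all nearby masses.\<close>
        obtain m n where mn: "m \<in> {a..b}" "n \<in> {a..b}" "\<And>x. x \<in> {a..b} \<Longrightarrow> ?s m \<le> ?s x" "\<And>x. x \<in> {a..b} \<Longrightarrow> ?s x
            \<le> ?s n"
          using continuous_attains_inf[of "{a..b}" ?s] continuous_attains_sup[of "{a..b}" ?s] ab
              continuous_on_arccos_cos by force
        show ?thesis
        proof (cases "?s a < ?t")
          case True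
          then have "?s n < ?t" using side[of a n] mn ab by simp
          then have "\<forall>\<^sub>F M in at M0. ?s n < T M" by (intro order_tendstoD(1)[OF lim(1)])
          moreover have "((\<lambda>M. \<bar>ratio \<alpha> (T M) - ratio \<alpha> (T M0)\<bar>) \<longlongrightarrow> \<bar>ratio \<alpha> (T M0) - ratio \<alpha> (T M0)\<bar>) (at M0)"
            by (intro tendsto_intros rlim)
          then have "\<forall>\<^sub>F M in at M0. \<bar>ratio \<alpha> (T M) - ratio \<alpha> (T M0)\<bar> < \<epsilon>" using \<epsilon>
              by (intro order_tendstoD(2)) auto
          ultimately show ?thesis using Mpos
          proof eventually_elim
            case (elim M)
            define k where "k = \<lfloor>(a + pi) / (2 * pi)\<rfloor>"
            have wa: "a - 2 * pi * of_int k = wrap a" by (simp add: wrap_def k_def)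
            have "\<bar>wrap a\<bar> \<le> pi" using wrap_bounds[of a] by (auto simp: abs_le_iff)
            then have wa_abs: "\<bar>wrap a\<bar> < ?t" using True arccos_cos_abs wrap_of_periodic[OF p, of a] by simp
            \<comment> \<open>The interval stays inside one period copy of the droplet: leaving it
              would mean crossing a translate of the contact angle. Hence one shift \<open>k\<close>
              serves all its points.\<close>
            have in_t: "\<bar>x - 2 * pi * of_int k\<bar> < ?t" if x: "x \<in> {a..b}" for x
            proof -
              have "x - 2 * pi * of_int k < ?t"
              proof (rule ccontr)
                assume "\<not> x - 2 * pi * of_int k < ?t"
                then have "?t + 2 * pi * of_int k \<in> {a..b}" using x wa_abs wa by auto
                moreover have "?s (?t + 2 * pi * of_int k) = ?t"
                  using periodic_add_int[OF p, of ?t k] arccos_cos_abs[of ?t] T(2,3)[OF M0] by simp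
                ultimately show False using avoid by blast
              qed
              moreover have "- ?t < x - 2 * pi * of_int k" using x wa_abs wa by auto
              ultimately show ?thesis by (simp add: abs_less_iff)
            qed
            have diff: "deriv (U M) x - deriv (U M0) x = (ratio \<alpha> (T M0) - ratio \<alpha> (T M)) * homog \<alpha> (x
                - 2 * pi * of_int k)"
              if x: "x \<in> {a..b}" for x
            proof -
              let ?z = "x - 2 * pi * of_int k"
              have z: "\<bar>?z\<bar> < ?t" "\<bar>?z\<bar> \<le> pi" using in_t[OF x] T(3)[OF M0] by auto
              have "\<bar>?z\<bar> = ?s x" using arccos_cos_abs[OF z(2)] periodic_diff_int[OF p, of x k] by simp
              also have "\<dots> < T M" using mn(4)[OF x] elim(1) by simp
              finally have zM: "\<bar>?z\<bar> < T M" .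
              have "drop_deriv \<alpha> t x = slope \<alpha> t ?z" if "t \<in> radii \<alpha>" "\<bar>?z\<bar> < t" for t
                using drop_deriv_truncate_at[OF \<alpha> that(1) z(2)] periodic_diff_int[OF drop_fun_periodic(2),
                    of \<alpha> t x k] that(2)
                by (simp add: truncate_at_def abs_less_iff)
              then show ?thesis
                unfolding dU[OF elim(3)] dU[OF M0] using T(1)[OF elim(3)] T(1)[OF M0] zM z(1)
                by (simp add: slope_def algebra_simps)
            qed
            show ?case
            proof (rule lipschitz_onI)
              fix x y assume xy: "x \<in> {a..b}" "y \<in> {a..b}"
              let ?h = "\<lambda>x. homog \<alpha> (x - 2 * pi * of_int k)"
              have "dist (deriv (U M) x - deriv (U M0) x) (deriv (U M) y - deriv (U M0) y)
                  = \<bar>ratio \<alpha> (T M) - ratio \<alpha> (T M0)\<bar> * \<bar>?h x - ?h y\<bar>"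
                unfolding diff[OF xy(1)] diff[OF xy(2)] dist_norm real_norm_def right_diff_distrib[symmetric]
                    abs_mult
                by (simp add: abs_minus_commute)
              also have "\<dots> \<le> \<epsilon> * \<bar>x - y\<bar>"
                using homog_lipschitz[of \<alpha> "x - 2 * pi * of_int k" "y - 2 * pi * of_int k"] elim(2) \<epsilon>
                by (intro mult_mono) auto
              finally show "dist (deriv (U M) x - deriv (U M0) x) (deriv (U M) y - deriv (U M0) y) \<le> \<epsilon> * dist x y"
                by (simp add: dist_norm)
            qed (use \<epsilon> in simp)
          qed
        next
          case False
          then have "\<not> ?s m < ?t" using side[of a m] mn ab by simp
          then have "?t < ?s m" using avoid[OF mn(1)] by simp
          then have "\<forall>\<^sub>F M in at M0. T M < ?s m" by (intro order_tendstoD(2)[OF lim(1)])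
          with Mpos show ?thesis
          proof eventually_elim
            case (elim M)
            have "drop_deriv \<alpha> t x = 0" if "t \<in> radii \<alpha>" "t < ?s m" "x \<in> {a..b}" for t x
              using mn(3)[OF that(3)] that slope_end[OF \<alpha> that(1)] by (simp add: drop_deriv_def min_def)
            then show ?case
              using dU[OF elim(1)] dU[OF M0] T(1)[OF elim(1)] T(1)[OF M0] elim(2) \<open>?t < ?s m\<close> by (intro zero) simp
          qed
        qed
      next
        case False
        then show ?thesis using zero by (auto intro: always_eventually)
      qed
    qed
  qed
qed

section \<open>The explicit formula and its limit at \<alpha> = 0\<close>

lemma droplet_pos_eq_profile:
  assumes \<alpha>: "0 < \<alpha>" and \<tau>: "\<tau> \<in> radii \<alpha>"
  shows "droplet_pos \<alpha> \<tau> \<theta> = profile \<alpha> \<tau> \<theta>"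
proof -
  have "0 < sin (\<alpha> * \<tau>)" using \<tau> \<alpha> by (intro sin_gt_zero) (auto simp: radii_def)
  then have s: "sin (\<alpha> * \<tau>) \<noteq> 0" by simp
  show ?thesis
  proof (cases "\<alpha> = 1")
    case True
    have "(u0 1 has_real_derivative - (sin \<tau> + \<tau> * cos \<tau>) / 2) (at \<tau>)"
      unfolding u0_def[abs_def] by (auto intro!: derivative_eq_intros simp: field_simps)
    then have D: "deriv (u0 1) \<tau> = - (sin \<tau> + \<tau> * cos \<tau>) / 2" by (rule DERIV_imp_deriv)
    have "droplet_pos 1 \<tau> \<theta> = profile 1 \<tau> \<theta>"
      unfolding droplet_pos_def coeff_A_def D u0_def profile_def ratio_def partic_def homog_def ipartic_def
          ihomog_def
      using s True by (simp add: field_simps)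
    then show ?thesis using True by simp
  next
    case False
    define q where "q = 1 / (1 - \<alpha>\<^sup>2)"
    define c where "c = (1 + \<alpha>\<^sup>2) / (2 * \<alpha>)"
    have u0: "u0 \<alpha> t = q * (cos t - c * cos (\<alpha> * t))" for t using False by (simp add: u0_def q_def c_def)
    have "(u0 \<alpha> has_real_derivative q * (- sin \<tau> + c * (\<alpha> * sin (\<alpha> * \<tau>)))) (at \<tau>)"
      unfolding u0[abs_def] by (auto intro!: derivative_eq_intros)
    then have "deriv (u0 \<alpha>) \<tau> = q * (- sin \<tau> + c * (\<alpha> * sin (\<alpha> * \<tau>)))" by (rule DERIV_imp_deriv)
    \<comment> \<open>The term \<open>q * c\<close> cancels the multiple of
      \<open>cos (\<alpha> * \<theta>)\<close> contained in \<open>u0\<close>, so the formula does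
      not depend on that choice of particular solution.\<close>
    then have A: "coeff_A \<alpha> \<tau> = - (q * sin \<tau>) / (\<alpha> * sin (\<alpha> * \<tau>)) + q * c"
      unfolding coeff_A_def using s \<alpha> by (simp add: field_simps)
    have "profile \<alpha> \<tau> \<theta> = q * cos \<theta> - q * cos \<tau> + (- (q * sin \<tau>) / (sin (\<alpha> * \<tau>) / \<alpha>)) * ((cos (\<alpha> * \<theta>)
        - cos (\<alpha> * \<tau>)) / \<alpha>\<^sup>2)"
      using False \<alpha> by (simp add: profile_def ratio_def partic_def homog_def ipartic_def ihomog_def q_def
          diff_divide_distrib)
    also have "(- (q * sin \<tau>) / (sin (\<alpha> * \<tau>) / \<alpha>)) * ((cos (\<alpha> * \<theta>) - cos (\<alpha> * \<tau>)) / \<alpha>\<^sup>2)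
       = - (q * sin \<tau>) / (\<alpha> * sin (\<alpha> * \<tau>)) * (cos (\<alpha> * \<theta>) - cos (\<alpha> * \<tau>))"
      using s \<alpha> by (simp add: field_simps power2_eq_square)
    finally show ?thesis unfolding droplet_pos_def u0 A by (simp add: algebra_simps)
  qed
qed

lemma ihomog_tendsto: "((\<lambda>a. ihomog a t) \<longlongrightarrow> ihomog 0 t) (at_right 0)"
proof (cases "t = 0")
  case False
  have "((\<lambda>a. (cos (a * t) - 1) / a\<^sup>2) \<longlongrightarrow> - (t * t / 2)) (at_right 0)"
    using False by real_asymp
  then have "((\<lambda>a. ihomog a t) \<longlongrightarrow> - (t * t / 2)) (at_right 0)"
    by (rule Lim_transform_eventually) (auto simp: eventually_at_filter ihomog_def)
  then show ?thesis by (simp add: ihomog_def power2_eq_square)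
next
  case True
  have "ihomog a 0 = 0" for a by (simp add: ihomog_def)
  then show ?thesis using True by simp
qed

lemma droplet_eq_profile:
  assumes \<alpha>: "0 \<le> \<alpha>" and \<tau>: "\<tau> \<in> radii \<alpha>"
  shows "droplet \<alpha> \<tau> \<theta> = profile \<alpha> \<tau> \<theta>"
proof (cases "\<alpha> = 0")
  case True
  have \<tau>0: "0 < \<tau>" "\<tau> \<le> pi" using \<tau> by (auto simp: radii_def)
  have "((\<lambda>a. sin (a * \<tau>) / a) \<longlongrightarrow> \<tau>) (at_right 0)" using \<tau>0(1) by real_asymp
  then have "((\<lambda>a. homog a \<tau>) \<longlongrightarrow> \<tau>) (at_right 0)"
    by (rule Lim_transform_eventually) (auto simp: eventually_at_filter homog_def)
  then have homog: "((\<lambda>a. homog a \<tau>) \<longlongrightarrow> homog 0 \<tau>) (at_right 0)" by (simp add: homog_def)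
  \<comment> \<open>For \<open>a < 1\<close> every radius up to \<open>pi\<close> is admissible, so
    the formula for positive parameters applies along the limit.\<close>
  have small: "\<forall>\<^sub>F a::real in at_right 0. a \<in> {0<..<1}" by (rule eventually_at_right_real) simp
  have ip: "((\<lambda>a. ipartic a t) \<longlongrightarrow> ipartic 0 t) (at_right 0)"
      and pa: "((\<lambda>a. partic a t) \<longlongrightarrow> partic 0 t) (at_right 0)" for t
  proof -
    have "((\<lambda>a. cos t / (1 - a\<^sup>2)) \<longlongrightarrow> cos t / (1 - 0\<^sup>2)) (at_right 0)" "((\<lambda>a. - sin t / (1 - a\<^sup>2)) \<longlongrightarrow>
        - sin t / (1 - 0\<^sup>2)) (at_right 0)"
      by (intro tendsto_intros; simp)+
    then show "((\<lambda>a. ipartic a t) \<longlongrightarrow> ipartic 0 t) (at_right 0)" "((\<lambda>a. partic a t) \<longlongrightarrow> partic 0 t) (at_right 0)"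
      using small by (auto simp: ipartic_def partic_def elim!: Lim_transform_eventually eventually_mono)
  qed
  have "((\<lambda>a. profile a \<tau> \<theta>) \<longlongrightarrow> profile 0 \<tau> \<theta>) (at_right 0)"
    unfolding profile_def ratio_def
    using \<tau>0 by (intro tendsto_intros ip pa homog ihomog_tendsto) (simp add: homog_def)
  moreover have "\<forall>\<^sub>F a in at_right 0. profile a \<tau> \<theta> = droplet_pos a \<tau> \<theta>"
    using small
  proof eventually_elim
    case (elim a)
    then have "a * \<tau> < 1 * pi" using \<tau>0 by (intro mult_less_le_imp_less) auto
    then have "\<tau> \<in> radii a" using \<tau>0 by (simp add: radii_def)
    then show ?case using droplet_pos_eq_profile[of a \<tau> \<theta>] elim by simp
  qed
  ultimately have "((\<lambda>a. droplet_pos a \<tau> \<theta>) \<longlongrightarrow> profile 0 \<tau> \<theta>) (at_right 0)"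
    by (rule Lim_transform_eventually)
  then have "Lim (at_right 0) (\<lambda>a. droplet_pos a \<tau> \<theta>) = profile 0 \<tau> \<theta>" by (intro tendsto_Lim) simp
  then show ?thesis using True by (simp add: droplet_def)
next
  case False
  then show ?thesis using droplet_pos_eq_profile[of \<alpha> \<tau> \<theta>] \<alpha> \<tau> by (simp add: droplet_def)
qed

lemma drop_fun_pi:
  assumes "0 \<le> \<alpha>" "\<alpha> < 1"
  shows "drop_fun \<alpha> pi c x = c + (1 + cos x) / (1 - \<alpha>\<^sup>2)"
  using arccos_cos_bounds(2)[of x] ratio_at_pi(2)[OF assms] by (simp add: drop_fun_def min.absorb2)

theorem theorem1:
  fixes \<alpha> :: real
  assumes "\<alpha> \<ge> 0"
  shows
    "(\<forall>M>0. \<exists>!u. minimizer \<alpha> M u) \<and>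
     (\<forall>M>0. \<forall>u. minimizer \<alpha> M u \<longrightarrow> strictly_symm_decr_on_supp u \<and> C11_per u) \<and>
     (\<forall>U. (\<forall>M>0. minimizer \<alpha> M (U M)) \<longrightarrow> (\<forall>M>0. C11_tendsto U (U M) (at M))) \<and>
     (\<forall>M1 M2 u1 u2. 0 < M1 \<longrightarrow> 0 < M2 \<longrightarrow> minimizer \<alpha> M1 u1 \<longrightarrow> minimizer \<alpha> M2 u2 \<longrightarrow>
        M1 < M2 \<longrightarrow> (\<forall>\<theta>\<in>supp u1. u1 \<theta> < u2 \<theta>)) \<and>
     (\<forall>M>0. M * (1 - \<alpha>\<^sup>2) > 2 * pi \<longrightarrow>
        (\<forall>u. minimizer \<alpha> M u \<longrightarrow>
           (\<forall>\<theta>. u \<theta> > 0 \<and> u \<theta> = M / (2 * pi) + 1 / (1 - \<alpha>\<^sup>2) * cos \<theta>))) \<and>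
     (\<forall>M>0. M * (1 - \<alpha>\<^sup>2) < 2 * pi \<longrightarrow>
        (\<forall>u. minimizer \<alpha> M u \<longrightarrow>
           (\<exists>\<tau>>0. max \<alpha> 1 * \<tau> < pi \<and>
              (\<forall>\<theta>. \<bar>\<theta>\<bar> \<le> \<tau> \<longrightarrow> u \<theta> = droplet \<alpha> \<tau> \<theta>) \<and>
              (\<forall>\<theta>. \<tau> \<le> \<bar>\<theta>\<bar> \<and> \<bar>\<theta>\<bar> \<le> pi \<longrightarrow> u \<theta> = 0)))) \<and>
     (\<forall>M>0. M * (1 - \<alpha>\<^sup>2) = 2 * pi \<longrightarrow>
        (\<forall>\<theta>. \<bar>\<theta>\<bar> \<le> pi \<longrightarrow>
           droplet \<alpha> pi \<theta> = M / (2 * pi) + 1 / (1 - \<alpha>\<^sup>2) * cos \<theta>) \<and>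
        (\<forall>u. minimizer \<alpha> M u \<longrightarrow> (\<forall>\<theta>. u \<theta> = (1 + cos \<theta>) / (1 - \<alpha>\<^sup>2))))"
proof -
  have \<alpha>: "0 \<le> \<alpha>" using assms by simp
  have "\<exists>\<tau> c. is_droplet \<alpha> M \<tau> c" if "0 < M" for M
    using is_droplet_exists[OF \<alpha> that] by (meson not_le)
  \<comment> \<open>One radius and one constant per mass; uniqueness, regularity and the dependence
    on the mass become statements on \<open>drop_fun \<alpha> (T M) (C M)\<close>.\<close>
  then obtain T C where d: "\<And>M. 0 < M \<Longrightarrow> is_droplet \<alpha> M (T M) (C M)" by metis
  have iff: "minimizer \<alpha> M u \<longleftrightarrow> u = drop_fun \<alpha> (T M) (C M)" if "0 < M" for M u
    using minimizer_iff_droplet[OF \<alpha> that d[OF that]] .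
  have r: "T M \<in> radii \<alpha>" if "0 < M" for M using d[OF that] by (simp add: is_droplet_def)
  show ?thesis
  proof (intro conjI allI impI)
    fix M :: real assume M: "0 < M"
    show "\<exists>!u. minimizer \<alpha> M u" using iff[OF M] by simp
  next
    fix M :: real and u assume M: "0 < M" and u: "minimizer \<alpha> M u"
    show "strictly_symm_decr_on_supp u" "C11_per u"
      using u iff[OF M] drop_fun_strictly_decr[OF \<alpha> d[OF M]] drop_fun_C11_per[OF \<alpha> r[OF M]] by simp_all
  next
    fix U and M :: real assume U: "\<forall>M>0. minimizer \<alpha> M (U M)" and M: "0 < M"
    show "C11_tendsto U (U M) (at M)"
      by (rule drop_fun_C11_tendsto[OF \<alpha> d M]) (use U iff in auto)
  next
    fix M1 M2 :: real and u1 u2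
    assume M: "0 < M1" "0 < M2" "M1 < M2" and u: "minimizer \<alpha> M1 u1" "minimizer \<alpha> M2 u2"
    show "\<forall>\<theta>\<in>supp u1. u1 \<theta> < u2 \<theta>"
      using drop_fun_mono_mass[OF \<alpha> d[OF M(1)] d[OF M(2)] M(3)] supp_drop_fun[OF d[OF M(1)]] u iff M by simp
  next
    fix M \<theta> :: real and u assume M: "0 < M" "2 * pi < M * (1 - \<alpha>\<^sup>2)" and u: "minimizer \<alpha> M u"
    have a: "\<alpha> < 1" and dr: "is_droplet \<alpha> M pi (M / (2 * pi) - 1 / (1 - \<alpha>\<^sup>2))"
      using is_droplet_exists(2)[OF \<alpha> M(1)] M(2) by simp_all
    have s: "0 < 1 - \<alpha>\<^sup>2" using \<alpha> a by (simp add: abs_square_less_1)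
    have eq: "u \<theta> = M / (2 * pi) - 1 / (1 - \<alpha>\<^sup>2) + (1 + cos \<theta>) / (1 - \<alpha>\<^sup>2)"
      using minimizer_iff_droplet[OF \<alpha> M(1) dr] u drop_fun_pi[OF \<alpha> a] by simp
    then show "u \<theta> = M / (2 * pi) + 1 / (1 - \<alpha>\<^sup>2) * cos \<theta>" by (simp add: add_divide_distrib)
    have "1 / (1 - \<alpha>\<^sup>2) < M / (2 * pi)" using M(2) s by (simp add: field_simps)
    moreover have "0 \<le> (1 + cos \<theta>) / (1 - \<alpha>\<^sup>2)" using s cos_ge_minus_one[of \<theta>]
        by (intro divide_nonneg_pos) linarith+
    ultimately show "0 < u \<theta>" using eq by linarith
  next
    fix M :: real and u assume M: "0 < M" "M * (1 - \<alpha>\<^sup>2) < 2 * pi" and u: "minimizer \<alpha> M u"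
    obtain \<tau> where \<tau>: "\<tau> < pi" "is_droplet \<alpha> M \<tau> 0" using is_droplet_exists(1)[OF \<alpha> M] by auto
    have rad: "\<tau> \<in> radii \<alpha>" using \<tau>(2) by (simp add: is_droplet_def)
    have eq: "u = drop_fun \<alpha> \<tau> 0" using minimizer_iff_droplet[OF \<alpha> M(1) \<tau>(2)] u by simp
    show "\<exists>\<tau>>0. max \<alpha> 1 * \<tau> < pi \<and>
              (\<forall>\<theta>. \<bar>\<theta>\<bar> \<le> \<tau> \<longrightarrow> u \<theta> = droplet \<alpha> \<tau> \<theta>) \<and>
              (\<forall>\<theta>. \<tau> \<le> \<bar>\<theta>\<bar> \<and> \<bar>\<theta>\<bar> \<le> pi \<longrightarrow> u \<theta> = 0)"
    proof (intro exI conjI allI impI)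
      show "0 < \<tau>" using rad by (simp add: radii_def)
      show "max \<alpha> 1 * \<tau> < pi" using rad \<tau>(1) by (auto simp: radii_def max_def)
      show "u \<theta> = droplet \<alpha> \<tau> \<theta>" if "\<bar>\<theta>\<bar> \<le> \<tau>" for \<theta>
        using drop_fun_on[OF that, of \<alpha> 0] \<tau>(1) droplet_eq_profile[OF \<alpha> rad] eq by simp
      show "u \<theta> = 0" if "\<tau> \<le> \<bar>\<theta>\<bar> \<and> \<bar>\<theta>\<bar> \<le> pi" for \<theta>
        using drop_fun_off[OF rad, of \<theta> 0] that eq by simp
    qed
  next
    fix M \<theta> :: real assume M: "0 < M" "M * (1 - \<alpha>\<^sup>2) = 2 * pi"
    have a: "\<alpha> < 1" using is_droplet_exists(2)[OF \<alpha> M(1)] M(2) by simp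
    have s: "0 < 1 - \<alpha>\<^sup>2" using \<alpha> a by (simp add: abs_square_less_1)
    have "M / (2 * pi) = 1 / (1 - \<alpha>\<^sup>2)" using M(2) s by (simp add: field_simps)
    moreover have "pi \<in> radii \<alpha>" using pi_in_radii[OF \<alpha>] a by simp
    ultimately show "droplet \<alpha> pi \<theta> = M / (2 * pi) + 1 / (1 - \<alpha>\<^sup>2) * cos \<theta>"
      using droplet_eq_profile[OF \<alpha>] ratio_at_pi(2)[OF \<alpha> a] by (simp add: add_divide_distrib)
  next
    fix M \<theta> :: real and u assume M: "0 < M" "M * (1 - \<alpha>\<^sup>2) = 2 * pi" and u: "minimizer \<alpha> M u"
    have a: "\<alpha> < 1" and dr: "is_droplet \<alpha> M pi (M / (2 * pi) - 1 / (1 - \<alpha>\<^sup>2))"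
      using is_droplet_exists(2)[OF \<alpha> M(1)] M(2) by simp_all
    have s: "0 < 1 - \<alpha>\<^sup>2" using \<alpha> a by (simp add: abs_square_less_1)
    have "M / (2 * pi) = 1 / (1 - \<alpha>\<^sup>2)" using M(2) s by (simp add: field_simps)
    then show "u \<theta> = (1 + cos \<theta>) / (1 - \<alpha>\<^sup>2)"
      using minimizer_iff_droplet[OF \<alpha> M(1) dr] u drop_fun_pi[OF \<alpha> a] by simp
  qed
qed

end
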